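(* Let $p$ be an odd prime, let $r\in\mathbb{N}$ (with $r\geq 1$), let $p-1=2^jd$, where $d$ is odd, let $d_1$ be a divisor of $d$, and let $G$ be a group of the form $\mathbb{Z}_{p^r}\rtimes_{\theta}\mathbb{Z}_{d_1}$, where $\theta\colon\mathbb{Z}_{d_1}\to\operatorname{Aut}(\mathbb{Z}_{p^r})$ is injective. (a) If $p\geq 3$, then $G$ embeds in $B_{p^r}/\Gamma_2(P_{p^r})$. (b) If $p\geq 5$ and $d_1$ satisfies $\gcd(d_1,3)=1$, then $G$ embeds in $B_{p^r}/\Gamma_3(P_{p^r})$.
   Context: For $n\in\mathbb{N}$, $B_n$ denotes the Artin braid group on $n$ strings, with generators $\sigma_1,\ldots,\sigma_{n-1}$ and relations $\sigma_i\sigma_j=\sigma_j\sigma_i$ for $|i-j|\geq 2$ and $\sigma_i\sigma_{i+1}\sigma_i=\sigma_{i+1}\sigma_i\sigma_{i+1}$ for $1\leq i\leq n-2$. The pure braid group $P_n$ is the kernel of the surjective homomorphism $\sigma\colon B_n\to S_n$ onto the symmetric group given by $\sigma(\sigma_i)=(i,i+1)$. For a group $\Pi$, the lower central series is defined by $\Gamma_1(\Pi)=\Pi$ and $\Gamma_k(\Pi)=[\Gamma_{k-1}(\Pi),\Pi]$ for $k\geq 2$. Since $P_n$ is normal in $B_n$, $\Gamma_k(P_n)$ is normal in $B_n$, so the quotient $B_n/\Gamma_k(P_n)$ is a group. $\mathbb{Z}_q$ denotes the cyclic group of order $q$. A group $G$ embeds in a group $\Pi$ if there is an injective homomorphism $G\to\Pi$.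 *)

theory Defs
  imports "HOL-Algebra.Algebra" "HOL-Computational_Algebra.Primes"
begin

section \<open>Groups given by generators and relations\<close>

text \<open>A letter \<open>(x, True)\<close> stands for the generator \<open>x\<close>, and \<open>(x, False)\<close> for its inverse.\<close>

type_synonym 'a word = "('a \<times> bool) list"

abbreviation words :: "'a set \<Rightarrow> 'a word set"
  where "words S \<equiv> lists (S \<times> UNIV)"

abbreviation pos_word :: "'a list \<Rightarrow> 'a word"
  where "pos_word xs \<equiv> map (\<lambda>x. (x, True)) xs"

text \<open>The congruence on words generated by free cancellation and by the defining relations
  \<open>u = v\<close> for \<open>(u, v) \<in> R\<close>.\<close>

inductive_set word_cong :: "'a set \<Rightarrow> ('a word \<times> 'a word) set \<Rightarrow> ('a word \<times> 'a word) set"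
  for S :: "'a set" and R :: "('a word \<times> 'a word) set"
where
  refl: "w \<in> words S \<Longrightarrow> (w, w) \<in> word_cong S R"
| sym: "(u, v) \<in> word_cong S R \<Longrightarrow> (v, u) \<in> word_cong S R"
| trans: "(u, v) \<in> word_cong S R \<Longrightarrow> (v, w) \<in> word_cong S R \<Longrightarrow> (u, w) \<in> word_cong S R"
| append: "(u, v) \<in> word_cong S R \<Longrightarrow> (u', v') \<in> word_cong S R \<Longrightarrow> (u @ u', v @ v') \<in> word_cong S R"
| cancel: "x \<in> S \<Longrightarrow> ([(x, b), (x, \<not> b)], []) \<in> word_cong S R"
| rel: "(u, v) \<in> R \<Longrightarrow> u \<in> words S \<Longrightarrow> v \<in> words S \<Longrightarrow> (u, v) \<in> word_cong S R"

definition presented_group :: "'a set \<Rightarrow> ('a word \<times> 'a word) set \<Rightarrow> 'a word set monoid"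
  where "presented_group S R =
    \<lparr>carrier = words S // word_cong S R,
     monoid.mult = \<lambda>A B. \<Union>u\<in>A. \<Union>v\<in>B. word_cong S R `` {u @ v},
     one = word_cong S R `` {[]}\<rparr>"

lemma word_cong_words:
  "(u, v) \<in> word_cong S R \<Longrightarrow> u \<in> words S \<and> v \<in> words S"
  by (induction rule: word_cong.induct) auto

lemma equiv_word_cong: "equiv (words S) (word_cong S R)"
proof (rule equivI)
  show "word_cong S R \<subseteq> words S \<times> words S"
    using word_cong_words by fast
  show "refl_on (words S) (word_cong S R)"
    by (rule refl_onI) (rule word_cong.refl)
  show "Relation.sym (word_cong S R)"
    by (rule symI) (rule word_cong.sym)
  show "Relation.trans (word_cong S R)"
    by (rule transI) (rule word_cong.trans)
qed

lemma presented_carrierI: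
  "w \<in> words S \<Longrightarrow> word_cong S R `` {w} \<in> carrier (presented_group S R)"
  by (simp add: presented_group_def quotientI)

lemma presented_carrierE:
  assumes "A \<in> carrier (presented_group S R)"
  obtains w where "w \<in> words S" "A = word_cong S R `` {w}"
  using assms unfolding presented_group_def by (auto elim!: quotientE)

lemma presented_one: "\<one>\<^bsub>presented_group S R\<^esub> = word_cong S R `` {[]}"
  by (simp add: presented_group_def)

lemma presented_mult:
  assumes "u \<in> words S" "v \<in> words S"
  shows "word_cong S R `` {u} \<otimes>\<^bsub>presented_group S R\<^esub> word_cong S R `` {v} = word_cong S R `` {u @ v}"
proof -
  have "word_cong S R `` {u' @ v'} = word_cong S R `` {u @ v}"
    if "u' \<in> word_cong S R `` {u}" "v' \<in> word_cong S R `` {v}" for u' v'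
  proof -
    have "(u, u') \<in> word_cong S R" "(v, v') \<in> word_cong S R" using that by auto
    from equiv_class_eq[OF equiv_word_cong word_cong.append[OF this]] show ?thesis by simp
  qed
  moreover have "u \<in> word_cong S R `` {u}" "v \<in> word_cong S R `` {v}"
    using assms by (auto intro: word_cong.refl)
  ultimately have "(\<Union>u'\<in>word_cong S R `` {u}. \<Union>v'\<in>word_cong S R `` {v}. word_cong S R `` {u' @ v'})
      = word_cong S R `` {u @ v}"
    by (metis (no_types, lifting) SUP_eq_const empty_iff)
  then show ?thesis by (simp add: presented_group_def)
qed

fun word_inv :: "'a word \<Rightarrow> 'a word" where
  "word_inv [] = []"
| "word_inv ((x, b) # w) = word_inv w @ [(x, \<not> b)]"

lemma word_inv_words: "w \<in> words S \<Longrightarrow> word_inv w \<in> words S"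
  by (induction w rule: word_inv.induct) auto

lemma word_inv_cong: "w \<in> words S \<Longrightarrow> (word_inv w @ w, []) \<in> word_cong S R"
proof (induction w rule: word_inv.induct)
  case 1
  then show ?case by (simp add: word_cong.refl)
next
  case (2 x b w)
  then have x: "x \<in> S" and w: "w \<in> words S" by auto
  have "([(x, \<not> b), (x, b)], []) \<in> word_cong S R"
    using word_cong.cancel[OF x, of "\<not> b"] by simp
  from word_cong.append[OF this word_cong.refl[OF w]]
  have "((x, \<not> b) # (x, b) # w, w) \<in> word_cong S R" by simp
  from word_cong.append[OF word_cong.refl[OF word_inv_words[OF w]] this]
  have "(word_inv ((x, b) # w) @ (x, b) # w, word_inv w @ w) \<in> word_cong S R" by simp
  with "2.IH"[OF w] show ?case by (blast intro: word_cong.trans)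
qed

lemma group_presented_group: "group (presented_group S R)"
proof (rule groupI)
  fix A B assume "A \<in> carrier (presented_group S R)" "B \<in> carrier (presented_group S R)"
  then show "A \<otimes>\<^bsub>presented_group S R\<^esub> B \<in> carrier (presented_group S R)"
    by (elim presented_carrierE) (auto simp: presented_mult intro!: presented_carrierI)
next
  show "\<one>\<^bsub>presented_group S R\<^esub> \<in> carrier (presented_group S R)"
    by (simp add: presented_one presented_carrierI)
next
  fix A B C
  assume "A \<in> carrier (presented_group S R)" "B \<in> carrier (presented_group S R)"
    "C \<in> carrier (presented_group S R)"
  then show "A \<otimes>\<^bsub>presented_group S R\<^esub> B \<otimes>\<^bsub>presented_group S R\<^esub> C
      = A \<otimes>\<^bsub>presented_group S R\<^esub> (B \<otimes>\<^bsub>presented_group S R\<^esub> C)"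
    by (elim presented_carrierE) (auto simp: presented_mult)
next
  fix A assume "A \<in> carrier (presented_group S R)"
  then show "\<one>\<^bsub>presented_group S R\<^esub> \<otimes>\<^bsub>presented_group S R\<^esub> A = A"
    by (elim presented_carrierE) (auto simp: presented_mult presented_one)
next
  fix A assume "A \<in> carrier (presented_group S R)"
  then obtain w where w: "w \<in> words S" and A: "A = word_cong S R `` {w}"
    by (rule presented_carrierE)
  have "word_cong S R `` {word_inv w} \<otimes>\<^bsub>presented_group S R\<^esub> A = \<one>\<^bsub>presented_group S R\<^esub>"
    using equiv_class_eq[OF equiv_word_cong word_inv_cong[OF w]]
    by (simp add: A presented_mult presented_one word_inv_words w)
  then show "\<exists>B\<in>carrier (presented_group S R). B \<otimes>\<^bsub>presented_group S R\<^esub> A = \<one>\<^bsub>presented_group S R\<^esub>"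
    using presented_carrierI[OF word_inv_words[OF w]] by blast
qed

text \<open>The homomorphism out of a presented group that extends a map \<open>f\<close> on the generators.
  It is meaningful only when \<open>f\<close> respects the relations, so that the image below is a
  singleton.\<close>

fun word_eval :: "('b, 'm) monoid_scheme \<Rightarrow> ('a \<Rightarrow> 'b) \<Rightarrow> 'a word \<Rightarrow> 'b" where
  "word_eval G f [] = \<one>\<^bsub>G\<^esub>"
| "word_eval G f ((x, b) # w) = (if b then f x else inv\<^bsub>G\<^esub> f x) \<otimes>\<^bsub>G\<^esub> word_eval G f w"

definition presented_hom :: "('b, 'm) monoid_scheme \<Rightarrow> ('a \<Rightarrow> 'b) \<Rightarrow> 'a word set \<Rightarrow> 'b"
  where "presented_hom G f A = the_elem (word_eval G f ` A)"

lemma word_eval_closed: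
  assumes "group G" "f \<in> S \<rightarrow> carrier G" "w \<in> words S"
  shows "word_eval G f w \<in> carrier G"
  using assms(3)
proof (induction w)
  case Nil
  then show ?case using assms(1) by (simp add: group.is_monoid monoid.one_closed)
next
  case (Cons a w)
  interpret group G by fact
  show ?case using Cons assms(2) by (cases a) auto
qed

lemma word_eval_append:
  assumes "group G" "f \<in> S \<rightarrow> carrier G" "u \<in> words S" "v \<in> words S"
  shows "word_eval G f (u @ v) = word_eval G f u \<otimes>\<^bsub>G\<^esub> word_eval G f v"
  using assms(3)
proof (induction u)
  case Nil
  interpret group G by fact
  show ?case using word_eval_closed[OF assms(1,2,4)] by simp
next
  case (Cons a w)
  interpret group G by fact
  obtain x b where a: "a = (x, b)" by (cases a)
  have fx: "f x \<in> carrier G" using Cons.hyps assms(2) a by auto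
  show ?case
    using Cons fx word_eval_closed[OF assms(1,2)] assms(4) a
    by (auto simp: m_assoc)
qed

lemma word_eval_cong:
  assumes "group G" "f \<in> S \<rightarrow> carrier G"
    and "\<forall>(u, v)\<in>R. word_eval G f u = word_eval G f v"
    and "(u, v) \<in> word_cong S R"
  shows "word_eval G f u = word_eval G f v"
  using assms(4)
proof (induction rule: word_cong.induct)
  case (append u v u' v')
  then show ?case
    using word_eval_append[OF assms(1,2)] word_cong_words by metis
next
  case (cancel x b)
  interpret group G by fact
  have "f x \<in> carrier G" using assms(2) cancel by auto
  then show ?case by simp
next
  case (rel u v)
  then show ?case using assms(3) by blast
qed simp_all

lemma presented_hom_class:
  assumes "group G" "f \<in> S \<rightarrow> carrier G"
    and "\<forall>(u, v)\<in>R. word_eval G f u = word_eval G f v"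
    and "w \<in> words S"
  shows "presented_hom G f (word_cong S R `` {w}) = word_eval G f w"
proof -
  have "word_eval G f v = word_eval G f w" if "v \<in> word_cong S R `` {w}" for v
    using word_eval_cong[of G f S R w v, OF assms(1,2,3)] that by simp
  moreover have "w \<in> word_cong S R `` {w}"
    using word_cong.refl[OF assms(4), of R] by simp
  ultimately have "word_eval G f ` (word_cong S R `` {w}) = {word_eval G f w}"
    by blast
  then show ?thesis by (simp add: presented_hom_def)
qed

lemma presented_hom_hom:
  assumes "group G" "f \<in> S \<rightarrow> carrier G"
    and "\<forall>(u, v)\<in>R. word_eval G f u = word_eval G f v"
  shows "presented_hom G f \<in> hom (presented_group S R) G"
proof (rule homI)
  note c = presented_hom_class[of G f S R, OF assms]
  fix A assume "A \<in> carrier (presented_group S R)"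
  then obtain w where w: "w \<in> words S" "A = word_cong S R `` {w}" by (rule presented_carrierE)
  show "presented_hom G f A \<in> carrier G"
    unfolding w(2) c[OF w(1)] by (rule word_eval_closed[OF assms(1,2) w(1)])
next
  note c = presented_hom_class[of G f S R, OF assms]
  fix A B assume "A \<in> carrier (presented_group S R)" "B \<in> carrier (presented_group S R)"
  then obtain u v where u: "u \<in> words S" "A = word_cong S R `` {u}"
    and v: "v \<in> words S" "B = word_cong S R `` {v}" by (elim presented_carrierE)
  have uv: "u @ v \<in> words S" using u(1) v(1) by simp
  show "presented_hom G f (A \<otimes>\<^bsub>presented_group S R\<^esub> B)
      = presented_hom G f A \<otimes>\<^bsub>G\<^esub> presented_hom G f B"
    unfolding u(2) v(2) presented_mult[OF u(1) v(1)] c[OF u(1)] c[OF v(1)] c[OF uv]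
    by (rule word_eval_append[OF assms(1,2) u(1) v(1)])
qed


section \<open>Braid groups\<close>

definition braid_relations :: "nat \<Rightarrow> (nat word \<times> nat word) set"
  where "braid_relations n =
    {(pos_word [i, j], pos_word [j, i]) | i j.
       i \<in> {1..<n} \<and> j \<in> {1..<n} \<and> \<bar>int i - int j\<bar> \<ge> 2} \<union>
    {(pos_word [i, i + 1, i], pos_word [i + 1, i, i + 1]) | i. 1 \<le> i \<and> i + 2 \<le> n}"

definition braid_group :: "nat \<Rightarrow> nat word set monoid"
  where "braid_group n = presented_group {1..<n} (braid_relations n)"

definition braid_gen :: "nat \<Rightarrow> nat \<Rightarrow> nat word set"
  where "braid_gen n i = word_cong {1..<n} (braid_relations n) `` {[(i, True)]}"

definition braid_perm :: "nat \<Rightarrow> nat word set \<Rightarrow> nat \<Rightarrow> nat"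
  where "braid_perm n = presented_hom (sym_group n) (\<lambda>i. Transposition.transpose i (i + 1))"

definition pure_braid_group :: "nat \<Rightarrow> nat word set monoid"
  where "pure_braid_group n =
    (braid_group n)\<lparr>carrier := kernel (braid_group n) (sym_group n) (braid_perm n)\<rparr>"

lemma group_braid_group: "group (braid_group n)"
  by (simp add: braid_group_def group_presented_group)

lemma transpose_in_sym_group:
  "(\<lambda>i. Transposition.transpose i (i + 1)) \<in> {1..<n} \<rightarrow> carrier (sym_group n)"
  by (auto simp: sym_group_carrier intro!: permutes_swap_id)

lemma braid_relations_respected:
  "\<forall>(u, v)\<in>braid_relations n.
    word_eval (sym_group n) (\<lambda>i. Transposition.transpose i (i + 1)) u
    = word_eval (sym_group n) (\<lambda>i. Transposition.transpose i (i + 1)) v"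
  by (auto simp: braid_relations_def sym_group_def fun_eq_iff Transposition.transpose_def)

lemma braid_perm_hom: "braid_perm n \<in> hom (braid_group n) (sym_group n)"
  unfolding braid_perm_def braid_group_def
  by (rule presented_hom_hom[OF sym_group_is_group transpose_in_sym_group braid_relations_respected])

lemma braid_perm_gen:
  assumes "i \<in> {1..<n}"
  shows "braid_perm n (braid_gen n i) = Transposition.transpose i (i + 1)"
proof -
  have "[(i, True)] \<in> words {1..<n}" using assms by auto
  from presented_hom_class[OF sym_group_is_group transpose_in_sym_group braid_relations_respected this]
  show ?thesis by (simp add: braid_perm_def braid_gen_def sym_group_def)
qed


section \<open>Lower central series\<close>

definition commutator_subgroup :: "('a, 'b) monoid_scheme \<Rightarrow> 'a set \<Rightarrow> 'a set \<Rightarrow> 'a set"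
  where "commutator_subgroup G H K =
    generate G {h \<otimes>\<^bsub>G\<^esub> k \<otimes>\<^bsub>G\<^esub> inv\<^bsub>G\<^esub> h \<otimes>\<^bsub>G\<^esub> inv\<^bsub>G\<^esub> k | h k. h \<in> H \<and> k \<in> K}"

text \<open>The series is indexed from 1; the value at 0 is a dummy.\<close>

fun lower_central :: "('a, 'b) monoid_scheme \<Rightarrow> nat \<Rightarrow> 'a set" where
  "lower_central G 0 = carrier G"
| "lower_central G (Suc 0) = carrier G"
| "lower_central G (Suc (Suc k)) = commutator_subgroup G (lower_central G (Suc k)) (carrier G)"

lemma lower_central_subset:
  fixes G (structure)
  assumes "group G"
  shows "lower_central G k \<subseteq> carrier G"
proof (induction k rule: induct_nat_012)
  case (ge2 k)
  interpret group G by fact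
  have "{h \<otimes> k \<otimes> inv h \<otimes> inv k | h k. h \<in> lower_central G (Suc k') \<and> k \<in> carrier G} \<subseteq> carrier G"
    if "lower_central G (Suc k') \<subseteq> carrier G" for k'
    using that by (auto simp del: lower_central.simps simp: subset_iff)
  from generate_incl[OF this[OF ge2(2)]] show ?case
    by (simp add: commutator_subgroup_def)
qed simp_all

lemma lower_central_normal:
  fixes G (structure)
  assumes G: "group G" and N: "N \<lhd> G"
  shows "lower_central (G\<lparr>carrier := N\<rparr>) k \<lhd> G"
proof (induction k rule: induct_nat_012)
  case 0
  show ?case using N by simp
next
  case 1
  show ?case using N by simp
next
  case (ge2 k)
  interpret group G by fact
  interpret N: normal N G by fact
  define L where "L = lower_central (G\<lparr>carrier := N\<rparr>) (Suc k)"
  have L: "L \<lhd> G" using ge2 by (simp add: L_def)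
  interpret L: normal L G by fact
  have grN: "group (G\<lparr>carrier := N\<rparr>)" using N.subgroup_axioms by (rule subgroup_imp_group)
  have LN: "L \<subseteq> N"
    using lower_central_subset[OF grN, of "Suc k"] by (simp add: L_def)
  let ?C = "{h \<otimes> k \<otimes> inv h \<otimes> inv k | h k. h \<in> L \<and> k \<in> N}"
  have C: "?C \<subseteq> N" using LN by (auto intro!: N.m_closed N.m_inv_closed)
  have eq: "lower_central (G\<lparr>carrier := N\<rparr>) (Suc (Suc k)) = generate G ?C"
  proof -
    have "h \<otimes> k \<otimes> inv\<^bsub>G\<lparr>carrier := N\<rparr>\<^esub> h \<otimes> inv\<^bsub>G\<lparr>carrier := N\<rparr>\<^esub> k = h \<otimes> k \<otimes> inv h \<otimes> inv k"
      if "h \<in> L" "k \<in> N" for h k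
      using that LN m_inv_consistent[OF N.subgroup_axioms] by auto
    then have "{h \<otimes> k \<otimes> inv\<^bsub>G\<lparr>carrier := N\<rparr>\<^esub> h \<otimes> inv\<^bsub>G\<lparr>carrier := N\<rparr>\<^esub> k | h k. h \<in> L \<and> k \<in> N} = ?C"
      by (intro Collect_cong) (metis (no_types, lifting))
    then show ?thesis
      using generate_consistent[OF C N.subgroup_axioms]
      by (simp add: commutator_subgroup_def L_def)
  qed
  have "generate G ?C \<lhd> G"
  proof (rule normal_generateI)
    show "?C \<subseteq> carrier G" using C N.subset by blast
    fix c g assume "c \<in> ?C" and g: "g \<in> carrier G"
    then obtain h k where hk: "h \<in> L" "k \<in> N" "c = h \<otimes> k \<otimes> inv h \<otimes> inv k" by blast
    have hc: "h \<in> carrier G" "k \<in> carrier G" using hk L.subset N.subset by auto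
    define h' where "h' = g \<otimes> h \<otimes> inv g"
    define k' where "k' = g \<otimes> k \<otimes> inv g"
    have "h' \<in> L" "k' \<in> N"
      unfolding h'_def k'_def using hk g L.inv_op_closed2 N.inv_op_closed2 by auto
    moreover have "g \<otimes> c \<otimes> inv g = h' \<otimes> k' \<otimes> inv h' \<otimes> inv k'"
      unfolding hk(3) h'_def k'_def using hc g
      by (simp add: m_assoc inv_mult_group inv_solve_left')
         (simp add: m_assoc[symmetric])
    ultimately show "g \<otimes> c \<otimes> inv g \<in> ?C" by blast
  qed
  then show ?case using eq by simp
qed

lemma lower_central_pure_braid_normal:
  "lower_central (pure_braid_group n) k \<lhd> braid_group n"
proof -
  have "group_hom (braid_group n) (sym_group n) (braid_perm n)"
    using group_braid_group sym_group_is_group braid_perm_hom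
    by (simp add: group_hom_def group_hom_axioms_def)
  from lower_central_normal[OF group_braid_group group_hom.normal_kernel[OF this]]
  show ?thesis unfolding pure_braid_group_def .
qed


section \<open>Semidirect products and embeddings\<close>

definition semidirect_product ::
    "('a, 'm) monoid_scheme \<Rightarrow> ('b, 'n) monoid_scheme \<Rightarrow> ('b \<Rightarrow> 'a \<Rightarrow> 'a) \<Rightarrow> ('a \<times> 'b) monoid"
  where "semidirect_product N H \<theta> =
    \<lparr>carrier = carrier N \<times> carrier H,
     monoid.mult = \<lambda>(a, x) (b, y). (a \<otimes>\<^bsub>N\<^esub> \<theta> x b, x \<otimes>\<^bsub>H\<^esub> y),
     one = (\<one>\<^bsub>N\<^esub>, \<one>\<^bsub>H\<^esub>)\<rparr>"

definition embeds_in :: "('a, 'm) monoid_scheme \<Rightarrow> ('b, 'n) monoid_scheme \<Rightarrow> bool"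
  where "embeds_in G H \<longleftrightarrow> mon G H \<noteq> {}"

lemma group_semidirect_product:
  assumes "group N" "group H" and \<theta>: "\<theta> \<in> hom H (AutoGroup N)"
  shows "group (semidirect_product N H \<theta>)"
proof -
  interpret N: group N by fact
  interpret H: group H by fact
  interpret A: group "AutoGroup N" by (rule N.AutoGroup)
  interpret T: group_hom H "AutoGroup N" \<theta>
    using \<theta> by (simp add: group_hom_def group_hom_axioms_def H.is_group A.is_group)
  have auto: "\<theta> x \<in> hom N N" "\<theta> x \<in> Bij (carrier N)" if "x \<in> carrier H" for x
    using T.hom_closed[OF that] by (auto simp: AutoGroup_def auto_def)
  have cl: "\<theta> x a \<in> carrier N" if "x \<in> carrier H" "a \<in> carrier N" for x a
    using auto(1)[OF that(1)] that(2) by (rule hom_in_carrier)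
  have mul: "\<theta> x (a \<otimes>\<^bsub>N\<^esub> b) = \<theta> x a \<otimes>\<^bsub>N\<^esub> \<theta> x b"
    if "x \<in> carrier H" "a \<in> carrier N" "b \<in> carrier N" for x a b
    using auto(1)[OF that(1)] that by (simp add: hom_mult)
  have comp: "\<theta> (x \<otimes>\<^bsub>H\<^esub> y) a = \<theta> x (\<theta> y a)"
    if "x \<in> carrier H" "y \<in> carrier H" "a \<in> carrier N" for x y a
    using T.hom_mult[OF that(1,2)] auto that
    by (simp add: AutoGroup_def BijGroup_def compose_def)
  have one: "\<theta> \<one>\<^bsub>H\<^esub> a = a" if "a \<in> carrier N" for a
    using T.hom_one that by (simp add: AutoGroup_def BijGroup_def)
  show ?thesis
  proof (rule groupI)
    fix z assume "z \<in> carrier (semidirect_product N H \<theta>)"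
    then obtain a x where z: "z = (a, x)" "a \<in> carrier N" "x \<in> carrier H"
      by (auto simp: semidirect_product_def)
    have "\<theta> (inv\<^bsub>H\<^esub> x) (inv\<^bsub>N\<^esub> a) \<otimes>\<^bsub>N\<^esub> \<theta> (inv\<^bsub>H\<^esub> x) a = \<one>\<^bsub>N\<^esub>"
      using z mul[of "inv\<^bsub>H\<^esub> x" "inv\<^bsub>N\<^esub> a" a] hom_one[OF auto(1)[of "inv\<^bsub>H\<^esub> x"] N.is_group N.is_group]
      by (simp del: T.hom_inv)
    then show "\<exists>w\<in>carrier (semidirect_product N H \<theta>).
        w \<otimes>\<^bsub>semidirect_product N H \<theta>\<^esub> z = \<one>\<^bsub>semidirect_product N H \<theta>\<^esub>"
      using z cl
      by (intro bexI[of _ "(\<theta> (inv\<^bsub>H\<^esub> x) (inv\<^bsub>N\<^esub> a), inv\<^bsub>H\<^esub> x)"])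
        (auto simp: semidirect_product_def simp del: T.hom_inv)
  qed (auto simp: semidirect_product_def cl mul comp one N.m_assoc H.m_assoc
      simp del: T.hom_mult T.hom_one)
qed

end

theory Submission
  imports Defs
begin

text \<open>
  Let \<open>P\<close> be the pure braid group on \<open>n\<close> strings.  The quotient of \<open>P\<close> by the second term of its lower
  central series is free abelian on the classes of the twists of the pairs \<open>{i, j}\<close>, and the quotient of the
  second term by the third one is free abelian on commutators indexed by the triples \<open>{i, j, k}\<close>;
  the braid group permutes both bases (up to sign) through the symmetric group.  If a finite group acts
  on \<open>n\<close> points such that no nontrivial element stabilises a set of two (respectively two or three) points,
  these are free modules over it.  Hence the obstruction in its second cohomology to lifting the action
  to \<open>B / \<Gamma>\<^sub>2\<close> (respectively from there to \<open>B / \<Gamma>\<^sub>3\<close>) vanishes, and a primitive of the cocycle can be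
  read off coordinate by coordinate.

  The group here acts on the \<open>p\<^sup>r\<close> points of the cyclic group by affine maps.  An element fixing two
  points has multiplier congruent to 1 modulo \<open>p\<close>, of order prime to \<open>p\<close>, hence is trivial; as the
  order of the group is prime to 2 (respectively 6), no nontrivial element stabilises a set of two
  (respectively two or three) points.

  Generation of the two quotients follows from Coxeter's presentation of the symmetric group.  Independence
  is detected by winding numbers and their analogues for triples of strings, the components of an
  explicit homomorphism from the braid group to a group which is nilpotent of class two over the
  symmetric group.
\<close>

section \<open>A nilpotent quotient of class two of the braid group\<close>

text \<open>No presentation of the pure braid group enters. The braid relations bound both quotients
  from above by generators, \<open>chord_group\<close> bounds them from below by integer invariants
  dual to these generators, and the bounds meet. The law of \<open>chord_group\<close> is the
  Baker-Campbell-Hausdorff product x + x' + [x, x']/2 cut after degree two, with the degree two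
  coordinate multiplied by 6. A half twist has degree one coordinate 1 and a twist has 2, so a
  commutator of two twists sharing one string has coordinate 6 * 2 * 2 = 24 up to sign: this is the
  origin of 24. Freeness is needed on sets, not on tuples, because a basis vector belongs to an
  unordered pair or triple. The coordinates are symmetric or alternating in the labels, and a
  cochain is glued by choosing one source element per set, so that these symmetries survive.\<close>

text \<open>In the Lie algebra of infinitesimal pure braids, with generators \<open>t i j\<close>, the brackets
  \<open>[t i j, t j k]\<close> alternate in \<open>i, j, k\<close>.  So an element of degree 1 is a function of pairs, one of
  degree 2 a function of triples, and this is the bracket; the factor 3 clears the denominators of the
  correction terms in \<open>chord_gen\<close> below.\<close>

definition braid_bracket :: "(nat \<Rightarrow> nat \<Rightarrow> int) \<Rightarrow> (nat \<Rightarrow> nat \<Rightarrow> int) \<Rightarrow> nat \<Rightarrow> nat \<Rightarrow> nat \<Rightarrow> int"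
  where "braid_bracket x x' i j k =
    3 * (x i j * x' j k - x j k * x' i j + x j k * x' k i - x k i * x' j k + x k i * x' i j - x i j * x' k i)"

text \<open>A semidirect product with the symmetric group, which acts by relabelling arguments.
  Symmetry of \<open>x\<close> and alternation of \<open>y\<close> are not built in: bilinearity of
  the bracket gives associativity and its vanishing on the diagonal gives inverses for all integer
  functions. The symmetries are derived later for the images of pure braids.\<close>

definition chord_group :: "nat \<Rightarrow> ((nat \<Rightarrow> nat \<Rightarrow> int) \<times> (nat \<Rightarrow> nat \<Rightarrow> nat \<Rightarrow> int) \<times> (nat \<Rightarrow> nat)) monoid"
  where "chord_group n =
    \<lparr>carrier = {(x, y, \<pi>). \<pi> permutes {1..n}},
     monoid.mult = \<lambda>(x, y, \<pi>) (x', y', \<pi>').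
       (\<lambda>i j. x (\<pi>' i) (\<pi>' j) + x' i j,
        \<lambda>i j k. y (\<pi>' i) (\<pi>' j) (\<pi>' k) + y' i j k + braid_bracket (\<lambda>i j. x (\<pi>' i) (\<pi>' j)) x' i j k,
        \<pi> \<circ> \<pi>'),
     one = (\<lambda>i j. 0, \<lambda>i j k. 0, id)\<rparr>"

lemma group_chord_group: "group (chord_group n)"
proof (rule groupI)
  fix u v assume "u \<in> carrier (chord_group n)" "v \<in> carrier (chord_group n)"
  then show "u \<otimes>\<^bsub>chord_group n\<^esub> v \<in> carrier (chord_group n)"
    by (auto simp: chord_group_def intro: permutes_compose)
next
  show "\<one>\<^bsub>chord_group n\<^esub> \<in> carrier (chord_group n)"
    by (auto simp: chord_group_def permutes_id)
next
  fix u v w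
  show "u \<otimes>\<^bsub>chord_group n\<^esub> v \<otimes>\<^bsub>chord_group n\<^esub> w = u \<otimes>\<^bsub>chord_group n\<^esub> (v \<otimes>\<^bsub>chord_group n\<^esub> w)"
    by (cases u, cases v, cases w) (auto simp: chord_group_def braid_bracket_def fun_eq_iff algebra_simps)
next
  fix u assume "u \<in> carrier (chord_group n)"
  then show "\<one>\<^bsub>chord_group n\<^esub> \<otimes>\<^bsub>chord_group n\<^esub> u = u"
    by (auto simp: chord_group_def braid_bracket_def)
next
  fix u assume "u \<in> carrier (chord_group n)"
  then obtain x y \<pi> where u: "u = (x, y, \<pi>)" and \<pi>: "\<pi> permutes {1..n}"
    by (auto simp: chord_group_def)
  let ?\<rho> = "inv_into UNIV \<pi>"
  let ?v = "(\<lambda>i j. - x (?\<rho> i) (?\<rho> j), \<lambda>i j k. - y (?\<rho> i) (?\<rho> j) (?\<rho> k), ?\<rho>)"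
  have "?v \<in> carrier (chord_group n)"
    using \<pi> by (simp add: chord_group_def permutes_inv)
  moreover have "?v \<otimes>\<^bsub>chord_group n\<^esub> u = \<one>\<^bsub>chord_group n\<^esub>"
    using permutes_inverses[OF \<pi>]
    by (auto simp: u chord_group_def braid_bracket_def fun_eq_iff)
  ultimately show "\<exists>v\<in>carrier (chord_group n). v \<otimes>\<^bsub>chord_group n\<^esub> u = \<one>\<^bsub>chord_group n\<^esub>"
    by blast
qed

text \<open>The naive assignment sending a generator to its crossing violates the braid relation in degree 2
  by a multiple of the bracket.  The correction depends on the side on which the third string lies.\<close>

definition side_sign :: "nat \<Rightarrow> nat \<Rightarrow> int"
  where "side_sign a k = (if k < a then 1 else if k > a + 1 then - 1 else 0)"

definition crossing :: "nat \<Rightarrow> nat \<Rightarrow> nat \<Rightarrow> int"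
  where "crossing a i j = (if i = a \<and> j = a + 1 \<or> i = a + 1 \<and> j = a then 1 else 0)"

definition side_term :: "nat \<Rightarrow> nat \<Rightarrow> nat \<Rightarrow> nat \<Rightarrow> int"
  where "side_term a i j k =
    (if i = a \<and> j = a + 1 then 1 else if i = a + 1 \<and> j = a then - 1 else 0) * side_sign a k"

definition chord_gen :: "nat \<Rightarrow> (nat \<Rightarrow> nat \<Rightarrow> int) \<times> (nat \<Rightarrow> nat \<Rightarrow> nat \<Rightarrow> int) \<times> (nat \<Rightarrow> nat)"
  where "chord_gen a =
    (crossing a, \<lambda>i j k. side_term a i j k + side_term a j k i + side_term a k i j,
     Transposition.transpose a (a + 1))"

text \<open>Neither \<open>b\<close> nor \<open>b + 1\<close> takes part in the crossing at
  \<open>a\<close>, and both lie on the same side of it, so exchanging them changes no test in the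
  two definitions.\<close>

lemma crossing_transpose_far:
  assumes "a + 2 \<le> b \<or> b + 2 \<le> a"
  shows "crossing a (Transposition.transpose b (b + 1) i) (Transposition.transpose b (b + 1) j) = crossing a i j"
    and "side_term a (Transposition.transpose b (b + 1) i) (Transposition.transpose b (b + 1) j)
      (Transposition.transpose b (b + 1) k) = side_term a i j k"
proof -
  have a: "Transposition.transpose b (b + 1) i = a \<longleftrightarrow> i = a"
    "Transposition.transpose b (b + 1) i = a + 1 \<longleftrightarrow> i = a + 1"
    "Transposition.transpose b (b + 1) i < a \<longleftrightarrow> i < a"
    "Transposition.transpose b (b + 1) i > a + 1 \<longleftrightarrow> i > a + 1" for i
    using assms by (auto simp: Transposition.transpose_def)
  show "crossing a (Transposition.transpose b (b + 1) i) (Transposition.transpose b (b + 1) j) = crossing a i j"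
    unfolding crossing_def a ..
  show "side_term a (Transposition.transpose b (b + 1) i) (Transposition.transpose b (b + 1) j)
      (Transposition.transpose b (b + 1) k) = side_term a i j k"
    unfolding side_term_def side_sign_def a ..
qed

text \<open>Distant crossings share no string, so every product in the two brackets vanishes, and
  the correction of each is invariant under the transposition of the other.\<close>

lemma chord_gen_commute:
  assumes "\<bar>int a - int b\<bar> \<ge> 2"
  shows "chord_gen a \<otimes>\<^bsub>chord_group n\<^esub> chord_gen b = chord_gen b \<otimes>\<^bsub>chord_group n\<^esub> chord_gen a"
proof -
  have far: "a + 2 \<le> b \<or> b + 2 \<le> a" "b + 2 \<le> a \<or> a + 2 \<le> b"
    using assms by linarith+
  have "crossing a i j * crossing b j k = 0" "crossing b i j * crossing a j k = 0"
     "crossing a i j * crossing b k i = 0" "crossing b i j * crossing a k i = 0" for i j k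
    using far by (auto simp: crossing_def)
  then have "braid_bracket (crossing a) (crossing b) i j k = 0"
    "braid_bracket (crossing b) (crossing a) i j k = 0" for i j k
    unfolding braid_bracket_def by (simp_all del: mult_eq_0_iff)
  moreover have "Transposition.transpose a (a + 1) \<circ> Transposition.transpose b (b + 1)
      = Transposition.transpose b (b + 1) \<circ> Transposition.transpose a (a + 1)"
    using far by (auto simp: Transposition.transpose_def fun_eq_iff)
  ultimately show ?thesis
    using crossing_transpose_far[OF far(1)] crossing_transpose_far[OF far(2)]
    by (simp add: chord_group_def chord_gen_def add_ac fun_eq_iff)
qed

text \<open>The products are nested to the right because \<open>word_eval\<close> produces that
  shape.\<close>

lemma chord_gen_braid:
  "chord_gen a \<otimes>\<^bsub>chord_group n\<^esub> (chord_gen (a + 1) \<otimes>\<^bsub>chord_group n\<^esub> chord_gen a)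
    = chord_gen (a + 1) \<otimes>\<^bsub>chord_group n\<^esub> (chord_gen a \<otimes>\<^bsub>chord_group n\<^esub> chord_gen (a + 1))"
proof -
  define b c where "b = a + 1" and "c = a + 2"
  define s t where "s = Transposition.transpose a b" and "t = Transposition.transpose b c"
  define out where "out = (\<lambda>i. i < a \<or> c < i)"
  note defs = b_def c_def s_def t_def out_def
  have perm: "s a = b" "s b = a" "s c = c" "t a = a" "t b = c" "t c = b"
    "\<And>i. out i \<Longrightarrow> s i = i" "\<And>i. out i \<Longrightarrow> t i = i"
    by (auto simp: defs Transposition.transpose_def)
  have comp: "s \<circ> (t \<circ> s) = t \<circ> (s \<circ> t)"
    by (auto simp: defs Transposition.transpose_def fun_eq_iff)
  have cross: "crossing a a b = 1" "crossing a b a = 1" "crossing a a a = 0" "crossing a b b = 0"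
    "crossing b b c = 1" "crossing b c b = 1" "crossing b b b = 0" "crossing b c c = 0"
    "\<And>i. crossing a c i = 0" "\<And>i. crossing a i c = 0"
    "\<And>i. crossing b a i = 0" "\<And>i. crossing b i a = 0"
    "\<And>i j. out i \<Longrightarrow> crossing a i j = 0" "\<And>i j. out i \<Longrightarrow> crossing a j i = 0"
    "\<And>i j. out i \<Longrightarrow> crossing b i j = 0" "\<And>i j. out i \<Longrightarrow> crossing b j i = 0"
    by (auto simp: defs crossing_def)
  have side: "\<And>k. side_term a a b k = side_sign a k" "\<And>k. side_term a b a k = - side_sign a k"
    "\<And>k. side_term b b c k = side_sign b k" "\<And>k. side_term b c b k = - side_sign b k"
    "\<And>k. side_term a a a k = 0" "\<And>k. side_term a b b k = 0"
    "\<And>k. side_term b b b k = 0" "\<And>k. side_term b c c k = 0"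
    "\<And>j k. side_term a c j k = 0" "\<And>j k. side_term a j c k = 0"
    "\<And>j k. side_term b a j k = 0" "\<And>j k. side_term b j a k = 0"
    "\<And>i j k. out i \<Longrightarrow> side_term a i j k = 0" "\<And>i j k. out i \<Longrightarrow> side_term a j i k = 0"
    "\<And>i j k. out i \<Longrightarrow> side_term b i j k = 0" "\<And>i j k. out i \<Longrightarrow> side_term b j i k = 0"
    by (auto simp: defs side_term_def)
  have sign: "\<And>k. out k \<Longrightarrow> side_sign b k = side_sign a k"
    "side_sign a a = 0" "side_sign a b = 0" "side_sign a c = - 1"
    "side_sign b a = 1" "side_sign b b = 0" "side_sign b c = 0"
    by (auto simp: defs side_sign_def)
  have gens: "chord_gen a = (crossing a, \<lambda>i j k. side_term a i j k + side_term a j k i + side_term a k i j, s)"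
    "chord_gen b = (crossing b, \<lambda>i j k. side_term b i j k + side_term b j k i + side_term b k i j, t)"
    by (simp_all add: chord_gen_def defs)
  \<comment> \<open>An index matters only as \<open>a\<close>, \<open>b\<close>, \<open>c\<close> or
    as a string outside, on which \<open>side_sign a\<close> and \<open>side_sign b\<close> agree.
    Equality of functions thus becomes 16 cases for pairs and 64 for triples.\<close>
  have pt: "\<And>i. i = a \<or> i = b \<or> i = c \<or> out i"
    unfolding defs by linarith
  have x: "crossing a (t (s i)) (t (s j)) + (crossing b (s i) (s j) + crossing a i j) =
      crossing b (s (t i)) (s (t j)) + (crossing a (t i) (t j) + crossing b i j)" for i j
    using pt[of i] pt[of j] by (elim disjE) (simp_all add: perm cross)
  let ?y = "\<lambda>a i j k. side_term a i j k + side_term a j k i + side_term a k i j"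
  have y: "?y a (t (s i)) (t (s j)) (t (s k)) + (?y b (s i) (s j) (s k) + ?y a i j k +
      braid_bracket (\<lambda>i j. crossing b (s i) (s j)) (crossing a) i j k) +
    braid_bracket (\<lambda>i j. crossing a (t (s i)) (t (s j))) (\<lambda>i j. crossing b (s i) (s j) + crossing a i j) i j k =
    ?y b (s (t i)) (s (t j)) (s (t k)) + (?y a (t i) (t j) (t k) + ?y b i j k +
      braid_bracket (\<lambda>i j. crossing a (t i) (t j)) (crossing b) i j k) +
    braid_bracket (\<lambda>i j. crossing b (s (t i)) (s (t j))) (\<lambda>i j. crossing a (t i) (t j) + crossing b i j) i j k"
    for i j k
    unfolding braid_bracket_def
    using pt[of i] pt[of j] pt[of k] by (elim disjE) (simp_all add: perm cross side sign)
  show ?thesis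
    unfolding b_def[symmetric] chord_group_def gens
    using comp by (simp add: x y)
qed

section \<open>The Coxeter presentation of the symmetric group\<close>

text \<open>Coset representatives of a symmetric group in the next one: at adjacent transpositions,
  the product with \<open>k\<close> factors sends \<open>m + 1 - k\<close> to
  \<open>m + 1\<close>.\<close>

primrec desc_prod :: "('a, 'm) monoid_scheme \<Rightarrow> (nat \<Rightarrow> 'a) \<Rightarrow> nat \<Rightarrow> nat \<Rightarrow> 'a" where
  "desc_prod G q m 0 = \<one>\<^bsub>G\<^esub>"
| "desc_prod G q m (Suc k) = desc_prod G q m k \<otimes>\<^bsub>G\<^esub> q (m - k)"

locale coxeter_family = group Q for Q (structure) +
  fixes q :: "nat \<Rightarrow> 'a" and n :: nat
  assumes q_closed: "i \<in> {1..<n} \<Longrightarrow> q i \<in> carrier Q"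
    and q_square: "i \<in> {1..<n} \<Longrightarrow> q i \<otimes> q i = \<one>"
    and q_commute: "i \<in> {1..<n} \<Longrightarrow> j \<in> {1..<n} \<Longrightarrow> i + 2 \<le> j \<Longrightarrow> q i \<otimes> q j = q j \<otimes> q i"
    and q_braid: "1 \<le> i \<Longrightarrow> i + 2 \<le> n \<Longrightarrow> q i \<otimes> q (i + 1) \<otimes> q i = q (i + 1) \<otimes> q i \<otimes> q (i + 1)"
begin

lemma desc_prod_closed: "m < n \<Longrightarrow> k \<le> m \<Longrightarrow> desc_prod Q q m k \<in> carrier Q"
proof (induction k)
  case (Suc k)
  then have "m - k \<in> {1..<n}" by auto
  then show ?case using Suc q_closed by simp
qed simp

lemma desc_prod_commute_low:
  assumes "m < n" "i \<in> {1..<n}"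
  shows "k \<le> m \<Longrightarrow> i + k < m \<Longrightarrow> desc_prod Q q m k \<otimes> q i = q i \<otimes> desc_prod Q q m k"
proof (induction k)
  case 0
  then show ?case using q_closed[OF assms(2)] by simp
next
  case (Suc k)
  have c: "desc_prod Q q m k \<in> carrier Q" "q (m - k) \<in> carrier Q" "q i \<in> carrier Q"
    using Suc assms desc_prod_closed[OF assms(1)] by (auto intro!: q_closed)
  have "q i \<otimes> q (m - k) = q (m - k) \<otimes> q i"
    using Suc.prems assms by (intro q_commute) auto
  then have "desc_prod Q q m (Suc k) \<otimes> q i = desc_prod Q q m k \<otimes> q i \<otimes> q (m - k)"
    using c by (simp add: m_assoc)
  also have "\<dots> = q i \<otimes> desc_prod Q q m (Suc k)"
    using Suc c by (simp add: m_assoc)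
  finally show ?case .
qed

text \<open>Coming from the right, \<open>q i\<close> commutes with the factors of index below
  \<open>i - 1\<close>, is turned into \<open>q (i - 1)\<close> by the braid relation with the
  factors \<open>q i\<close> and \<open>q (i - 1)\<close>, and then commutes with the factors of
  index above \<open>i\<close>.\<close>

lemma desc_prod_commute_high:
  assumes "m < n"
  shows "k \<le> m \<Longrightarrow> i \<le> m \<Longrightarrow> m + 1 < i + k \<Longrightarrow>
    desc_prod Q q m k \<otimes> q i = q (i - 1) \<otimes> desc_prod Q q m k"
proof (induction k)
  case 0
  then show ?case by simp
next
  case (Suc k)
  have c: "desc_prod Q q m k \<in> carrier Q" "q (m - k) \<in> carrier Q" "q i \<in> carrier Q" "q (i - 1) \<in> carrier Q"
    using Suc assms desc_prod_closed[OF assms] by (auto intro!: q_closed)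
  show ?case
  proof (cases "m + 1 < i + k")
    case True
    have "q (m - k) \<otimes> q i = q i \<otimes> q (m - k)"
      using Suc.prems True assms by (intro q_commute) auto
    then have "desc_prod Q q m (Suc k) \<otimes> q i = desc_prod Q q m k \<otimes> q i \<otimes> q (m - k)"
      using c by (simp add: m_assoc)
    also have "\<dots> = q (i - 1) \<otimes> desc_prod Q q m (Suc k)"
      using Suc c True by (simp add: m_assoc)
    finally show ?thesis .
  next
    case False
    then have k: "m + 1 = i + k" and "k \<noteq> 0" using Suc.prems by auto
    then obtain l where l: "k = Suc l" by (cases k) auto
    have i: "m - l = i" "m - k = i - 1" "i \<ge> 2" using k l Suc.prems by auto
    have d: "desc_prod Q q m l \<in> carrier Q"
      using l Suc.prems desc_prod_closed[OF assms] by auto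
    have br: "q i \<otimes> q (i - 1) \<otimes> q i = q (i - 1) \<otimes> q i \<otimes> q (i - 1)"
      using q_braid[of "i - 1"] i Suc.prems assms by simp
    have lo: "desc_prod Q q m l \<otimes> q (i - 1) = q (i - 1) \<otimes> desc_prod Q q m l"
      using i k l Suc.prems assms by (intro desc_prod_commute_low) auto
    have "desc_prod Q q m (Suc k) \<otimes> q i = desc_prod Q q m l \<otimes> (q i \<otimes> q (i - 1) \<otimes> q i)"
      using c d i l by (simp add: m_assoc)
    also have "\<dots> = desc_prod Q q m l \<otimes> q (i - 1) \<otimes> q i \<otimes> q (i - 1)"
      unfolding br using c d by (simp add: m_assoc)
    also have "\<dots> = q (i - 1) \<otimes> desc_prod Q q m (Suc k)"
      unfolding lo using c d i l by (simp add: m_assoc)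
    finally show ?thesis .
  qed
qed

text \<open>The union \<open>Y\<close> of the cosets contains the identity and is stable under right
  multiplication by every generator. The generators are involutions, so inverses add nothing and
  \<open>Y\<close> contains the whole generated group.\<close>

lemma generate_coset:
  assumes m: "1 \<le> m" "m < n" and x: "x \<in> generate Q (q ` {1..<Suc m})"
  shows "\<exists>h\<in>generate Q (q ` {1..<m}). \<exists>k\<le>m. x = h \<otimes> desc_prod Q q m k"
proof -
  define H where "H = generate Q (q ` {1..<m})"
  define Y where "Y = {h \<otimes> desc_prod Q q m k | h k. h \<in> H \<and> k \<le> m}"
  have sub: "q ` {1..<m} \<subseteq> carrier Q" using m by (auto intro!: q_closed)
  interpret H: subgroup H Q unfolding H_def by (rule generate_is_subgroup[OF sub])
  have qH: "q i \<in> H" if "i \<in> {1..<m}" for i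
    unfolding H_def using that by (blast intro: generate.incl)
  have YI: "h \<otimes> desc_prod Q q m k \<in> Y" if "h \<in> H" "k \<le> m" for h k
    using that unfolding Y_def by blast
  have Y1: "\<one> \<in> Y" using YI[OF H.one_closed, of 0] by simp
  have Yc: "Y \<subseteq> carrier Q"
    unfolding Y_def using desc_prod_closed[OF m(2)] by auto
  have step: "y \<otimes> q i \<in> Y" if y: "y \<in> Y" and i: "i \<in> {1..<Suc m}" for y i
  proof -
    obtain h k where hk: "y = h \<otimes> desc_prod Q q m k" "h \<in> H" "k \<le> m"
      using y unfolding Y_def by blast
    have c: "h \<in> carrier Q" "desc_prod Q q m k \<in> carrier Q" "q i \<in> carrier Q"
      using hk desc_prod_closed[OF m(2)] i m by (auto intro!: q_closed)
    have eq: "y \<otimes> q i = h \<otimes> (desc_prod Q q m k \<otimes> q i)"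
      unfolding hk(1) using c by (simp add: m_assoc)
    \<comment> \<open>The last factor of the product is \<open>q (m - k + 1)\<close>. Accordingly
      \<open>q i\<close> commutes with the product, lengthens it, cancels its last factor, or
      crosses it with the index lowered by one.\<close>
    consider "i + k < m" | "i + k = m" | "i + k = m + 1" | "m + 1 < i + k" by linarith
    then show ?thesis
    proof cases
      case 1
      then have "y \<otimes> q i = (h \<otimes> q i) \<otimes> desc_prod Q q m k"
        unfolding eq using desc_prod_commute_low[OF m(2), of i k] i hk m c by (simp add: m_assoc)
      moreover have "h \<otimes> q i \<in> H" using hk qH[of i] 1 i by auto
      ultimately show ?thesis using YI hk by simp
    next
      case 2
      then have "y \<otimes> q i = h \<otimes> desc_prod Q q m (Suc k)" unfolding eq by (simp flip: 2)
      moreover have "Suc k \<le> m" using 2 i by auto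
      ultimately show ?thesis using YI hk by metis
    next
      case 3
      then obtain l where l: "k = Suc l" "m - l = i" using i by (cases k) auto
      have "desc_prod Q q m l \<in> carrier Q" using l hk desc_prod_closed[OF m(2)] by auto
      then have "desc_prod Q q m k \<otimes> q i = desc_prod Q q m l"
        using l c i m by (simp add: m_assoc q_square)
      then show ?thesis unfolding eq using YI[OF hk(2), of l] hk(3) l(1) by simp
    next
      case 4
      then have "i - 1 \<in> {1..<n}" using hk(3) i m by auto
      then have "q (i - 1) \<in> carrier Q" by (rule q_closed)
      with 4 have "y \<otimes> q i = (h \<otimes> q (i - 1)) \<otimes> desc_prod Q q m k"
        unfolding eq using desc_prod_commute_high[OF m(2), of k i] i hk m c
        by (simp add: m_assoc)
      moreover have "i - 1 \<in> {1..<m}" using 4 hk(3) i by auto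
      then have "h \<otimes> q (i - 1) \<in> H" using hk(2) qH by simp
      ultimately show ?thesis using YI hk by simp
    qed
  qed
  have "\<forall>y\<in>Y. y \<otimes> x \<in> Y"
    using x
  proof (induction rule: generate.induct)
    case one
    then show ?case using Yc by auto
  next
    case (incl h)
    then show ?case using step by auto
  next
    case (inv h)
    then obtain i where i: "i \<in> {1..<Suc m}" "h = q i" by auto
    have "inv (q i) = q i"
      using q_square[of i] q_closed[of i] i m by (intro inv_equality) auto
    then show ?case using step i by auto
  next
    case (eng h1 h2)
    have "q ` {1..<Suc m} \<subseteq> carrier Q" using m by (auto intro!: q_closed)
    from generate_in_carrier[OF this] have "h1 \<in> carrier Q" "h2 \<in> carrier Q" using eng by auto
    show ?case
    proof
      fix y assume y: "y \<in> Y"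
      then have "y \<otimes> (h1 \<otimes> h2) = y \<otimes> h1 \<otimes> h2"
        using Yc \<open>h1 \<in> carrier Q\<close> \<open>h2 \<in> carrier Q\<close> by (subst m_assoc) auto
      then show "y \<otimes> (h1 \<otimes> h2) \<in> Y" using eng y by simp
    qed
  qed
  then have "\<one> \<otimes> x \<in> Y" using Y1 by blast
  moreover have "x \<in> carrier Q"
    using m by (intro generate_in_carrier[OF _ x]) (auto intro!: q_closed)
  ultimately show ?thesis unfolding Y_def H_def by auto
qed

text \<open>Faithfulness of the Coxeter presentation of the symmetric group.\<close>

lemma generate_perm_eq_one:
  assumes p: "p \<in> hom Q (sym_group n)"
    and pq: "\<And>i. i \<in> {1..<n} \<Longrightarrow> p (q i) = Transposition.transpose i (i + 1)"
  shows "x \<in> generate Q (q ` {1..<m}) \<Longrightarrow> m \<le> n \<Longrightarrow> p x = id \<Longrightarrow> x = \<one>"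
proof (induction m arbitrary: x)
  case 0
  then show ?case by (simp add: generate_empty)
next
  case (Suc m)
  interpret p: group_hom Q "sym_group n" p
    using p by (simp add: group_hom_def group_hom_axioms_def sym_group_is_group is_group)
  show ?case
  proof (cases "m = 0")
    case True
    then show ?thesis using Suc.prems by (simp add: generate_empty)
  next
    case False
    then have m: "1 \<le> m" "m < n" using Suc.prems by auto
    obtain h k where hk: "h \<in> generate Q (q ` {1..<m})" "k \<le> m" "x = h \<otimes> desc_prod Q q m k"
      using generate_coset[OF m Suc.prems(1)] by blast
    have sub: "q ` {1..<m} \<subseteq> carrier Q" using m by (auto intro!: q_closed)
    have hc: "h \<in> carrier Q" using generate_in_carrier[OF sub hk(1)] .
    have dc: "desc_prod Q q m k \<in> carrier Q" using desc_prod_closed hk m by auto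
    have fix_h: "p h (m + 1) = m + 1"
      using hk(1)
    proof (induction rule: generate.induct)
      case one
      then show ?case by (simp add: p.hom_one sym_group_one)
    next
      case (incl h)
      then obtain i where i: "i \<in> {1..<m}" "h = q i" by auto
      then show ?case using pq[of i] i m by (simp add: Transposition.transpose_def)
    next
      case (inv h)
      then obtain i where i: "i \<in> {1..<m}" "h = q i" by auto
      have "inv (q i) = q i"
        using q_square[of i] q_closed[of i] i m by (intro inv_equality) auto
      then show ?case using pq[of i] i m by (simp add: Transposition.transpose_def)
    next
      case (eng h1 h2)
      have "h1 \<in> carrier Q" "h2 \<in> carrier Q" using generate_in_carrier[OF sub] eng by auto
      then show ?case using eng by (simp add: p.hom_mult sym_group_mult)
    qed
    have d: "l \<le> m \<Longrightarrow> p (desc_prod Q q m l) (m + 1 - l) = m + 1" for l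
    proof (induction l)
      case 0
      then show ?case by (simp add: p.hom_one sym_group_one)
    next
      case (Suc l)
      have "desc_prod Q q m l \<in> carrier Q" "q (m - l) \<in> carrier Q"
        using Suc.prems desc_prod_closed m by (auto intro!: q_closed)
      moreover have "p (q (m - l)) = Transposition.transpose (m - l) (m - l + 1)"
        using Suc.prems m by (intro pq) auto
      ultimately show ?case using Suc by (simp add: p.hom_mult sym_group_mult Suc_diff_le)
    qed
    \<comment> \<open>The coset is recognised by the point sent to \<open>m + 1\<close>: the
      representative sends \<open>m + 1 - k\<close> there and \<open>h\<close> leaves
      \<open>m + 1\<close> fixed, so a trivial permutation forces \<open>k = 0\<close> and the
      induction descends.\<close>
    have "p x (m + 1 - k) = p h (p (desc_prod Q q m k) (m + 1 - k))"
      unfolding hk(3) using hc dc by (simp add: p.hom_mult sym_group_mult)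
    then have "m + 1 - k = m + 1"
      unfolding d[OF hk(2)] fix_h Suc.prems(3) by simp
    then have "k = 0" using hk(2) by linarith
    then have "x = h" using hk hc by simp
    then show ?thesis using Suc.IH[OF hk(1)[folded \<open>x = h\<close>]] Suc.prems by auto
  qed
qed

end

section \<open>Coordinates on abelian sections and lifting through them\<close>

context group
begin

lemma cancel_inv:
  assumes "x \<in> carrier G" "y \<in> carrier G"
  shows "inv x \<otimes> (x \<otimes> y) = y" "x \<otimes> (inv x \<otimes> y) = y"
  using assms by (simp_all flip: m_assoc)

lemma additive_int_pow:
  fixes lam :: "'a \<Rightarrow> int"
  assumes N: "subgroup N G" and mult: "\<And>h k. h \<in> N \<Longrightarrow> k \<in> N \<Longrightarrow> lam (h \<otimes> k) = lam h + lam k"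
  shows "lam \<one> = 0" and "h \<in> N \<Longrightarrow> lam (inv h) = - lam h"
    and "h \<in> N \<Longrightarrow> lam (h [^] (k :: int)) = k * lam h"
proof -
  interpret N: subgroup N G by fact
  show one: "lam \<one> = 0"
    using mult[OF N.one_closed N.one_closed] by simp
  show inv: "lam (inv h) = - lam h" if "h \<in> N" for h
    using mult[OF N.m_inv_closed[OF that] that] that one by simp
  have nat: "h [^] k \<in> N \<and> lam (h [^] k) = int k * lam h" if "h \<in> N" for h and k :: nat
    by (induction k) (use that one mult in \<open>auto simp: algebra_simps\<close>)
  show "lam (h [^] k) = k * lam h" if h: "h \<in> N" for h and k :: int
  proof (cases k rule: int_cases2)
    case (nonneg n)
    then show ?thesis using nat[OF h] by (simp add: int_pow_int)
  next
    case (nonpos n)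
    then show ?thesis using nat[OF h] inv h by (simp add: int_pow_neg_int)
  qed
qed

text \<open>Modulo \<open>N'\<close> the group \<open>N\<close> is commutative, so the powers of
  \<open>a\<close> can be collected on the right. Each exchange costs a commutator in
  \<open>N'\<close>, which the smaller generating set absorbs.\<close>

lemma generate_insert_decompose:
  assumes N: "subgroup N G" and N': "subgroup N' G" "N' \<subseteq> N"
    and comm: "\<And>h k. h \<in> N \<Longrightarrow> k \<in> N \<Longrightarrow> h \<otimes> k \<otimes> inv h \<otimes> inv k \<in> N'"
    and S: "S \<subseteq> N" and a: "a \<in> N" and m: "m \<in> generate G (insert a S \<union> N')"
  shows "\<exists>u\<in>generate G (S \<union> N'). \<exists>k::int. m = u \<otimes> a [^] k"
proof -
  interpret N: subgroup N G by fact
  let ?H = "generate G (S \<union> N')"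
  have HN: "?H \<subseteq> N" using generate_subgroup_incl[OF _ N] S N' by blast
  interpret H: subgroup ?H G
    using S N'(2) N.subset by (intro generate_is_subgroup) auto
  have N'H: "N' \<subseteq> ?H" by (auto intro: generate.incl)
  have ac: "a \<in> carrier G" using a by auto
  have pow: "a [^] k \<in> N" for k :: int using subgroup_int_pow_closed[OF N a] .
  from m show ?thesis
  proof (induction rule: generate.induct)
    case one
    have "\<one> = \<one> \<otimes> a [^] (0::int)" by simp
    then show ?case using H.one_closed by blast
  next
    case (incl h)
    have "a = \<one> \<otimes> a [^] (1::int)" "h \<in> carrier G \<Longrightarrow> h = h \<otimes> a [^] (0::int)" using ac by (simp_all add: int_pow_1)
    moreover have "h = a \<or> h \<in> ?H" using incl by (auto intro: generate.incl)
    ultimately show ?case using H.one_closed H.mem_carrier by metis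
  next
    case (inv h)
    have "inv a = \<one> \<otimes> a [^] (-1::int)" "inv h \<in> carrier G \<Longrightarrow> inv h = inv h \<otimes> a [^] (0::int)"
      using ac by (simp_all add: int_pow_neg int_pow_1)
    moreover have "h = a \<or> inv h \<in> ?H" using inv by (auto intro: generate.inv)
    ultimately show ?case using H.one_closed H.mem_carrier by metis
  next
    case (eng h1 h2)
    then obtain u k u' l where u: "u \<in> ?H" "u' \<in> ?H" and h: "h1 = u \<otimes> a [^] (k::int)" "h2 = u' \<otimes> a [^] (l::int)"
      by blast
    have c: "u \<in> carrier G" "u' \<in> carrier G" using u by auto
    let ?w = "a [^] k \<otimes> u' \<otimes> inv (a [^] k) \<otimes> inv u'"
    have w: "?w \<in> ?H" using comm[OF pow, of u' k] u HN N'H by blast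
    have wu: "?w \<otimes> u' = a [^] k \<otimes> u' \<otimes> inv (a [^] k)"
      using c ac by (simp add: m_assoc)
    have "u \<otimes> (?w \<otimes> u') \<otimes> a [^] (k + l) = h1 \<otimes> h2"
      unfolding h wu using c ac by (simp add: m_assoc int_pow_mult cancel_inv)
    moreover have "u \<otimes> (?w \<otimes> u') \<in> ?H" using H.m_closed[OF u(1) H.m_closed[OF w u(2)]] .
    ultimately show ?case by metis
  qed
qed

text \<open>Functionals dual to generators up to the factor \<open>c\<close> show that
  \<open>N\<close> modulo \<open>N'\<close> is free abelian on these generators. The generators are
  removed one at a time, each coordinate killing one exponent. The factor is 2 for windings and 24
  for triple windings.\<close>

lemma coordinates_free_basis:
  fixes lam :: "'i \<Rightarrow> 'a \<Rightarrow> int"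
  assumes N: "subgroup N G" and N': "subgroup N' G" "N' \<subseteq> N"
    and comm: "\<And>h k. h \<in> N \<Longrightarrow> k \<in> N \<Longrightarrow> h \<otimes> k \<otimes> inv h \<otimes> inv k \<in> N'"
    and I: "finite I" and A: "\<And>i. i \<in> I \<Longrightarrow> A i \<in> N"
    and gen: "N \<subseteq> generate G (A ` I \<union> N')"
    and lam_mult: "\<And>i h k. i \<in> I \<Longrightarrow> h \<in> N \<Longrightarrow> k \<in> N \<Longrightarrow> lam i (h \<otimes> k) = lam i h + lam i k"
    and lam_zero: "\<And>i h. i \<in> I \<Longrightarrow> h \<in> N' \<Longrightarrow> lam i h = 0"
    and lam_A: "\<And>i j. i \<in> I \<Longrightarrow> j \<in> I \<Longrightarrow> lam i (A j) = (if i = j then c else 0)" and c: "c \<noteq> 0"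
  shows "m \<in> N \<Longrightarrow> (\<And>i. i \<in> I \<Longrightarrow> lam i m = 0) \<Longrightarrow> m \<in> N'"
    and "\<exists>m\<in>N. \<forall>i\<in>I. lam i m = c * v i"
proof -
  interpret N: subgroup N G by fact
  have pow: "lam i \<one> = 0" "h \<in> N \<Longrightarrow> lam i (inv h) = - lam i h"
    "h \<in> N \<Longrightarrow> lam i (h [^] (k :: int)) = k * lam i h" if "i \<in> I" for i h k
    using additive_int_pow[OF N, of "lam i"] lam_mult[OF that] by auto
  have gen_N: "generate G (A ` J \<union> N') \<subseteq> N" if "J \<subseteq> I" for J
    using that A N' by (intro generate_subgroup_incl[OF _ N]) auto
  have *: "m \<in> N'" if "finite J" "J \<subseteq> I" "m \<in> generate G (A ` J \<union> N')" "\<And>i. i \<in> J \<Longrightarrow> lam i m = 0" for J m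
    using that
  proof (induction J arbitrary: m rule: finite_induct)
    case empty
    then show ?case using generate_subgroup_incl[OF order_refl N'(1)] by auto
  next
    case (insert i J)
    have "A ` J \<subseteq> N" "A i \<in> N" using A insert.prems by auto
    then obtain u k where u: "u \<in> generate G (A ` J \<union> N')" and m: "m = u \<otimes> A i [^] (k::int)"
      using generate_insert_decompose[OF N N' comm, of "A ` J" "A i" m] insert.prems by auto
    have i: "i \<in> I" and J: "J \<subseteq> I" using insert.prems by auto
    have uN: "u \<in> N" using gen_N[OF J] u by auto
    \<comment> \<open>All generators of the group containing \<open>u\<close> have coordinate
      \<open>i\<close> equal to zero, so that this coordinate of \<open>m\<close> sees only the
      exponent of \<open>A i\<close>.\<close>
    have "lam i u = 0"
      using u
    proof (induction rule: generate.induct)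
      case (incl h)
      then show ?case using lam_A lam_zero i J insert.hyps by auto
    next
      case (inv h)
      moreover have "h \<in> N" using inv A J N' by auto
      ultimately show ?case using lam_A lam_zero i J insert.hyps pow(2)[OF i] by auto
    next
      case (eng h1 h2)
      then show ?case using lam_mult[OF i, of h1 h2] gen_N[OF J] by auto
    qed (use pow(1)[OF i] in auto)
    moreover have "lam i m = lam i u + k * c"
      unfolding m using lam_mult[OF i uN subgroup_int_pow_closed[OF N A[OF i]]] pow(3)[OF i A[OF i]] lam_A[OF i i]
      by simp
    ultimately have "k = 0" using insert.prems(3)[of i] c by simp
    then have "m = u" using m uN by simp
    then show ?case using insert.IH[of m] J u insert.prems by auto
  qed
  show "m \<in> N'" if "m \<in> N" "\<And>i. i \<in> I \<Longrightarrow> lam i m = 0"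
    using *[OF I order_refl] gen that by blast
  have "\<exists>m\<in>N. \<forall>i\<in>I. lam i m = (if i \<in> J then c * v i else 0)" if "finite J" "J \<subseteq> I" for J
    using that
  proof (induction J rule: finite_induct)
    case empty
    show ?case using pow(1) N.one_closed by (intro bexI[of _ "\<one>"]) auto
  next
    case (insert j J)
    then obtain m where m: "m \<in> N" "\<forall>i\<in>I. lam i m = (if i \<in> J then c * v i else 0)" by auto
    have j: "j \<in> I" using insert by auto
    have Aj: "A j [^] v j \<in> N" using subgroup_int_pow_closed[OF N A[OF j]] .
    show ?case
    proof (intro bexI[of _ "m \<otimes> A j [^] v j"] ballI)
      fix i assume i: "i \<in> I"
      show "lam i (m \<otimes> A j [^] v j) = (if i \<in> insert j J then c * v i else 0)"
        unfolding lam_mult[OF i m(1) Aj] pow(3)[OF i A[OF j]] using m(2) i j lam_A insert.hyps by auto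
    qed (use m(1) Aj in auto)
  qed
  from this[OF I order_refl] show "\<exists>m\<in>N. \<forall>i\<in>I. lam i m = c * v i" by simp
qed

end

text \<open>Choose a representative in each orbit. By freeness, the group element that carries the
  representative to a given point is unique, and uniqueness makes it equivariant.\<close>

lemma free_action_section:
  fixes K (structure) and act :: "'k \<Rightarrow> 'x \<Rightarrow> 'x"
  assumes "group K"
    and act: "\<And>g T. g \<in> carrier K \<Longrightarrow> T \<in> Ts \<Longrightarrow> act g T \<in> Ts"
      "\<And>g h T. g \<in> carrier K \<Longrightarrow> h \<in> carrier K \<Longrightarrow> T \<in> Ts \<Longrightarrow> act (g \<otimes> h) T = act g (act h T)"
      "\<And>T. T \<in> Ts \<Longrightarrow> act \<one> T = T"
    and free: "\<And>g T. g \<in> carrier K \<Longrightarrow> T \<in> Ts \<Longrightarrow> act g T = T \<Longrightarrow> g = \<one>"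
  shows "\<exists>\<kappa>. \<forall>T\<in>Ts. \<kappa> T \<in> carrier K \<and> (\<forall>g\<in>carrier K. \<kappa> (act g T) = g \<otimes> \<kappa> T)"
proof -
  interpret group K by fact
  define orb where "orb T = {act g T | g. g \<in> carrier K}" for T
  \<comment> \<open>The choice depends on the orbit as a set, so all points of an orbit receive the
    same representative.\<close>
  define r where "r T = (SOME S. S \<in> orb T)" for T
  define \<kappa> where "\<kappa> T = (SOME k. k \<in> carrier K \<and> act k (r T) = T)" for T
  have orb_act: "orb (act g T) = orb T" if "g \<in> carrier K" "T \<in> Ts" for g T
  proof -
    have "act h T \<in> orb (act g T)" if "h \<in> carrier K" for h
    proof -
      have "act (h \<otimes> inv g) (act g T) = act (h \<otimes> inv g \<otimes> g) T"
        using that \<open>g \<in> carrier K\<close> \<open>T \<in> Ts\<close> by (subst act(2)) simp_all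
      then have "act h T = act (h \<otimes> inv g) (act g T)"
        using that \<open>g \<in> carrier K\<close> by (simp add: m_assoc)
      then show ?thesis unfolding orb_def using that \<open>g \<in> carrier K\<close> by blast
    qed
    moreover have "act h (act g T) \<in> orb T" if "h \<in> carrier K" for h
      using that \<open>g \<in> carrier K\<close> \<open>T \<in> Ts\<close> act(2)[of h g T] unfolding orb_def
      by (metis (mono_tags, lifting) m_closed mem_Collect_eq)
    ultimately show ?thesis unfolding orb_def by blast
  qed
  have r: "\<exists>k\<in>carrier K. r T = act k T" if "T \<in> Ts" for T
  proof -
    have "act \<one> T \<in> orb T" unfolding orb_def by blast
    then have "r T \<in> orb T" unfolding r_def by (rule someI)
    then show ?thesis unfolding orb_def by blast
  qed
  have rTs: "r T \<in> Ts" if "T \<in> Ts" for T using r[OF that] act(1) that by auto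
  have k: "\<kappa> T \<in> carrier K \<and> act (\<kappa> T) (r T) = T" if "T \<in> Ts" for T
  proof -
    obtain k where k: "k \<in> carrier K" "r T = act k T" using r[OF \<open>T \<in> Ts\<close>] by blast
    then have "inv k \<in> carrier K \<and> act (inv k) (r T) = T"
      using act(2)[of "inv k" k T] act(3) that by simp
    then show ?thesis unfolding \<kappa>_def by (rule someI)
  qed
  have "\<kappa> (act g T) = g \<otimes> \<kappa> T" if g: "g \<in> carrier K" and T: "T \<in> Ts" for g T
  proof -
    let ?h = "\<kappa> (act g T)"
    have rr: "r (act g T) = r T" unfolding r_def orb_act[OF g T] ..
    have h: "?h \<in> carrier K" "act ?h (r T) = act g T" using k[OF act(1)[OF g T]] rr by auto
    have kT: "\<kappa> T \<in> carrier K" "act (\<kappa> T) (r T) = T" using k[OF T] by auto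
    have "act (inv (g \<otimes> \<kappa> T) \<otimes> ?h) (r T) = act (inv (g \<otimes> \<kappa> T)) (act (g \<otimes> \<kappa> T) (r T))"
      using h kT g rTs[OF T] by (simp add: act(2) del: inv_mult_group)
    also have "\<dots> = r T"
      using kT g rTs[OF T] by (subst act(2)[symmetric]) (auto simp: act(3))
    finally have "inv (g \<otimes> \<kappa> T) \<otimes> ?h = \<one>"
      using free[of "inv (g \<otimes> \<kappa> T) \<otimes> ?h" "r T"] rTs[OF T] h kT g by simp
    then have "(g \<otimes> \<kappa> T) \<otimes> (inv (g \<otimes> \<kappa> T) \<otimes> ?h) = g \<otimes> \<kappa> T"
      using kT g by simp
    then show ?thesis using h kT g by (simp add: cancel_inv del: inv_mult_group)
  qed
  then show ?thesis using k by blast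
qed

text \<open>With the 2-cocycle \<open>F g h = e g \<otimes> e h \<otimes> inv (e (g h))\<close> and an equivariant map \<open>\<kappa>\<close>, the formula
  \<open>c g (T) = F g (g\<inverse> \<kappa> T) (T)\<close> defines a 1-cochain with coboundary \<open>F\<close>.\<close>

lemma lift_modulo_coordinates:
  fixes G (structure) and K :: "('k, 'm) monoid_scheme" and act :: "'k \<Rightarrow> 'x \<Rightarrow> 'x"
    and lam :: "'x \<Rightarrow> 'a \<Rightarrow> int"
  assumes "group K" and "N \<lhd> G"
    and e: "\<And>g. g \<in> carrier K \<Longrightarrow> e g \<in> carrier G"
      "\<And>g h. g \<in> carrier K \<Longrightarrow> h \<in> carrier K \<Longrightarrow> e g \<otimes> e h \<otimes> inv (e (g \<otimes>\<^bsub>K\<^esub> h)) \<in> N"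
    and lam_mult: "\<And>T h k. T \<in> Ts \<Longrightarrow> h \<in> N \<Longrightarrow> k \<in> N \<Longrightarrow> lam T (h \<otimes> k) = lam T h + lam T k"
    and detect: "\<And>m. m \<in> N \<Longrightarrow> (\<And>T. T \<in> Ts \<Longrightarrow> lam T m = 0) \<Longrightarrow> m \<in> N'"
    and equivariant: "\<And>g m T. g \<in> carrier K \<Longrightarrow> m \<in> N \<Longrightarrow> T \<in> Ts \<Longrightarrow>
      lam (act g T) (e g \<otimes> m \<otimes> inv (e g)) = lam T m"
    and act: "\<And>g T. g \<in> carrier K \<Longrightarrow> T \<in> Ts \<Longrightarrow> act g T \<in> Ts"
      "\<And>g h T. g \<in> carrier K \<Longrightarrow> h \<in> carrier K \<Longrightarrow> T \<in> Ts \<Longrightarrow> act (g \<otimes>\<^bsub>K\<^esub> h) T = act g (act h T)"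
      "\<And>T. T \<in> Ts \<Longrightarrow> act \<one>\<^bsub>K\<^esub> T = T"
    and \<kappa>: "\<And>T. T \<in> Ts \<Longrightarrow> \<kappa> T \<in> carrier K"
      "\<And>g T. g \<in> carrier K \<Longrightarrow> T \<in> Ts \<Longrightarrow> \<kappa> (act g T) = g \<otimes>\<^bsub>K\<^esub> \<kappa> T"
    and glue: "\<And>f. (\<And>g. g \<in> carrier K \<Longrightarrow> f g \<in> N) \<Longrightarrow> \<exists>m\<in>N. \<forall>T\<in>Ts. lam T m = lam T (f (\<kappa> T))"
  shows "\<exists>e'. (\<forall>g\<in>carrier K. e' g \<in> carrier G \<and> e' g \<otimes> inv (e g) \<in> N) \<and>
    (\<forall>g\<in>carrier K. \<forall>h\<in>carrier K. e' g \<otimes> e' h \<otimes> inv (e' (g \<otimes>\<^bsub>K\<^esub> h)) \<in> N')"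
proof -
  interpret K: group K by fact
  interpret N: normal N G by fact
  have add: "lam T (inv h) = - lam T h" if "T \<in> Ts" "h \<in> N" for T h
    using N.additive_int_pow(2)[OF N.subgroup_axioms, of "lam T"] lam_mult[OF that(1)] that(2) by auto
  define F where "F g h = e g \<otimes> e h \<otimes> inv (e (g \<otimes>\<^bsub>K\<^esub> h))" for g h
  have FN: "F g h \<in> N" if "g \<in> carrier K" "h \<in> carrier K" for g h
    unfolding F_def using e(2) that .
  have cocycle: "(e g \<otimes> F h k \<otimes> inv (e g)) \<otimes> F g (h \<otimes>\<^bsub>K\<^esub> k) = F g h \<otimes> F (g \<otimes>\<^bsub>K\<^esub> h) k"
    if "g \<in> carrier K" "h \<in> carrier K" "k \<in> carrier K" for g h k
    unfolding F_def using that e(1)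
    by (simp add: N.m_assoc K.m_assoc N.inv_mult_group N.cancel_inv)
  \<comment> \<open>Each coordinate of the cochain is copied from a different value of
    \<open>F\<close>, selected by \<open>\<kappa> T\<close>; \<open>glue\<close> realises all these
    coordinates by one element of \<open>N\<close>.\<close>
  have "\<exists>m\<in>N. \<forall>T\<in>Ts. lam T m = lam T (F g (inv\<^bsub>K\<^esub> g \<otimes>\<^bsub>K\<^esub> \<kappa> T))" if "g \<in> carrier K" for g
    using glue[of "\<lambda>k. F g (inv\<^bsub>K\<^esub> g \<otimes>\<^bsub>K\<^esub> k)"] FN that by simp
  then have "\<exists>c. \<forall>g\<in>carrier K. c g \<in> N \<and> (\<forall>T\<in>Ts. lam T (c g) = lam T (F g (inv\<^bsub>K\<^esub> g \<otimes>\<^bsub>K\<^esub> \<kappa> T)))"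
    by (intro bchoice) blast
  then obtain c where c: "\<And>g. g \<in> carrier K \<Longrightarrow> c g \<in> N"
    "\<And>g T. g \<in> carrier K \<Longrightarrow> T \<in> Ts \<Longrightarrow> lam T (c g) = lam T (F g (inv\<^bsub>K\<^esub> g \<otimes>\<^bsub>K\<^esub> \<kappa> T))"
    by blast
  define e' where "e' g = inv (c g) \<otimes> e g" for g
  have cG: "c g \<in> carrier G" if "g \<in> carrier K" for g using c(1)[OF that] by auto
  have "e' g \<in> carrier G \<and> e' g \<otimes> inv (e g) \<in> N" if "g \<in> carrier K" for g
    unfolding e'_def using e(1)[OF that] cG[OF that] c(1)[OF that] by (auto simp: N.m_assoc)
  moreover have "e' g \<otimes> e' h \<otimes> inv (e' (g \<otimes>\<^bsub>K\<^esub> h)) \<in> N'" if g: "g \<in> carrier K" and h: "h \<in> carrier K" for g h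
  proof (rule detect)
    let ?gh = "g \<otimes>\<^bsub>K\<^esub> h"
    let ?d = "e g \<otimes> c h \<otimes> inv (e g)"
    have gh: "?gh \<in> carrier K" using g h by simp
    have dN: "?d \<in> N" using c(1)[OF h] e(1)[OF g] by (simp add: N.inv_op_closed2)
    \<comment> \<open>The defect of the corrected lift is \<open>F g h\<close> modified by the
      coboundary of \<open>c\<close>. As coordinates are additive, it remains to see that the four
      contributions cancel.\<close>
    have eq: "e' g \<otimes> e' h \<otimes> inv (e' ?gh) = inv (c g) \<otimes> (inv ?d \<otimes> (F g h \<otimes> c ?gh))"
      unfolding e'_def F_def using e(1) cG g h gh
      by (simp add: N.m_assoc N.inv_mult_group N.cancel_inv)
    then show "e' g \<otimes> e' h \<otimes> inv (e' ?gh) \<in> N"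
      using c(1) g h gh dN FN by simp
    fix T assume T: "T \<in> Ts"
    define T' where "T' = act (inv\<^bsub>K\<^esub> g) T"
    have T': "T' \<in> Ts" "act g T' = T"
      unfolding T'_def using T g by (auto simp: act(1) act(3) simp flip: act(2))
    \<comment> \<open>With this third argument, the coordinates of \<open>c g\<close> and
      \<open>c ?gh\<close> at \<open>T\<close> and of \<open>c h\<close> at \<open>T'\<close> are
      those of \<open>F g (h k)\<close>, \<open>F (g h) k\<close> and \<open>F h k\<close>, the
      terms of the cocycle identity for \<open>g\<close>, \<open>h\<close>, \<open>k\<close>.
      Conjugation by \<open>e g\<close> carries coordinate \<open>T'\<close> to
      \<open>T\<close>.\<close>
    define k where "k = inv\<^bsub>K\<^esub> ?gh \<otimes>\<^bsub>K\<^esub> \<kappa> T"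
    have k: "k \<in> carrier K" unfolding k_def using gh \<kappa>(1)[OF T] by simp
    have k1: "inv\<^bsub>K\<^esub> g \<otimes>\<^bsub>K\<^esub> \<kappa> T = h \<otimes>\<^bsub>K\<^esub> k" "inv\<^bsub>K\<^esub> h \<otimes>\<^bsub>K\<^esub> \<kappa> T' = k"
      unfolding k_def T'_def using g h T \<kappa> by (auto simp: K.inv_mult_group K.m_assoc K.cancel_inv)
    have "lam T (inv (c g) \<otimes> (inv ?d \<otimes> (F g h \<otimes> c ?gh)))
       = - lam T (c g) + (- lam T ?d + (lam T (F g h) + lam T (c ?gh)))"
      using lam_mult[OF T] add[OF T] c(1) g h gh dN FN by simp
    also have "lam T ?d = lam T' (c h)"
      using equivariant[OF g c(1)[OF h] T'(1)] T'(2) by simp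
    also have "\<dots> = lam T' (F h k)" using c(2)[OF h T'(1)] k1 by simp
    also have "\<dots> = lam T (e g \<otimes> F h k \<otimes> inv (e g))"
      using equivariant[OF g FN[OF h k] T'(1)] T'(2) by simp
    also have "- lam T (c g) + (- \<dots> + (lam T (F g h) + lam T (c ?gh))) =
      (lam T (F g h) + lam T (F ?gh k)) - (lam T (e g \<otimes> F h k \<otimes> inv (e g)) + lam T (F g (h \<otimes>\<^bsub>K\<^esub> k)))"
      using c(2)[OF g T] c(2)[OF gh T] k1 unfolding k_def by simp
    also have "\<dots> = 0"
    proof -
      have "e g \<otimes> F h k \<otimes> inv (e g) \<in> N" using FN[OF h k] e(1)[OF g] by (simp add: N.inv_op_closed2)
      then show ?thesis
        using cocycle[OF g h k] lam_mult[OF T] FN g h k gh by (metis K.m_closed diff_self)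
    qed
    finally show "lam T (e' g \<otimes> e' h \<otimes> inv (e' ?gh)) = 0" unfolding eq .
  qed
  ultimately show ?thesis by blast
qed

section \<open>Braids, permutations and winding numbers\<close>

text \<open>Inverses and generated subgroups do not change on passing from \<open>N\<close> to
  \<open>G\<close>, so all later commutator calculations can be made in the ambient group.\<close>

lemma lower_central_subgroup_Suc:
  fixes G (structure)
  assumes "group G" and N: "N \<lhd> G"
  shows "lower_central (G\<lparr>carrier := N\<rparr>) (Suc (Suc l)) =
    generate G {h \<otimes> k \<otimes> inv h \<otimes> inv k | h k. h \<in> lower_central (G\<lparr>carrier := N\<rparr>) (Suc l) \<and> k \<in> N}"
proof -
  interpret group G by fact
  interpret N: normal N G by fact
  define L where "L = lower_central (G\<lparr>carrier := N\<rparr>) (Suc l)"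
  have "L \<subseteq> N"
    using lower_central_subset[OF subgroup_imp_group[OF N.subgroup_axioms]] by (simp add: L_def)
  then have LN: "h \<in> N" if "h \<in> L" for h using that by auto
  let ?C = "{h \<otimes> k \<otimes> inv h \<otimes> inv k | h k. h \<in> L \<and> k \<in> N}"
  have "h \<otimes> k \<otimes> inv\<^bsub>G\<lparr>carrier := N\<rparr>\<^esub> h \<otimes> inv\<^bsub>G\<lparr>carrier := N\<rparr>\<^esub> k = h \<otimes> k \<otimes> inv h \<otimes> inv k"
    if "h \<in> L" "k \<in> N" for h k
    using that LN m_inv_consistent[OF N.subgroup_axioms] by auto
  then have "{h \<otimes> k \<otimes> inv\<^bsub>G\<lparr>carrier := N\<rparr>\<^esub> h \<otimes> inv\<^bsub>G\<lparr>carrier := N\<rparr>\<^esub> k | h k. h \<in> L \<and> k \<in> N} = ?C"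
    by (intro Collect_cong) (metis (no_types, lifting))
  moreover have "?C \<subseteq> N" using LN by (auto intro!: N.m_closed N.m_inv_closed)
  ultimately show ?thesis
    using generate_consistent[OF _ N.subgroup_axioms, of ?C]
    by (simp add: commutator_subgroup_def L_def)
qed

text \<open>What is retained of the presentation: generators satisfying the relations, and the two
  homomorphisms that its universal property supplies. The bound on \<open>n\<close> provides
  \<open>s 1\<close> and \<open>s 2\<close>, on which the calculations with three strings
  rest.\<close>

locale artin_braids = group B for B (structure) +
  fixes n :: nat and s :: "nat \<Rightarrow> 'a" and \<rho> :: "'a \<Rightarrow> nat \<Rightarrow> nat"
    and \<omega> :: "'a \<Rightarrow> (nat \<Rightarrow> nat \<Rightarrow> int) \<times> (nat \<Rightarrow> nat \<Rightarrow> nat \<Rightarrow> int) \<times> (nat \<Rightarrow> nat)"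
  assumes three_le: "3 \<le> n"
    and gen_closed: "i \<in> {1..<n} \<Longrightarrow> s i \<in> carrier B"
    and gen_generate: "carrier B = generate B (s ` {1..<n})"
    and gen_commute: "i \<in> {1..<n} \<Longrightarrow> j \<in> {1..<n} \<Longrightarrow> i + 2 \<le> j \<Longrightarrow> s i \<otimes> s j = s j \<otimes> s i"
    and gen_braid: "1 \<le> i \<Longrightarrow> i + 2 \<le> n \<Longrightarrow> s i \<otimes> s (i + 1) \<otimes> s i = s (i + 1) \<otimes> s i \<otimes> s (i + 1)"
    and perm_hom: "\<rho> \<in> hom B (sym_group n)"
    and perm_gen: "i \<in> {1..<n} \<Longrightarrow> \<rho> (s i) = Transposition.transpose i (i + 1)"
    and chord_hom: "\<omega> \<in> hom B (chord_group n)"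
    and chord_gen: "i \<in> {1..<n} \<Longrightarrow> \<omega> (s i) = chord_gen i"
begin

sublocale perm: group_hom B "sym_group n" \<rho>
  using perm_hom by (simp add: group_hom_def group_hom_axioms_def sym_group_is_group is_group)

sublocale chord: group_hom B "chord_group n" \<omega>
  using chord_hom by (simp add: group_hom_def group_hom_axioms_def group_chord_group is_group)

definition pure :: "'a set" where "pure = kernel B (sym_group n) \<rho>"

abbreviation pure_central :: "nat \<Rightarrow> 'a set"
  where "pure_central k \<equiv> lower_central (B\<lparr>carrier := pure\<rparr>) k"

lemma pure_iff: "b \<in> pure \<longleftrightarrow> b \<in> carrier B \<and> \<rho> b = id"
  by (simp add: pure_def kernel_def sym_group_one)

sublocale pure: normal pure B
  unfolding pure_def by (rule perm.normal_kernel)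

lemma pure_central_normal: "pure_central k \<lhd> B"
  by (rule lower_central_normal[OF is_group pure.normal_axioms])

lemma pure_central_Suc:
  "pure_central (Suc (Suc l)) =
    generate B {h \<otimes> k \<otimes> inv h \<otimes> inv k | h k. h \<in> pure_central (Suc l) \<and> k \<in> pure}"
  by (rule lower_central_subgroup_Suc[OF is_group pure.normal_axioms])

lemma commutator_in_pure_central:
  assumes "h \<in> pure_central (Suc k)" "g \<in> pure"
  shows "h \<otimes> g \<otimes> inv h \<otimes> inv g \<in> pure_central (Suc (Suc k))"
  unfolding pure_central_Suc using assms by (blast intro: generate.incl)

lemma pure_central_subset: "pure_central (Suc (Suc k)) \<subseteq> pure_central (Suc k)"
proof -
  interpret L: normal "pure_central (Suc k)" B by (rule pure_central_normal)
  have "h \<otimes> g \<otimes> inv h \<otimes> inv g \<in> pure_central (Suc k)" if "h \<in> pure_central (Suc k)" "g \<in> pure" for h g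
  proof -
    have "h \<otimes> (g \<otimes> inv h \<otimes> inv g) \<in> pure_central (Suc k)"
      using that(2) by (intro L.m_closed[OF that(1)] L.inv_op_closed2 L.m_inv_closed[OF that(1)]) auto
    then show ?thesis using that by (simp add: m_assoc)
  qed
  then show ?thesis
    unfolding pure_central_Suc by (intro generate_subgroup_incl[OF _ L.subgroup_axioms]) auto
qed

lemma perm_mult: "b \<in> carrier B \<Longrightarrow> c \<in> carrier B \<Longrightarrow> \<rho> (b \<otimes> c) = \<rho> b \<circ> \<rho> c"
  by (simp add: perm.hom_mult sym_group_mult)

lemma perm_permutes: "b \<in> carrier B \<Longrightarrow> \<rho> b permutes {1..n}"
  using perm.hom_closed by (simp add: sym_group_carrier)

lemma perm_inv: "b \<in> carrier B \<Longrightarrow> \<rho> (inv b) (\<rho> b i) = i"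
  using perm_mult[of "inv b" b] by (simp add: perm.hom_one sym_group_one fun_eq_iff)

lemma perm_inv': "b \<in> carrier B \<Longrightarrow> \<rho> b (\<rho> (inv b) i) = i"
  using perm_mult[of b "inv b"] by (simp add: perm.hom_one sym_group_one fun_eq_iff)

lemma perm_eq_iff: "b \<in> carrier B \<Longrightarrow> \<rho> b i = \<rho> b j \<longleftrightarrow> i = j"
  using perm_inv by metis

text \<open>Coxeter's presentation of the symmetric group, read as a normal generation statement.\<close>

lemma pure_subset_normal:
  assumes N: "N \<lhd> B" and sq: "\<And>i. i \<in> {1..<n} \<Longrightarrow> s i \<otimes> s i \<in> N"
  shows "pure \<subseteq> N"
proof
  fix b assume b: "b \<in> pure"
  interpret N: normal N B by fact
  \<comment> \<open>\<open>N\<close> is not assumed to consist of pure braids, so the permutation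
    need not factor through \<open>B Mod N\<close>. Pairing a coset with the permutation restores a
    homomorphism to the symmetric group.\<close>
  let ?Q = "(B Mod N) \<times>\<times> sym_group n"
  let ?f = "\<lambda>b. (N #> b, \<rho> b)"
  have f: "?f \<in> hom B ?Q"
    unfolding hom_paired using N.r_coset_hom_Mod perm_hom by simp
  interpret f: group_hom B ?Q ?f
    using f DirProd_group[OF N.factorgroup_is_group sym_group_is_group]
    by (simp add: group_hom_def group_hom_axioms_def is_group)
  interpret C: coxeter_family ?Q "\<lambda>i. ?f (s i)" n
  proof unfold_locales
    fix i assume i: "i \<in> {1..<n}"
    show "?f (s i) \<in> carrier ?Q" by (rule f.hom_closed[OF gen_closed[OF i]])
    have "s i \<otimes> s i \<in> carrier B" using gen_closed[OF i] by simp
    then have "N #> (s i \<otimes> s i) = N" using sq[OF i] by (intro coset_join2 N.subgroup_axioms)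
    moreover have "\<rho> (s i \<otimes> s i) = id"
      using gen_closed[OF i] perm_gen[OF i] by (simp add: sym_group_mult)
    ultimately have "?f (s i \<otimes> s i) = \<one>\<^bsub>?Q\<^esub>" by (simp add: FactGroup_def sym_group_one)
    then show "?f (s i) \<otimes>\<^bsub>?Q\<^esub> ?f (s i) = \<one>\<^bsub>?Q\<^esub>"
      using f.hom_mult[OF gen_closed[OF i] gen_closed[OF i]] by simp
  next
    fix i j assume ij: "i \<in> {1..<n}" "j \<in> {1..<n}" "i + 2 \<le> j"
    then show "?f (s i) \<otimes>\<^bsub>?Q\<^esub> ?f (s j) = ?f (s j) \<otimes>\<^bsub>?Q\<^esub> ?f (s i)"
      using f.hom_mult[OF gen_closed gen_closed] gen_commute by metis
  next
    fix i assume i: "1 \<le> i" "i + 2 \<le> n"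
    then have "s i \<in> carrier B" "s (i + 1) \<in> carrier B" by (auto intro: gen_closed)
    then show "?f (s i) \<otimes>\<^bsub>?Q\<^esub> ?f (s (i + 1)) \<otimes>\<^bsub>?Q\<^esub> ?f (s i) =
        ?f (s (i + 1)) \<otimes>\<^bsub>?Q\<^esub> ?f (s i) \<otimes>\<^bsub>?Q\<^esub> ?f (s (i + 1))"
      using gen_braid[OF i] f.hom_mult m_closed by metis
  qed
  have "?f b \<in> generate ?Q (?f ` s ` {1..<n})"
    using f.generate_img[of "s ` {1..<n}"] gen_closed gen_generate b pure_iff by blast
  then have "?f b \<in> generate ?Q ((\<lambda>i. ?f (s i)) ` {1..<n})" by (simp only: image_image)
  then have "?f b = \<one>\<^bsub>?Q\<^esub>"
  proof (rule C.generate_perm_eq_one[rotated 2])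
    show "snd \<in> hom ?Q (sym_group n)"
      by (auto intro!: homI simp: mult_DirProd')
    show "snd (?f b) = id" using b by (simp add: pure_iff)
  qed (auto simp: perm_gen)
  then have "N #> b = N" by (simp add: FactGroup_def)
  then show "b \<in> N" using coset_join1[OF _ _ N.subgroup_axioms] b pure_iff by blast
qed

text \<open>The restriction to generators from \<open>s m\<close> on matters: for
  \<open>m = 3\<close> such lifts commute with \<open>s 1\<close>, and in general their permutations
  fix all points below \<open>m\<close>.\<close>

lemma ex_braid_with_perm:
  assumes m: "1 \<le> m" and \<pi>: "\<pi> permutes {m..n}"
  shows "\<exists>b\<in>generate B (s ` {m..<n}). \<rho> b = \<pi>"
  using \<pi> finite_atLeastAtMost
proof (induction rule: permutes_induct)
  case id
  show ?case using generate.one perm.hom_one sym_group_one by metis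
next
  case (swap a b p)
  have sub: "s ` {m..<n} \<subseteq> carrier B" using m by (auto intro: gen_closed)
  have "\<exists>c\<in>generate B (s ` {m..<n}). \<rho> c = Transposition.transpose a (a + Suc k)" if "m \<le> a" "a + Suc k \<le> n" for a k
    using that
  proof (induction k)
    case 0
    then have "s a \<in> generate B (s ` {m..<n})" by (intro generate.incl) auto
    moreover have "\<rho> (s a) = Transposition.transpose a (a + Suc 0)" using 0 m perm_gen[of a] by auto
    ultimately show ?case by blast
  next
    case (Suc k)
    then obtain c where c: "c \<in> generate B (s ` {m..<n})" "\<rho> c = Transposition.transpose a (a + Suc k)" by auto
    define i where "i = a + Suc k"
    have i: "i \<in> {m..<n}" "i \<in> {1..<n}" using Suc.prems m by (auto simp: i_def)
    have si: "s i \<in> generate B (s ` {m..<n})" using i by (intro generate.incl) auto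
    have cc: "c \<in> carrier B" using generate_in_carrier[OF sub c(1)] .
    \<comment> \<open>Conjugation by the adjacent transposition at \<open>i\<close> moves the far
      end of the transposition of \<open>a\<close> and \<open>i\<close> to
      \<open>i + 1\<close>.\<close>
    have "\<rho> (s i \<otimes> c \<otimes> s i) = Transposition.transpose i (i + 1) \<circ> Transposition.transpose a i \<circ> Transposition.transpose i (i + 1)"
      using cc gen_closed[OF i(2)] by (simp add: sym_group_mult perm_gen[OF i(2)] c(2)[folded i_def])
    also have "\<dots> = Transposition.transpose a (a + Suc (Suc k))"
      by (auto simp: Transposition.transpose_def fun_eq_iff i_def)
    finally show ?case using c(1) si by (blast intro: generate.eng)
  qed
  note up = this
  have tr: "\<exists>c\<in>generate B (s ` {m..<n}). \<rho> c = Transposition.transpose a b" if "m \<le> a" "a < b" "b \<le> n" for a b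
    using up[of a "b - a - 1"] that by simp
  obtain c where c: "c \<in> generate B (s ` {m..<n})" "\<rho> c = Transposition.transpose a b"
    using tr[of a b] tr[of b a] swap.hyps
    by (metis atLeastAtMost_iff linorder_neqE_nat transpose_commute)
  obtain b' where b': "b' \<in> generate B (s ` {m..<n})" "\<rho> b' = p" using swap by auto
  have "c \<otimes> b' \<in> generate B (s ` {m..<n})" "\<rho> (c \<otimes> b') = Transposition.transpose a b \<circ> p"
    using c b' generate_in_carrier[OF sub] by (auto intro: generate.eng simp: sym_group_mult)
  then show ?case by blast
qed

section \<open>Signed crossing numbers of pairs of strings and their degree two analogue for
  triples\<close>

definition winding :: "'a \<Rightarrow> nat \<Rightarrow> nat \<Rightarrow> int" where "winding b = fst (\<omega> b)"
definition triple_winding :: "'a \<Rightarrow> nat \<Rightarrow> nat \<Rightarrow> nat \<Rightarrow> int" where "triple_winding b = fst (snd (\<omega> b))"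

lemma chord_perm: "b \<in> carrier B \<Longrightarrow> snd (snd (\<omega> b)) = \<rho> b"
proof -
  have proj: "(\<lambda>w. snd (snd w)) \<in> hom (chord_group n) (sym_group n)"
    by (rule homI) (auto simp: chord_group_def sym_group_def)
  interpret p: group_hom B "sym_group n" "\<lambda>b. snd (snd (\<omega> b))"
    using Group.hom_compose[OF chord_hom proj]
    by (simp add: group_hom_def group_hom_axioms_def sym_group_is_group is_group comp_def)
  have sub: "s ` {1..<n} \<subseteq> carrier B" by (auto intro: gen_closed)
  show "snd (snd (\<omega> b)) = \<rho> b" if "b \<in> carrier B"
    using that unfolding gen_generate
  proof (induction rule: generate.induct)
    case one
    then show ?case using p.hom_one perm.hom_one by simp
  next
    case (incl h)
    then show ?case using chord_gen perm_gen by (auto simp: chord_gen_def)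
  next
    case (inv h)
    then have "snd (snd (\<omega> h)) = \<rho> h" using chord_gen perm_gen by (auto simp: chord_gen_def)
    moreover have "h \<in> carrier B" using inv sub by auto
    ultimately show ?case using p.hom_inv perm.hom_inv by metis
  next
    case (eng h1 h2)
    then have "h1 \<in> carrier B" "h2 \<in> carrier B" using generate_in_carrier[OF sub] by auto
    then show ?case using eng p.hom_mult perm.hom_mult by metis
  qed
qed

lemma chord_eq: "b \<in> carrier B \<Longrightarrow> \<omega> b = (winding b, triple_winding b, \<rho> b)"
  using chord_perm[of b] by (simp add: winding_def triple_winding_def prod_eq_iff)

lemma winding_mult:
  assumes "b \<in> carrier B" "c \<in> carrier B"
  shows "winding (b \<otimes> c) i j = winding b (\<rho> c i) (\<rho> c j) + winding c i j"
    and "triple_winding (b \<otimes> c) i j k = triple_winding b (\<rho> c i) (\<rho> c j) (\<rho> c k) + triple_winding c i j k +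
      braid_bracket (\<lambda>i j. winding b (\<rho> c i) (\<rho> c j)) (winding c) i j k"
proof -
  have "\<omega> (b \<otimes> c) = (winding b, triple_winding b, \<rho> b) \<otimes>\<^bsub>chord_group n\<^esub> (winding c, triple_winding c, \<rho> c)"
    using chord.hom_mult[OF assms] chord_eq assms by simp
  then have "winding (b \<otimes> c) = (\<lambda>i j. winding b (\<rho> c i) (\<rho> c j) + winding c i j)"
    and "triple_winding (b \<otimes> c) = (\<lambda>i j k. triple_winding b (\<rho> c i) (\<rho> c j) (\<rho> c k)
      + triple_winding c i j k + braid_bracket (\<lambda>i j. winding b (\<rho> c i) (\<rho> c j)) (winding c) i j k)"
    using chord_eq[of "b \<otimes> c"] assms by (simp_all add: chord_group_def)
  then show "winding (b \<otimes> c) i j = winding b (\<rho> c i) (\<rho> c j) + winding c i j"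
    and "triple_winding (b \<otimes> c) i j k = triple_winding b (\<rho> c i) (\<rho> c j) (\<rho> c k) + triple_winding c i j k +
      braid_bracket (\<lambda>i j. winding b (\<rho> c i) (\<rho> c j)) (winding c) i j k"
    by simp_all
qed

lemma winding_gen: "i \<in> {1..<n} \<Longrightarrow> winding (s i) = crossing i"
  by (simp add: winding_def chord_gen chord_gen_def)

text \<open>Conjugation relabels the strings. In degree two this holds once the windings of
  \<open>m\<close> vanish, since the brackets are then zero. Comparing the two sides after
  multiplication by \<open>b\<close> on the right avoids a formula for the inverse.\<close>

lemma winding_conj:
  assumes b: "b \<in> carrier B" and m: "m \<in> pure"
  shows "winding (b \<otimes> m \<otimes> inv b) (\<rho> b i) (\<rho> b j) = winding m i j"
    and "(\<And>i j. winding m i j = 0) \<Longrightarrow>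
      triple_winding (b \<otimes> m \<otimes> inv b) (\<rho> b i) (\<rho> b j) (\<rho> b k) = triple_winding m i j k"
proof -
  have mc: "m \<in> carrier B" "\<rho> m = id" using m pure_iff by auto
  have eq: "(b \<otimes> m \<otimes> inv b) \<otimes> b = b \<otimes> m" using b mc by (simp add: m_assoc)
  have cc: "b \<otimes> m \<otimes> inv b \<in> carrier B" using b mc by simp
  show *: "winding (b \<otimes> m \<otimes> inv b) (\<rho> b i) (\<rho> b j) = winding m i j" for i j
    using winding_mult(1)[OF cc b, of i j] winding_mult(1)[OF b mc(1), of i j]
    unfolding eq mc(2) by simp
  show "triple_winding (b \<otimes> m \<otimes> inv b) (\<rho> b i) (\<rho> b j) (\<rho> b k) = triple_winding m i j k"
    if "\<And>i j. winding m i j = 0"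
    using winding_mult(2)[OF cc b, of i j k] winding_mult(2)[OF b mc(1), of i j k] that
    unfolding eq mc(2) * by (simp add: braid_bracket_def)
qed

lemma pure_winding_mult:
  assumes "h \<in> pure" "k \<in> pure"
  shows "winding (h \<otimes> k) i j = winding h i j + winding k i j"
    and "triple_winding (h \<otimes> k) a b c = triple_winding h a b c + triple_winding k a b c
      + braid_bracket (winding h) (winding k) a b c"
  using assms winding_mult[of h k] by (simp_all add: pure_iff)

lemma winding_inv: "h \<in> pure \<Longrightarrow> winding (inv h) i j = - winding h i j"
  and winding_one: "winding \<one> i j = 0"
  using additive_int_pow(1,2)[OF pure.subgroup_axioms, of "\<lambda>h. winding h i j"] pure_winding_mult(1)
  by auto

text \<open>The two products \<open>h \<otimes> k\<close> and \<open>k \<otimes> h\<close> differ by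
  the commutator on the left. Their windings agree, and their triple windings differ by twice the
  bracket because the bracket is antisymmetric.\<close>

lemma winding_commutator:
  assumes h: "h \<in> pure" and k: "k \<in> pure"
  shows "winding (h \<otimes> k \<otimes> inv h \<otimes> inv k) i j = 0"
    and "triple_winding (h \<otimes> k \<otimes> inv h \<otimes> inv k) a b c = 2 * braid_bracket (winding h) (winding k) a b c"
proof -
  let ?c = "h \<otimes> k \<otimes> inv h \<otimes> inv k"
  have hk: "h \<otimes> k \<in> pure" "k \<otimes> h \<in> pure" "?c \<in> pure" using h k by auto
  have "?c \<otimes> (k \<otimes> h) = h \<otimes> k" using h k by (simp add: m_assoc cancel_inv)
  note eq = pure_winding_mult[OF hk(3,2), unfolded this]
  show w: "winding ?c i j = 0" for i j
    using eq(1)[of i j] pure_winding_mult(1)[OF h k] pure_winding_mult(1)[OF k h] by simp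
  show "triple_winding ?c a b c = 2 * braid_bracket (winding h) (winding k) a b c"
    using eq(2)[of a b c] pure_winding_mult(2)[OF h k] pure_winding_mult(2)[OF k h]
    by (simp add: braid_bracket_def w algebra_simps)
qed

end

section \<open>The abelianised pure braid group\<close>

text \<open>Otherwise the simplifier rewrites the index of \<open>s 1\<close> to \<open>Suc 0\<close>.\<close>

declare One_nat_def [simp del]

context artin_braids
begin

lemma assoc_left:
  assumes "x \<otimes> y = z \<otimes> w" "x \<in> carrier B" "y \<in> carrier B" "z \<in> carrier B" "w \<in> carrier B" "v \<in> carrier B"
  shows "x \<otimes> (y \<otimes> v) = z \<otimes> (w \<otimes> v)"
  using assms by (simp flip: m_assoc)

text \<open>The full twist of the strings \<open>\<rho> b 1\<close> and \<open>\<rho> b 2\<close>.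
  Indexing by a braid rather than by a pair makes conjugation a left multiplication of the index;
  that modulo \<open>pure_central 2\<close> only the pair matters is
  \<open>twist_cong\<close>.\<close>

definition twist :: "'a \<Rightarrow> 'a" where "twist b = b \<otimes> (s 1 \<otimes> s 1) \<otimes> inv b"

lemma gen12: "s 1 \<in> carrier B" "s 2 \<in> carrier B"
  "\<rho> (s 1) = Transposition.transpose 1 2" "\<rho> (s 2) = Transposition.transpose 2 3"
  "s 1 \<otimes> s 2 \<otimes> s 1 = s 2 \<otimes> s 1 \<otimes> s 2"
  using three_le gen_closed[of 1] gen_closed[of 2] perm_gen[of 1] perm_gen[of 2] gen_braid[of 1]
  by auto

lemma twist_closed: "b \<in> carrier B \<Longrightarrow> twist b \<in> carrier B"
  by (simp add: twist_def gen12)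

lemma twist_mult: "b \<in> carrier B \<Longrightarrow> c \<in> carrier B \<Longrightarrow> twist (b \<otimes> c) = b \<otimes> twist c \<otimes> inv b"
  by (simp add: twist_def gen12 inv_mult_group m_assoc)

lemma twist_one: "twist \<one> = s 1 \<otimes> s 1"
  by (simp add: twist_def gen12)

lemma twist_eq_square:
  assumes "v \<in> carrier B" "t \<in> carrier B" "v \<otimes> s 1 = t \<otimes> v"
  shows "twist v = t \<otimes> t"
proof -
  have "v \<otimes> (s 1 \<otimes> s 1) = t \<otimes> (v \<otimes> s 1)"
    using assms(1,2) gen12(1) by (intro assoc_left[OF assms(3)])
  also have "\<dots> = t \<otimes> t \<otimes> v" using assms(1,2) by (simp add: assms(3) m_assoc)
  finally show ?thesis unfolding twist_def using assms by (simp add: m_assoc)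
qed

lemma twist_gen1: "b \<in> carrier B \<Longrightarrow> twist (b \<otimes> s 1) = twist b"
proof -
  have "twist (s 1) = s 1 \<otimes> s 1" using gen12 by (intro twist_eq_square) auto
  then show "b \<in> carrier B \<Longrightarrow> twist (b \<otimes> s 1) = twist b"
    using gen12 by (simp add: twist_mult) (simp add: twist_def)
qed

lemma twist_pure: "b \<in> carrier B \<Longrightarrow> twist b \<in> pure"
proof -
  assume b: "b \<in> carrier B"
  have "s 1 \<otimes> s 1 \<in> pure" using gen12 by (simp add: pure_iff sym_group_mult)
  from pure.inv_op_closed2[OF b this] show ?thesis by (simp add: twist_def)
qed

text \<open>By the braid relation, \<open>s i \<otimes> s (i + 1)\<close> conjugates
  \<open>s i\<close> to \<open>s (i + 1)\<close>, so all generators are conjugate to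
  \<open>s 1\<close>.\<close>

lemma gen_conjugate: "i \<in> {1..<n} \<Longrightarrow> \<exists>v\<in>carrier B. v \<otimes> s 1 = s i \<otimes> v"
proof (induction i)
  case (Suc i)
  show ?case
  proof (cases "i = 0")
    case True
    then show ?thesis using gen12 by (auto simp: One_nat_def intro!: bexI[of _ \<one>])
  next
    case False
    then obtain v where v: "v \<in> carrier B" "v \<otimes> s 1 = s i \<otimes> v" using Suc by auto
    have si: "s i \<in> carrier B" "s (Suc i) \<in> carrier B" using Suc False gen_closed by auto
    have br: "s i \<otimes> s (Suc i) \<otimes> s i = s (Suc i) \<otimes> s i \<otimes> s (Suc i)"
      using gen_braid[of i] False Suc.prems by (simp add: One_nat_def)
    have "(s i \<otimes> s (Suc i) \<otimes> v) \<otimes> s 1 = s i \<otimes> s (Suc i) \<otimes> s i \<otimes> v"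
      using v si gen12 by (simp add: m_assoc)
    also have "\<dots> = s (Suc i) \<otimes> (s i \<otimes> s (Suc i) \<otimes> v)"
      unfolding br using v si by (simp add: m_assoc)
    finally show ?thesis using v si by (intro bexI[of _ "s i \<otimes> s (Suc i) \<otimes> v"]) auto
  qed
qed simp

text \<open>The twists are permuted by conjugation, so they generate a normal subgroup. It contains
  the squares of all generators, hence all pure braids by \<open>pure_subset_normal\<close>.\<close>

lemma pure_eq_generate_twist: "pure = generate B (twist ` carrier B)"
proof
  have "generate B (twist ` carrier B) \<lhd> B"
  proof (rule normal_generateI)
    show "twist ` carrier B \<subseteq> carrier B" using twist_closed by auto
    fix h g assume h: "h \<in> twist ` carrier B" and g: "g \<in> carrier B"
    then obtain b where b: "b \<in> carrier B" "h = twist b" by auto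
    then have "g \<otimes> h \<otimes> inv g = twist (g \<otimes> b)" using g by (simp add: twist_mult)
    then show "g \<otimes> h \<otimes> inv g \<in> twist ` carrier B" using g b by simp
  qed
  then show "pure \<subseteq> generate B (twist ` carrier B)"
  proof (rule pure_subset_normal)
    fix i assume i: "i \<in> {1..<n}"
    obtain v where v: "v \<in> carrier B" "v \<otimes> s 1 = s i \<otimes> v" using gen_conjugate[OF i] by blast
    have "s i \<otimes> s i = twist v" using twist_eq_square[OF v(1) gen_closed[OF i] v(2)] by simp
    then show "s i \<otimes> s i \<in> generate B (twist ` carrier B)" using v by (auto intro: generate.incl)
  qed
  show "generate B (twist ` carrier B) \<subseteq> pure"
    using twist_pure by (intro generate_subgroup_incl[OF _ pure.subgroup_axioms]) auto
qed

lemma winding_twist: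
  assumes b: "b \<in> carrier B"
  shows "winding (twist b) i j = (if i = \<rho> b 1 \<and> j = \<rho> b 2 \<or> i = \<rho> b 2 \<and> j = \<rho> b 1 then 2 else 0)"
proof -
  have g1: "1 \<in> {1..<n}" using three_le by auto
  have "s 1 \<otimes> s 1 \<in> pure" using gen12 by (simp add: pure_iff sym_group_mult)
  note conj = winding_conj(1)[OF b this, folded twist_def, of "\<rho> (inv b) i" "\<rho> (inv b) j", unfolded perm_inv'[OF b]]
  have "winding (s 1 \<otimes> s 1) k l = 2 * crossing 1 k l" for k l
    using winding_mult(1)[OF gen12(1) gen12(1), of k l] winding_gen[OF g1]
    by (simp add: gen12 crossing_def Transposition.transpose_def split: if_splits)
  moreover have "\<rho> (inv b) k = l \<longleftrightarrow> k = \<rho> b l" for k l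
    using perm_inv[OF b] perm_inv'[OF b] by metis
  ultimately show ?thesis unfolding conj by (simp add: crossing_def)
qed

lemma perm_commute_high:
  assumes "c \<in> generate B (s ` {3..<n})"
  shows "c \<in> carrier B" "c \<otimes> s 1 = s 1 \<otimes> c"
proof -
  have sub: "s ` {3..<n} \<subseteq> carrier B" by (auto intro: gen_closed)
  then show c: "c \<in> carrier B" using generate_in_carrier assms by blast
  have com: "s i \<otimes> s 1 = s 1 \<otimes> s i" if "i \<in> {3..<n}" for i
    using gen_commute[of 1 i] that by auto
  show "c \<otimes> s 1 = s 1 \<otimes> c"
    using assms
  proof (induction rule: generate.induct)
    case one
    then show ?case using gen12 by simp
  next
    case (incl h)
    then show ?case using com by auto
  next
    case (inv h)
    then have "h \<in> carrier B" "h \<otimes> s 1 = s 1 \<otimes> h" using com sub by auto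
    then have "inv h \<otimes> (h \<otimes> s 1) \<otimes> inv h = inv h \<otimes> (s 1 \<otimes> h) \<otimes> inv h" by simp
    then show ?case using \<open>h \<in> carrier B\<close> gen12(1) by (simp add: m_assoc cancel_inv)
  next
    case (eng h1 h2)
    then have "h1 \<in> carrier B" "h2 \<in> carrier B" using generate_in_carrier[OF sub] by auto
    then show ?case
      using eng gen12(1) assoc_left[of h1 "s 1" "s 1" h1 h2] by (simp add: m_assoc)
  qed
qed

section \<open>Twists modulo the second term of the series\<close>

lemma pure_central_two: "pure_central 2 = pure_central (Suc (Suc 0))"
  and pure_central_three: "pure_central 3 = pure_central (Suc (Suc (Suc 0)))"
  by (simp_all add: numeral_2_eq_2 numeral_3_eq_3)

lemma pure_central_mono: "pure_central 2 \<subseteq> pure" "pure_central 3 \<subseteq> pure_central 2"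
proof -
  show "pure_central 2 \<subseteq> pure"
    using pure_central_subset[of 0] by (simp add: pure_central_two)
  show "pure_central 3 \<subseteq> pure_central 2"
    unfolding pure_central_two pure_central_three by (rule pure_central_subset)
qed

lemma commutator_pure_central2:
  "h \<in> pure \<Longrightarrow> k \<in> pure \<Longrightarrow> h \<otimes> k \<otimes> inv h \<otimes> inv k \<in> pure_central 2"
  using commutator_in_pure_central[of h 0 k] by (simp add: pure_central_two)

lemma commutator_pure_central3:
  "h \<in> pure_central 2 \<Longrightarrow> k \<in> pure \<Longrightarrow> h \<otimes> k \<otimes> inv h \<otimes> inv k \<in> pure_central 3"
  using commutator_in_pure_central[of h "Suc 0" k] by (simp only: pure_central_two pure_central_three)

text \<open>Such a braid is \<open>c \<otimes> m\<close> with \<open>m\<close> pure and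
  \<open>c\<close> a word in the generators from \<open>s 3\<close> on. Conjugation by
  \<open>m\<close> changes the twist by a commutator of pure braids, and \<open>c\<close> commutes
  with \<open>s 1\<close>.\<close>

lemma twist_fixing_12:
  assumes b: "b \<in> carrier B" and fixed: "\<rho> b 1 = 1" "\<rho> b 2 = 2"
  shows "twist b \<otimes> inv (twist \<one>) \<in> pure_central 2"
proof -
  interpret L: normal "pure_central 2" B by (rule pure_central_normal)
  have "\<rho> b permutes {3..n}"
  proof (rule permutes_superset[OF perm_permutes[OF b]])
    fix x assume "x \<in> {1..n} - {3..n}"
    then have "x = 1 \<or> x = 2" by auto
    then show "\<rho> b x = x" using fixed by auto
  qed
  then obtain c where c: "c \<in> generate B (s ` {3..<n})" "\<rho> c = \<rho> b"
    using ex_braid_with_perm[of 3] by auto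
  note cc = perm_commute_high[OF c(1)]
  define m where "m = inv c \<otimes> b"
  have m: "m \<in> pure"
    using b cc(1) c(2) perm_inv[OF cc(1)] by (simp add: m_def pure_iff sym_group_mult fun_eq_iff)
  have mc: "m \<in> carrier B" using m pure_iff by auto
  have bm: "b = c \<otimes> m" using b cc by (simp add: m_def cancel_inv)
  let ?k = "m \<otimes> twist \<one> \<otimes> inv m \<otimes> inv (twist \<one>)"
  have k: "?k \<in> pure_central 2" using commutator_pure_central2[OF m twist_pure] by simp
  have t1: "twist \<one> \<in> carrier B" using twist_closed by simp
  have ct: "c \<otimes> twist \<one> = twist \<one> \<otimes> c"
  proof -
    have "c \<otimes> (s 1 \<otimes> s 1) = s 1 \<otimes> (c \<otimes> s 1)"
      using cc(1) gen12(1) by (intro assoc_left[OF cc(2)])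
    then show ?thesis unfolding twist_one cc(2) using cc(1) gen12(1) by (simp add: m_assoc)
  qed
  have "c \<otimes> ?k \<otimes> inv c = twist b \<otimes> (c \<otimes> inv (twist \<one>) \<otimes> inv c)"
    unfolding bm using twist_mult[OF cc(1) mc] twist_mult[OF mc one_closed] mc cc(1) t1
    by (simp add: m_assoc cancel_inv)
  also have "c \<otimes> inv (twist \<one>) \<otimes> inv c = inv (c \<otimes> twist \<one> \<otimes> inv c)"
    using cc(1) t1 by (simp add: inv_mult_group m_assoc)
  also have "c \<otimes> twist \<one> \<otimes> inv c = twist \<one>"
    unfolding ct using cc(1) t1 by (simp add: m_assoc)
  finally show ?thesis using L.inv_op_closed2[OF cc(1) k] by simp
qed

text \<open>Translation by \<open>inv c\<close> reduces to a braid fixing 1 and 2. The other order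
  of the pair is reached by replacing \<open>c\<close> with \<open>c \<otimes> s 1\<close>, which
  has the same twist.\<close>

lemma twist_cong:
  assumes b: "b \<in> carrier B" and c: "c \<in> carrier B"
    and eq: "\<rho> b 1 = \<rho> c 1 \<and> \<rho> b 2 = \<rho> c 2 \<or> \<rho> b 1 = \<rho> c 2 \<and> \<rho> b 2 = \<rho> c 1"
  shows "twist b \<otimes> inv (twist c) \<in> pure_central 2"
proof -
  interpret L: normal "pure_central 2" B by (rule pure_central_normal)
  have *: "twist b \<otimes> inv (twist c) \<in> pure_central 2"
    if b: "b \<in> carrier B" and c: "c \<in> carrier B" and eq: "\<rho> b 1 = \<rho> c 1" "\<rho> b 2 = \<rho> c 2" for b c
  proof -
    have "twist (inv c \<otimes> b) \<otimes> inv (twist \<one>) \<in> pure_central 2"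
      using b c eq perm_inv[OF c] by (intro twist_fixing_12) (auto simp: sym_group_mult)
    from L.inv_op_closed2[OF c this]
    have "c \<otimes> (inv c \<otimes> twist b \<otimes> c \<otimes> inv (twist \<one>)) \<otimes> inv c \<in> pure_central 2"
      using b c twist_mult[of "inv c" b] by simp
    moreover have "inv (twist c) = c \<otimes> inv (twist \<one>) \<otimes> inv c"
      using c twist_mult[OF c one_closed] twist_closed[of \<one>] by (simp add: inv_mult_group m_assoc)
    ultimately show ?thesis
      using b c twist_closed[OF b] twist_closed[of \<one>] by (simp add: m_assoc cancel_inv)
  qed
  show ?thesis
  proof (cases "\<rho> b 1 = \<rho> c 1 \<and> \<rho> b 2 = \<rho> c 2")
    case True
    then show ?thesis using * b c by simp
  next
    case False
    then have "twist b \<otimes> inv (twist (c \<otimes> s 1)) \<in> pure_central 2"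
      using eq b c gen12 by (intro *) (auto simp: sym_group_mult)
    then show ?thesis using twist_gen1[OF c] by simp
  qed
qed

text \<open>Multiple transitivity, lifted to braids: a transposition of points above
  \<open>m\<close>, applied first, corrects the image of \<open>Suc m\<close> and leaves the values
  already prescribed.\<close>

lemma ex_braid_extending:
  "m \<le> n \<Longrightarrow> inj_on f {1..m} \<Longrightarrow> f ` {1..m} \<subseteq> {1..n} \<Longrightarrow> \<exists>b\<in>carrier B. \<forall>i\<in>{1..m}. \<rho> b i = f i"
proof (induction m)
  case 0
  then show ?case by auto
next
  case (Suc m)
  have "inj_on f {1..m}" by (rule inj_on_subset[OF Suc.prems(2)]) auto
  moreover have "f ` {1..m} \<subseteq> {1..n}" using Suc.prems(3) by auto
  ultimately obtain b where b: "b \<in> carrier B" "\<forall>i\<in>{1..m}. \<rho> b i = f i"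
    using Suc.IH Suc.prems(1) by auto
  \<comment> \<open>The point that \<open>b\<close> sends to the prescribed value. Injectivity of
    \<open>f\<close> keeps it out of \<open>{1..m}\<close>.\<close>
  define x where "x = \<rho> (inv b) (f (Suc m))"
  have bx: "\<rho> b x = f (Suc m)" unfolding x_def using perm_inv'[OF b(1)] .
  have "Suc m \<in> {1..Suc m}" by (simp add: One_nat_def)
  then have "f (Suc m) \<in> {1..n}" using Suc.prems(3) by blast
  then have "x \<in> {1..n}" unfolding x_def using permutes_in_image[OF perm_permutes] b by blast
  moreover have "x \<notin> {1..m}"
  proof
    assume x: "x \<in> {1..m}"
    then have "f x = f (Suc m)" using b bx by auto
    then have "x = Suc m" using inj_onD[OF Suc.prems(2), of x "Suc m"] x by (simp add: One_nat_def)
    then show False using x by auto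
  qed
  ultimately have x: "x \<in> {Suc m..n}" by (simp add: not_le less_eq_Suc_le)
  then have "Transposition.transpose (Suc m) x permutes {Suc m..n}"
    by (intro permutes_swap_id) auto
  then obtain t where t: "t \<in> generate B (s ` {Suc m..<n})" "\<rho> t = Transposition.transpose (Suc m) x"
    using ex_braid_with_perm[of "Suc m"] by (auto simp: One_nat_def)
  have tc: "t \<in> carrier B" using t(1) by (intro generate_in_carrier[OF _ t(1)]) (auto simp: One_nat_def intro!: gen_closed)
  have "\<rho> (b \<otimes> t) i = f i" if "i \<in> {1..Suc m}" for i
  proof (cases "i = Suc m")
    case True
    then show ?thesis using b(1) bx tc t(2) by (simp add: sym_group_mult)
  next
    case False
    then have "i \<in> {1..m}" "\<rho> t i = i" using that x t(2) by (auto simp: Transposition.transpose_def)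
    then show ?thesis using b tc by (simp add: sym_group_mult)
  qed
  then show ?case using b tc by (intro bexI[of _ "b \<otimes> t"]) auto
qed

lemma ex_braid_four:
  assumes "distinct [i, j, k, l]" "{i, j, k, l} \<subseteq> {1..n}"
  shows "\<exists>b\<in>carrier B. \<rho> b 1 = i \<and> \<rho> b 2 = j \<and> \<rho> b 3 = k \<and> \<rho> b 4 = l"
proof -
  have "card {i, j, k, l} \<le> card {1..n}" using assms(2) by (intro card_mono) auto
  then have n: "4 \<le> n" using assms(1) by simp
  have 4: "{1..4::nat} = {1, 2, 3, 4}" by auto
  let ?f = "(\<lambda>x :: nat. i)(2 := j, 3 := k, 4 := l)"
  have inj: "inj_on ?f {1..4}" unfolding 4 using assms(1) by simp
  have img: "?f ` {1..4} \<subseteq> {1..n}" unfolding 4 using assms(2) by simp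
  have "\<exists>b\<in>carrier B. \<forall>x\<in>{1..4}. \<rho> b x = ?f x"
    by (rule ex_braid_extending[OF n inj img])
  then show ?thesis unfolding 4 by auto
qed

lemma ex_braid_three:
  assumes "distinct [i, j, k]" "{i, j, k} \<subseteq> {1..n}"
  shows "\<exists>b\<in>carrier B. \<rho> b 1 = i \<and> \<rho> b 2 = j \<and> \<rho> b 3 = k"
proof -
  have 3: "{1..3::nat} = {1, 2, 3}" by auto
  let ?f = "(\<lambda>x :: nat. i)(2 := j, 3 := k)"
  have inj: "inj_on ?f {1..3}" unfolding 3 using assms(1) by simp
  have img: "?f ` {1..3} \<subseteq> {1..n}" unfolding 3 using assms(2) by simp
  have "\<exists>b\<in>carrier B. \<forall>x\<in>{1..3}. \<rho> b x = ?f x"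
    using three_le by (intro ex_braid_extending[OF _ inj img]) simp
  then show ?thesis unfolding 3 by auto
qed

lemma ex_braid_two:
  assumes "i \<noteq> j" "{i, j} \<subseteq> {1..n}"
  shows "\<exists>b\<in>carrier B. \<rho> b 1 = i \<and> \<rho> b 2 = j"
proof -
  have 2: "{1..2::nat} = {1, 2}" by auto
  let ?f = "(\<lambda>x :: nat. i)(2 := j)"
  have inj: "inj_on ?f {1..2}" unfolding 2 using assms(1) by simp
  have img: "?f ` {1..2} \<subseteq> {1..n}" unfolding 2 using assms(2) by simp
  have "\<exists>b\<in>carrier B. \<forall>x\<in>{1..2}. \<rho> b x = ?f x"
    using three_le by (intro ex_braid_extending[OF _ inj img]) simp
  then show ?thesis unfolding 2 by auto
qed

text \<open>A choice of twist for each ordered pair. By \<open>twist_cong\<close>, neither the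
  choice nor the order of the pair affects the twist modulo \<open>pure_central 2\<close>.\<close>

definition pair_braid :: "nat \<Rightarrow> nat \<Rightarrow> 'a"
  where "pair_braid i j = (SOME b. b \<in> carrier B \<and> \<rho> b 1 = i \<and> \<rho> b 2 = j)"

lemma pair_braid:
  assumes "i \<noteq> j" "i \<in> {1..n}" "j \<in> {1..n}"
  shows "pair_braid i j \<in> carrier B" "\<rho> (pair_braid i j) 1 = i" "\<rho> (pair_braid i j) 2 = j"
proof -
  have "\<exists>b. b \<in> carrier B \<and> \<rho> b 1 = i \<and> \<rho> b 2 = j" using ex_braid_two[of i j] assms by auto
  from someI_ex[OF this]
  show "pair_braid i j \<in> carrier B" "\<rho> (pair_braid i j) 1 = i" "\<rho> (pair_braid i j) 2 = j"
    unfolding pair_braid_def by auto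
qed

lemma perm_in: "b \<in> carrier B \<Longrightarrow> i \<in> {1..n} \<Longrightarrow> \<rho> b i \<in> {1..n}"
  using permutes_in_image[OF perm_permutes] by blast

section \<open>Windings as coordinates on the abelianised pure braid group\<close>

lemma winding_pure_central2: "m \<in> pure_central 2 \<Longrightarrow> winding m i j = 0"
proof -
  have "pure_central 2 \<subseteq> {m \<in> pure. winding m i j = 0}"
    unfolding pure_central_two pure_central_Suc
  proof (rule generate_subgroup_incl)
    show "subgroup {m \<in> pure. winding m i j = 0} B"
      by (rule subgroupI)
        (use pure.subset pure.one_closed in \<open>auto simp: winding_one winding_inv pure_winding_mult intro!: exI[of _ \<one>]\<close>)
  qed (use winding_commutator in auto)
  then show "m \<in> pure_central 2 \<Longrightarrow> winding m i j = 0" by auto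
qed

text \<open>Both properties hold for twists and pass to products and inverses because windings are
  additive on pure braids. Evenness matches the diagonal value 2 in
  \<open>winding_basis\<close>.\<close>

lemma winding_symmetric_even:
  assumes "m \<in> pure"
  shows "winding m j i = winding m i j \<and> even (winding m i j)"
proof -
  have "pure \<subseteq> {m \<in> pure. winding m j i = winding m i j \<and> even (winding m i j)}"
  proof -
    have "generate B (twist ` carrier B) \<subseteq> {m \<in> pure. winding m j i = winding m i j \<and> even (winding m i j)}"
    proof (rule generate_subgroup_incl)
      show "subgroup {m \<in> pure. winding m j i = winding m i j \<and> even (winding m i j)} B"
        by (rule subgroupI)
          (use pure.subset pure.one_closed in \<open>auto simp: winding_one winding_inv pure_winding_mult intro!: exI[of _ \<one>]\<close>)
    qed (auto simp: winding_twist twist_pure)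
    then show "pure \<subseteq> {m \<in> pure. winding m j i = winding m i j \<and> even (winding m i j)}"
      using pure_eq_generate_twist by blast
  qed
  then show ?thesis using assms by auto
qed

definition increasing_pairs :: "(nat \<times> nat) set"
  where "increasing_pairs = {(i, j). 1 \<le> i \<and> i < j \<and> j \<le> n}"

text \<open>By \<open>twist_cong\<close> one twist for each increasing pair suffices to generate
  modulo \<open>pure_central 2\<close>, and the windings of these twists form twice the identity
  matrix.\<close>

lemma winding_basis:
  shows "m \<in> pure \<Longrightarrow> (\<And>i j. (i, j) \<in> increasing_pairs \<Longrightarrow> winding m i j = 0) \<Longrightarrow> m \<in> pure_central 2"
    and "\<exists>m\<in>pure. \<forall>(i, j)\<in>increasing_pairs. winding m i j = 2 * v (i, j)"
proof -
  interpret L: normal "pure_central 2" B by (rule pure_central_normal)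
  let ?A = "\<lambda>(i, j). twist (pair_braid i j)"
  let ?S = "?A ` increasing_pairs \<union> pure_central 2"
  let ?lam = "\<lambda>(i, j) m. winding m i j"
  have pb: "pair_braid i j \<in> carrier B" "\<rho> (pair_braid i j) 1 = i" "\<rho> (pair_braid i j) 2 = j"
    if "(i, j) \<in> increasing_pairs" for i j
    using that pair_braid[of i j] by (auto simp: increasing_pairs_def)
  have "increasing_pairs \<subseteq> {1..n} \<times> {1..n}" by (auto simp: increasing_pairs_def)
  then have fin: "finite increasing_pairs" by (rule finite_subset) simp
  have AN: "?A x \<in> pure" if "x \<in> increasing_pairs" for x using that pb(1) by (cases x) (auto simp: twist_pure)
  have sub: "?S \<subseteq> carrier B" using AN pure.subset L.subset by auto
  have "twist b \<in> generate B ?S" if b: "b \<in> carrier B" for b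
  proof -
    let ?i = "min (\<rho> b 1) (\<rho> b 2)" and ?j = "max (\<rho> b 1) (\<rho> b 2)"
    have "\<rho> b 1 \<noteq> \<rho> b 2" "\<rho> b 1 \<in> {1..n}" "\<rho> b 2 \<in> {1..n}"
      using perm_eq_iff[OF b, of 1 2] perm_in[OF b] three_le by auto
    then have ij: "(?i, ?j) \<in> increasing_pairs" by (auto simp: increasing_pairs_def)
    note p = pb[OF ij]
    have "twist b \<otimes> inv (twist (pair_braid ?i ?j)) \<in> pure_central 2"
      using p by (intro twist_cong b) (auto simp: min_def max_def)
    then have "twist b \<otimes> inv (twist (pair_braid ?i ?j)) \<in> generate B ?S" by (auto intro: generate.incl)
    moreover have "twist (pair_braid ?i ?j) \<in> generate B ?S"
      using ij by (intro generate.incl) (auto intro!: image_eqI[of _ _ "(?i, ?j)"])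
    ultimately have "twist b \<otimes> inv (twist (pair_braid ?i ?j)) \<otimes> twist (pair_braid ?i ?j) \<in> generate B ?S"
      by (rule generate.eng)
    then show ?thesis using twist_closed[OF b] twist_closed[OF p(1)] by (simp add: m_assoc)
  qed
  then have "generate B (twist ` carrier B) \<subseteq> generate B ?S"
    by (intro generate_subgroup_incl generate_is_subgroup sub) auto
  then have gen: "pure \<subseteq> generate B ?S"
    by (rule ord_eq_le_trans[OF pure_eq_generate_twist])
  have lam_A: "?lam x (?A y) = (if x = y then 2 else 0)"
    if "x \<in> increasing_pairs" "y \<in> increasing_pairs" for x y
    using that pb winding_twist by (auto simp: increasing_pairs_def)
  note * = coordinates_free_basis[OF pure.subgroup_axioms L.subgroup_axioms pure_central_mono(1)
      commutator_pure_central2 fin AN gen, of ?lam 2]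
  show "m \<in> pure_central 2" if "m \<in> pure" "\<And>i j. (i, j) \<in> increasing_pairs \<Longrightarrow> winding m i j = 0"
    by (rule *(1)) (use that lam_A in \<open>auto simp: pure_winding_mult winding_pure_central2\<close>)
  have "\<exists>m\<in>pure. \<forall>x\<in>increasing_pairs. ?lam x m = 2 * v x"
    by (rule *(2)) (use lam_A in \<open>auto simp: pure_winding_mult winding_pure_central2\<close>)
  then show "\<exists>m\<in>pure. \<forall>(i, j)\<in>increasing_pairs. winding m i j = 2 * v (i, j)"
    by (auto simp: case_prod_beta)
qed

end

section \<open>The second quotient of the lower central series\<close>

context artin_braids
begin

section \<open>Commutator calculus modulo the third term\<close>

definition comm :: "'a \<Rightarrow> 'a \<Rightarrow> 'a" where "comm x y = x \<otimes> y \<otimes> inv x \<otimes> inv y"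

lemma comm_closed: "x \<in> carrier B \<Longrightarrow> y \<in> carrier B \<Longrightarrow> comm x y \<in> carrier B"
  by (simp add: comm_def)

lemma comm_swap: "x \<in> carrier B \<Longrightarrow> y \<in> carrier B \<Longrightarrow> comm y x = inv (comm x y)"
  by (simp add: comm_def inv_mult_group m_assoc)

lemma comm_eq_one: "x \<in> carrier B \<Longrightarrow> y \<in> carrier B \<Longrightarrow> x \<otimes> y = y \<otimes> x \<Longrightarrow> comm x y = \<one>"
  by (simp add: comm_def m_assoc cancel_inv)

text \<open>The usual conjugate of \<open>comm h' k\<close> is written as an iterated commutator
  times \<open>comm h' k\<close>, so that for pure arguments the deviation from bilinearity visibly
  lies in \<open>pure_central 3\<close>.\<close>

lemma comm_mult_left:
  assumes "h \<in> carrier B" "h' \<in> carrier B" "k \<in> carrier B"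
  shows "comm (h \<otimes> h') k = comm h (comm h' k) \<otimes> comm h' k \<otimes> comm h k"
  using assms by (simp add: comm_def inv_mult_group m_assoc cancel_inv)

lemma comm_inv_left:
  assumes "h \<in> carrier B" "k \<in> carrier B"
  shows "comm (inv h) k = comm (inv h) (inv (comm h k)) \<otimes> inv (comm h k)"
  using assms by (simp add: comm_def inv_mult_group m_assoc cancel_inv)

lemma conj_comm:
  assumes "b \<in> carrier B" "h \<in> carrier B" "k \<in> carrier B"
  shows "b \<otimes> comm h k \<otimes> inv b = comm (b \<otimes> h \<otimes> inv b) (b \<otimes> k \<otimes> inv b)"
  using assms by (simp add: comm_def inv_mult_group m_assoc cancel_inv)

text \<open>With equality of cosets, the equivalence laws are immediate and compatibility with
  products and inverses comes from normality.\<close>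

definition cong3 :: "'a \<Rightarrow> 'a \<Rightarrow> bool" (infix "\<equiv>\<^sub>3" 50)
  where "x \<equiv>\<^sub>3 y \<longleftrightarrow> pure_central 3 #> x = pure_central 3 #> y"

sublocale L2: normal "pure_central 2" B by (rule pure_central_normal)
sublocale L3: normal "pure_central 3" B by (rule pure_central_normal)

lemma cong3_iff:
  assumes "x \<in> carrier B" "y \<in> carrier B"
  shows "x \<equiv>\<^sub>3 y \<longleftrightarrow> x \<otimes> inv y \<in> pure_central 3"
  unfolding cong3_def
  using assms L3.rcos_module[OF is_group, of y x] repr_independence[of x "pure_central 3" y]
    rcos_self[of x "pure_central 3"] L3.subgroup_axioms by metis

lemma cong3_mult: "x \<equiv>\<^sub>3 x' \<Longrightarrow> y \<equiv>\<^sub>3 y' \<Longrightarrow> {x, x', y, y'} \<subseteq> carrier B \<Longrightarrow> x \<otimes> y \<equiv>\<^sub>3 x' \<otimes> y'"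
  unfolding cong3_def by (metis L3.rcos_sum insert_subset)

lemma cong3_inv: "x \<equiv>\<^sub>3 y \<Longrightarrow> x \<in> carrier B \<Longrightarrow> y \<in> carrier B \<Longrightarrow> inv x \<equiv>\<^sub>3 inv y"
  unfolding cong3_def by (metis L3.rcos_inv)

lemma cong3_one: "x \<in> pure_central 3 \<Longrightarrow> x \<equiv>\<^sub>3 \<one>"
  unfolding cong3_def using coset_join2[OF _ L3.subgroup_axioms] L3.subset by auto

lemma cong3_trans [trans]: "x \<equiv>\<^sub>3 y \<Longrightarrow> y \<equiv>\<^sub>3 z \<Longrightarrow> x \<equiv>\<^sub>3 z"
  and cong3_sym: "x \<equiv>\<^sub>3 y \<Longrightarrow> y \<equiv>\<^sub>3 x"
  and cong3_refl: "x \<equiv>\<^sub>3 x"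
  by (simp_all add: cong3_def)

lemma cong3_absorb:
  assumes "u \<in> pure_central 3" "v \<in> pure_central 3" "x \<in> carrier B"
  shows "u \<otimes> x \<otimes> v \<equiv>\<^sub>3 x"
proof -
  have "u \<otimes> x \<otimes> v \<equiv>\<^sub>3 \<one> \<otimes> x \<otimes> \<one>"
    using assms L3.subset by (intro cong3_mult cong3_one cong3_refl) auto
  then show ?thesis using assms by simp
qed

lemma comm_pure2: "h \<in> pure \<Longrightarrow> k \<in> pure \<Longrightarrow> comm h k \<in> pure_central 2"
  unfolding comm_def by (rule commutator_pure_central2)

lemma comm_pure3:
  assumes "h \<in> pure_central 2" "k \<in> pure"
  shows "comm h k \<in> pure_central 3" "comm k h \<in> pure_central 3"
proof -
  show *: "comm h k \<in> pure_central 3"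
    unfolding comm_def using assms by (rule commutator_pure_central3)
  have "comm k h = inv (comm h k)" using assms L2.subset pure.subset by (intro comm_swap) auto
  then show "comm k h \<in> pure_central 3" using * by simp
qed

text \<open>Write \<open>h\<close> as \<open>?g \<otimes> h'\<close>. The two terms of the expansion
  that involve \<open>?g\<close> are commutators of an element of \<open>pure_central 2\<close> with
  a pure braid.\<close>

lemma comm_cong_left:
  assumes "h \<in> pure" "h' \<in> pure" "k \<in> pure" "h \<otimes> inv h' \<in> pure_central 2"
  shows "comm h k \<equiv>\<^sub>3 comm h' k"
proof -
  let ?g = "h \<otimes> inv h'"
  have c: "h \<in> carrier B" "h' \<in> carrier B" "k \<in> carrier B" using assms by auto
  have "comm h k = comm (?g \<otimes> h') k" using c by (simp add: m_assoc)
  also have "\<dots> = comm ?g (comm h' k) \<otimes> comm h' k \<otimes> comm ?g k"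
    using c by (intro comm_mult_left) auto
  also have "\<dots> \<equiv>\<^sub>3 comm h' k"
    using comm_pure3(1)[OF assms(4) subsetD[OF pure_central_mono(1) comm_pure2[OF assms(2,3)]]]
      comm_pure3(1)[OF assms(4,3)] comm_closed[OF c(2,3)] by (rule cong3_absorb)
  finally show ?thesis .
qed

lemma comm_cong:
  assumes "h \<in> pure" "h' \<in> pure" "k \<in> pure" "k' \<in> pure"
    and "h \<otimes> inv h' \<in> pure_central 2" "k \<otimes> inv k' \<in> pure_central 2"
  shows "comm h k \<equiv>\<^sub>3 comm h' k'"
proof -
  have c: "h' \<in> carrier B" "k \<in> carrier B" "k' \<in> carrier B" using assms by auto
  have "comm k h' \<equiv>\<^sub>3 comm k' h'" using assms by (intro comm_cong_left)
  then have "inv (comm k h') \<equiv>\<^sub>3 inv (comm k' h')" using c by (intro cong3_inv comm_closed)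
  then have "comm h' k \<equiv>\<^sub>3 comm h' k'" using c by (simp flip: comm_swap)
  with comm_cong_left[OF assms(1,2,3,5)] show ?thesis by (rule cong3_trans)
qed

text \<open>Commutators of pure braids are bilinear modulo \<open>pure_central 3\<close>, so
  membership need only be tested on twists. It is extended in the first argument, then in the second
  after exchanging the two.\<close>

lemma comm_bilinear_mem:
  assumes V: "subgroup V B" "pure_central 3 \<subseteq> V" "V \<subseteq> pure_central 2"
    and gen: "\<And>b c. b \<in> carrier B \<Longrightarrow> c \<in> carrier B \<Longrightarrow> comm (twist b) (twist c) \<in> V"
  shows "pure_central 2 \<subseteq> V"
proof -
  interpret V: subgroup V B by fact
  have sub: "subgroup {h \<in> pure. comm h k \<in> V} B" if k: "k \<in> pure" for k
  proof (rule subgroupI)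
    show "{h \<in> pure. comm h k \<in> V} \<subseteq> carrier B" by auto
    have "comm \<one> k = \<one>" using k by (intro comm_eq_one) auto
    then have "\<one> \<in> {h \<in> pure. comm h k \<in> V}" using pure.one_closed V.one_closed by simp
    then show "{h \<in> pure. comm h k \<in> V} \<noteq> {}" by blast
  next
    fix h assume h: "h \<in> {h \<in> pure. comm h k \<in> V}"
    then have x: "inv (comm h k) \<in> V" by simp
    then have "comm (inv h) (inv (comm h k)) \<in> V"
      using h subsetD[OF V(3) x] by (intro subsetD[OF V(2)] comm_pure3(2)) auto
    then have "comm (inv h) (inv (comm h k)) \<otimes> inv (comm h k) \<in> V" using x by (rule V.m_closed)
    moreover have "comm (inv h) k = comm (inv h) (inv (comm h k)) \<otimes> inv (comm h k)"
      using h k by (intro comm_inv_left) auto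
    ultimately show "inv h \<in> {h \<in> pure. comm h k \<in> V}" using h by simp
  next
    fix h h' assume h: "h \<in> {h \<in> pure. comm h k \<in> V}" "h' \<in> {h \<in> pure. comm h k \<in> V}"
    then have "comm h (comm h' k) \<in> V"
      using subsetD[OF V(3), of "comm h' k"] by (intro subsetD[OF V(2)] comm_pure3(2)) auto
    then have "comm h (comm h' k) \<otimes> comm h' k \<otimes> comm h k \<in> V" using h by (intro V.m_closed) auto
    moreover have "comm (h \<otimes> h') k = comm h (comm h' k) \<otimes> comm h' k \<otimes> comm h k"
      using h k by (intro comm_mult_left) auto
    ultimately show "h \<otimes> h' \<in> {h \<in> pure. comm h k \<in> V}" using h by simp
  qed
  have extend: "comm h k \<in> V" if "k \<in> pure" "h \<in> pure" "\<And>b. b \<in> carrier B \<Longrightarrow> comm (twist b) k \<in> V" for h k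
  proof -
    have "generate B (twist ` carrier B) \<subseteq> {h \<in> pure. comm h k \<in> V}"
      using that twist_pure by (intro generate_subgroup_incl sub) auto
    then show ?thesis using that(2) pure_eq_generate_twist by blast
  qed
  have "comm h k \<in> V" if h: "h \<in> pure" and k: "k \<in> pure" for h k
  proof (rule extend[OF k h])
    fix b assume b: "b \<in> carrier B"
    have "comm k (twist b) \<in> V" using extend[OF twist_pure[OF b] k] gen b by blast
    then have "inv (comm k (twist b)) \<in> V" by simp
    then show "comm (twist b) k \<in> V"
      using comm_swap[of k "twist b"] k twist_closed[OF b] by simp
  qed
  then have "{h \<otimes> k \<otimes> inv h \<otimes> inv k | h k. h \<in> pure_central (Suc 0) \<and> k \<in> pure} \<subseteq> V"
    by (auto simp: comm_def)
  then show ?thesis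
    unfolding pure_central_two pure_central_Suc by (intro generate_subgroup_incl V)
qed

text \<open>The group version of the bracket of \<open>t i j\<close> with \<open>t j k\<close>, the
  shared string being in the middle. The next lemmas show that it alternates modulo
  \<open>pure_central 3\<close>.\<close>

definition triple_comm :: "nat \<Rightarrow> nat \<Rightarrow> nat \<Rightarrow> 'a"
  where "triple_comm i j k = comm (twist (pair_braid i j)) (twist (pair_braid j k))"

lemma comm_twist_shared:
  assumes b: "b \<in> carrier B" and c: "c \<in> carrier B"
    and ij: "\<rho> b 1 = i \<and> \<rho> b 2 = j \<or> \<rho> b 1 = j \<and> \<rho> b 2 = i"
    and jk: "\<rho> c 1 = j \<and> \<rho> c 2 = k \<or> \<rho> c 1 = k \<and> \<rho> c 2 = j"
  shows "comm (twist b) (twist c) \<equiv>\<^sub>3 triple_comm i j k"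
proof -
  have "\<rho> b 1 \<in> {1..n}" "\<rho> b 2 \<in> {1..n}" "\<rho> b 1 \<noteq> \<rho> b 2"
    using perm_in[OF b] perm_eq_iff[OF b] three_le by auto
  then have p: "i \<in> {1..n}" "j \<in> {1..n}" "i \<noteq> j" using ij by auto
  have "\<rho> c 1 \<in> {1..n}" "\<rho> c 2 \<in> {1..n}" "\<rho> c 1 \<noteq> \<rho> c 2"
    using perm_in[OF c] perm_eq_iff[OF c] three_le by auto
  then have q: "k \<in> {1..n}" "j \<noteq> k" using jk by auto
  note pb = pair_braid[OF p(3,1,2)] pair_braid[OF q(2) p(2) q(1)]
  show ?thesis
    unfolding triple_comm_def using b c pb ij jk
    by (intro comm_cong twist_pure twist_cong) auto
qed

lemma triple_comm_closed:
  assumes "distinct [i, j, k]" "{i, j, k} \<subseteq> {1..n}"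
  shows "triple_comm i j k \<in> pure_central 2" "triple_comm i j k \<in> carrier B"
proof -
  show "triple_comm i j k \<in> pure_central 2"
    unfolding triple_comm_def using assms by (intro comm_pure2 twist_pure pair_braid) auto
  then show "triple_comm i j k \<in> carrier B" using L2.subset by blast
qed

lemma triple_comm_reverse:
  assumes "distinct [i, j, k]" "{i, j, k} \<subseteq> {1..n}"
  shows "triple_comm k j i \<equiv>\<^sub>3 inv (triple_comm i j k)"
proof -
  have pb: "pair_braid i j \<in> carrier B" "pair_braid j k \<in> carrier B"
    "\<rho> (pair_braid i j) 1 = i" "\<rho> (pair_braid i j) 2 = j"
    "\<rho> (pair_braid j k) 1 = j" "\<rho> (pair_braid j k) 2 = k"
    using assms pair_braid by auto
  have "comm (twist (pair_braid j k)) (twist (pair_braid i j)) \<equiv>\<^sub>3 triple_comm k j i"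
    using pb by (intro comm_twist_shared) auto
  moreover have "comm (twist (pair_braid j k)) (twist (pair_braid i j)) = inv (triple_comm i j k)"
    unfolding triple_comm_def using pb twist_closed by (intro comm_swap) auto
  ultimately show ?thesis using cong3_sym by simp
qed

text \<open>The generator \<open>s 1\<close> commutes with the full turn of the third strand around the first two,
  which is the product of the twists of the pairs \<open>{1, 3}\<close> and \<open>{2, 3}\<close>.\<close>

lemma twist_comm_relation:
  "comm (twist \<one>) (twist (s 2) \<otimes> twist (s 1 \<otimes> s 2)) = \<one>"
proof -
  note cl = gen12(1,2)
  \<comment> \<open>The twist of the pair \<open>{2, 3}\<close> is the square of \<open>s 2\<close>,
    so the inverse of \<open>s 2\<close> in the twist of \<open>{1, 3}\<close> cancels in the
    product.\<close>
  have "(s 1 \<otimes> s 2) \<otimes> s 1 = s 2 \<otimes> (s 1 \<otimes> s 2)" using gen12 by (simp add: m_assoc)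
  then have "twist (s 1 \<otimes> s 2) = s 2 \<otimes> s 2" using cl by (intro twist_eq_square) auto
  then have Y: "twist (s 2) \<otimes> twist (s 1 \<otimes> s 2) = s 2 \<otimes> (s 1 \<otimes> (s 1 \<otimes> s 2))"
    unfolding twist_def[of "s 2"] using cl by (simp add: m_assoc cancel_inv)
  let ?Y = "s 2 \<otimes> (s 1 \<otimes> (s 1 \<otimes> s 2))"
  have br: "s 1 \<otimes> (s 2 \<otimes> s 1) = s 2 \<otimes> (s 1 \<otimes> s 2)" using gen12(5) cl by (simp add: m_assoc)
  have br': "s 1 \<otimes> (s 2 \<otimes> (s 1 \<otimes> v)) = s 2 \<otimes> (s 1 \<otimes> (s 2 \<otimes> v))" if "v \<in> carrier B" for v
    using assoc_left[of "s 1" "s 2 \<otimes> s 1" "s 2" "s 1 \<otimes> s 2" v] br cl that by (simp add: m_assoc)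
  have "s 1 \<otimes> ?Y = s 2 \<otimes> (s 1 \<otimes> (s 2 \<otimes> (s 1 \<otimes> s 2)))" using cl by (intro br') auto
  also have "\<dots> = ?Y \<otimes> s 1" using cl br by (simp add: m_assoc)
  finally have c1: "s 1 \<otimes> ?Y = ?Y \<otimes> s 1" .
  have "(s 1 \<otimes> s 1) \<otimes> ?Y = s 1 \<otimes> (?Y \<otimes> s 1)" using cl by (simp only: m_assoc m_closed c1)
  also have "\<dots> = ?Y \<otimes> (s 1 \<otimes> s 1)"
    using cl by (intro assoc_left[OF c1]) auto
  finally show ?thesis unfolding Y twist_one using cl by (intro comm_eq_one) auto
qed

text \<open>A conjugate of \<open>twist_comm_relation\<close> says that the twist of
  \<open>{i, j}\<close> commutes with the product of those of \<open>{i, k}\<close> and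
  \<open>{j, k}\<close>. By bilinearity its commutators with the two factors are inverse to each
  other modulo \<open>pure_central 3\<close>.\<close>

lemma triple_comm_swap:
  assumes ijk: "distinct [i, j, k]" "{i, j, k} \<subseteq> {1..n}"
  shows "triple_comm j i k \<equiv>\<^sub>3 inv (triple_comm i j k)"
proof -
  obtain c where c: "c \<in> carrier B" "\<rho> c 1 = i" "\<rho> c 2 = j" "\<rho> c 3 = k"
    using ex_braid_three[OF ijk] by blast
  let ?x = "twist c" and ?y = "twist (c \<otimes> s 2)" and ?z = "twist (c \<otimes> (s 1 \<otimes> s 2))"
  have cl: "c \<otimes> s 2 \<in> carrier B" "c \<otimes> (s 1 \<otimes> s 2) \<in> carrier B" using c(1) gen12 by auto
  have xyz: "?x \<in> pure" "?y \<in> pure" "?z \<in> pure" using c(1) cl twist_pure by auto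
  have xyzc: "?x \<in> carrier B" "?y \<in> carrier B" "?z \<in> carrier B" using xyz by auto
  have ij': "triple_comm j i k \<in> carrier B" "triple_comm i j k \<in> carrier B"
    using ijk by (auto intro!: triple_comm_closed(2))
  have y: "comm ?x ?y \<equiv>\<^sub>3 triple_comm j i k"
    using c cl by (intro comm_twist_shared) (auto simp: sym_group_mult gen12 Transposition.transpose_def)
  have z: "comm ?x ?z \<equiv>\<^sub>3 triple_comm i j k"
    using c cl by (intro comm_twist_shared) (auto simp: sym_group_mult gen12 Transposition.transpose_def)
  have "c \<otimes> comm (twist \<one>) (twist (s 2) \<otimes> twist (s 1 \<otimes> s 2)) \<otimes> inv c = comm ?x (?y \<otimes> ?z)"
    using c(1) gen12 twist_closed twist_mult[OF c(1) one_closed]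
    by (simp add: conj_comm) (simp add: twist_mult m_assoc cancel_inv)
  then have "comm ?x (?y \<otimes> ?z) = \<one>"
    using c(1) by (simp add: twist_comm_relation)
  \<comment> \<open>The arguments are exchanged because \<open>comm_mult_left\<close> expands
    products on the left.\<close>
  moreover have "comm (?y \<otimes> ?z) ?x = inv (comm ?x (?y \<otimes> ?z))"
    using xyzc by (intro comm_swap) auto
  ultimately have "comm ?y (comm ?z ?x) \<otimes> comm ?z ?x \<otimes> comm ?y ?x = \<one>"
    using comm_mult_left[OF xyzc(2,3,1)] by simp
  then have e1: "comm ?y (comm ?z ?x) \<otimes> (comm ?z ?x \<otimes> comm ?y ?x) \<otimes> \<one> = \<one>"
    using xyzc by (simp add: m_assoc comm_closed)
  have "comm ?y (comm ?z ?x) \<otimes> (comm ?z ?x \<otimes> comm ?y ?x) \<otimes> \<one> \<equiv>\<^sub>3 comm ?z ?x \<otimes> comm ?y ?x"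
    using xyzc by (intro cong3_absorb comm_pure3(2)[OF comm_pure2[OF xyz(3,1)] xyz(2)] L3.one_closed m_closed comm_closed)
  then have e2: "comm ?z ?x \<otimes> comm ?y ?x \<equiv>\<^sub>3 \<one>"
    unfolding e1 by (rule cong3_sym)
  have e3: "comm ?z ?x \<otimes> comm ?y ?x = inv (comm ?x ?y \<otimes> comm ?x ?z)"
    unfolding comm_swap[OF xyzc(1,3)] comm_swap[OF xyzc(1,2)]
    using comm_closed[OF xyzc(1,2)] comm_closed[OF xyzc(1,3)] by (simp add: inv_mult_group)
  have e4: "inv (comm ?x ?y \<otimes> comm ?x ?z) \<equiv>\<^sub>3 inv (triple_comm j i k \<otimes> triple_comm i j k)"
    using ij' comm_closed[OF xyzc(1,2)] comm_closed[OF xyzc(1,3)]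
    by (intro cong3_inv cong3_mult[OF y z]) auto
  have "inv (triple_comm j i k \<otimes> triple_comm i j k) \<equiv>\<^sub>3 \<one>"
    using cong3_trans[OF cong3_sym[OF e4] e2[unfolded e3]] .
  then have "inv (inv (triple_comm j i k \<otimes> triple_comm i j k)) \<equiv>\<^sub>3 inv \<one>"
    using ij' by (intro cong3_inv) auto
  then have "triple_comm j i k \<otimes> triple_comm i j k \<equiv>\<^sub>3 \<one>"
    using ij' by (simp del: inv_mult_group)
  then have "triple_comm j i k \<otimes> triple_comm i j k \<otimes> inv (triple_comm i j k) \<equiv>\<^sub>3 \<one> \<otimes> inv (triple_comm i j k)"
    using ij' by (intro cong3_mult cong3_refl) auto
  then show ?thesis using ij' by (simp add: m_assoc)
qed

text \<open>A braid carries \<open>{1, 2}\<close> and \<open>{3, 4}\<close> to the two pairs. There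
  the twists can be taken as the squares of \<open>s 1\<close> and \<open>s 3\<close>, which
  commute, and the change of representatives is absorbed by \<open>comm_cong\<close>.\<close>

lemma comm_twist_disjoint:
  assumes b: "b \<in> carrier B" and c: "c \<in> carrier B"
    and dist: "distinct [\<rho> b 1, \<rho> b 2, \<rho> c 1, \<rho> c 2]"
  shows "comm (twist b) (twist c) \<in> pure_central 3"
proof -
  have im: "{\<rho> b 1, \<rho> b 2, \<rho> c 1, \<rho> c 2} \<subseteq> {1..n}" using perm_in b c three_le by auto
  then have "card {\<rho> b 1, \<rho> b 2, \<rho> c 1, \<rho> c 2} \<le> card {1..n}" by (intro card_mono) auto
  then have n: "4 \<le> n" using dist by simp
  obtain d where d: "d \<in> carrier B" "\<rho> d 1 = \<rho> b 1" "\<rho> d 2 = \<rho> b 2" "\<rho> d 3 = \<rho> c 1" "\<rho> d 4 = \<rho> c 2"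
    using ex_braid_four[OF dist im] by blast
  have s3: "s 3 \<in> carrier B" "\<rho> (s 3) = Transposition.transpose 3 4"
    using gen_closed[of 3] perm_gen[of 3] n by auto
  have br: "s 2 \<otimes> s 3 \<otimes> s 2 = s 3 \<otimes> s 2 \<otimes> s 3" using gen_braid[of 2] n by simp
  have com: "s 1 \<otimes> s 3 = s 3 \<otimes> s 1" using gen_commute[of 1 3] n by simp
  note cl = gen12(1,2) s3(1)
  \<comment> \<open>This braid passes the first two strings together across the next two: it sends
    1, 2 to 3, 4 and conjugates \<open>s 1\<close> to \<open>s 3\<close>.\<close>
  define v where "v = s 2 \<otimes> s 3 \<otimes> (s 1 \<otimes> s 2)"
  have vc: "v \<in> carrier B" using cl by (simp add: v_def)
  have "v \<otimes> s 1 = s 2 \<otimes> s 3 \<otimes> (s 1 \<otimes> s 2 \<otimes> s 1)" using cl by (simp add: v_def m_assoc)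
  also have "\<dots> = (s 2 \<otimes> s 3 \<otimes> s 2) \<otimes> (s 1 \<otimes> s 2)" unfolding gen12(5) using cl by (simp add: m_assoc)
  also have "\<dots> = s 3 \<otimes> v" unfolding br using cl by (simp add: v_def m_assoc)
  finally have tv: "twist v = s 3 \<otimes> s 3" using vc cl by (intro twist_eq_square)
  have rv: "\<rho> v 1 = 3" "\<rho> v 2 = 4"
    using cl by (simp_all add: v_def sym_group_mult gen12 s3 Transposition.transpose_def)
  have com': "s 1 \<otimes> (s 3 \<otimes> x) = s 3 \<otimes> (s 1 \<otimes> x)" if "x \<in> carrier B" for x
    using cl that by (intro assoc_left[OF com])
  have "twist \<one> \<otimes> twist v = twist v \<otimes> twist \<one>"
    unfolding tv twist_one using cl by (simp add: m_assoc com com')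
  then have "comm (twist \<one>) (twist v) = \<one>" using vc twist_closed by (intro comm_eq_one) auto
  then have "\<one> = d \<otimes> comm (twist \<one>) (twist v) \<otimes> inv d" using d by simp
  also have "\<dots> = comm (twist d) (twist (d \<otimes> v))"
    using d(1) vc twist_closed twist_mult[OF d(1) one_closed] by (simp add: conj_comm twist_mult)
  also have "comm (twist d) (twist (d \<otimes> v)) \<equiv>\<^sub>3 comm (twist b) (twist c)"
    using b c d vc rv by (intro comm_cong twist_pure twist_cong) (auto simp: sym_group_mult)
  finally have "comm (twist b) (twist c) \<equiv>\<^sub>3 \<one>" by (rule cong3_sym)
  then show ?thesis
    using comm_closed[OF twist_closed[OF b] twist_closed[OF c]] by (simp add: cong3_iff)
qed

definition increasing_triples :: "(nat \<times> nat \<times> nat) set"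
  where "increasing_triples = {(i, j, k). 1 \<le> i \<and> i < j \<and> j < k \<and> k \<le> n}"

abbreviation "triple_span \<equiv>
  generate B ((\<lambda>(i, j, k). triple_comm i j k) ` increasing_triples \<union> pure_central 3)"

lemma increasing_triple_comm:
  assumes "(i, j, k) \<in> increasing_triples"
  shows "distinct [i, j, k]" "{i, j, k} \<subseteq> {1..n}"
  using assms by (auto simp: increasing_triples_def)

lemma triple_span: "subgroup triple_span B" "pure_central 3 \<subseteq> triple_span" "triple_span \<subseteq> pure_central 2"
proof -
  have sub: "(\<lambda>(i, j, k). triple_comm i j k) ` increasing_triples \<union> pure_central 3 \<subseteq> pure_central 2"
    using triple_comm_closed(1)[OF increasing_triple_comm] pure_central_mono by auto
  then show "triple_span \<subseteq> pure_central 2" by (rule generate_subgroup_incl[OF _ L2.subgroup_axioms])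
  show "subgroup triple_span B" using sub L2.subset by (intro generate_is_subgroup) blast
  show "pure_central 3 \<subseteq> triple_span" by (auto intro: generate.incl)
qed

lemma triple_span_cong:
  assumes "x \<in> triple_span" "y \<in> carrier B" "y \<equiv>\<^sub>3 x"
  shows "y \<in> triple_span"
proof -
  interpret V: subgroup triple_span B by (rule triple_span)
  have "y \<otimes> inv x \<in> triple_span" using assms cong3_iff[of y x] triple_span(2) by auto
  then have "y \<otimes> inv x \<otimes> x \<in> triple_span" using assms(1) by (rule V.m_closed)
  then show ?thesis using assms by (simp add: m_assoc)
qed

text \<open>Reversal and exchange of the first two labels generate all permutations of three labels,
  and each changes the commutator only to its inverse modulo \<open>pure_central 3\<close>.\<close>

lemma triple_comm_in_span:
  assumes "distinct [i, j, k]" "{i, j, k} \<subseteq> {1..n}"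
  shows "triple_comm i j k \<in> triple_span"
proof -
  interpret V: subgroup triple_span B by (rule triple_span)
  have rev: "triple_comm k j i \<in> triple_span"
    if "distinct [i, j, k]" "{i, j, k} \<subseteq> {1..n}" "triple_comm i j k \<in> triple_span" for i j k
    using triple_span_cong[OF V.m_inv_closed[OF that(3)] triple_comm_closed(2) triple_comm_reverse] that by auto
  have swap: "triple_comm j i k \<in> triple_span"
    if "distinct [i, j, k]" "{i, j, k} \<subseteq> {1..n}" "triple_comm i j k \<in> triple_span" for i j k
    using triple_span_cong[OF V.m_inv_closed[OF that(3)] triple_comm_closed(2) triple_comm_swap] that by auto
  have inc: "triple_comm i j k \<in> triple_span" if "i < j" "j < k" "{i, j, k} \<subseteq> {1..n}" for i j k
    using that by (intro generate.incl) (auto simp: increasing_triples_def intro!: image_eqI[of _ _ "(i, j, k)"])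
  consider "i < j" "j < k" | "i < k" "k < j" | "j < i" "i < k" | "j < k" "k < i" | "k < i" "i < j" | "k < j" "j < i"
    using assms(1) by (auto simp: neq_iff)
  then show ?thesis
  proof cases
    case 1
    then show ?thesis using inc assms by simp
  next
    case 2
    then have "triple_comm i k j \<in> triple_span" using inc assms by auto
    then have "triple_comm k i j \<in> triple_span" using swap[of i k j] assms by auto
    then have "triple_comm j i k \<in> triple_span" using rev[of k i j] assms by auto
    then show ?thesis using swap[of j i k] assms by auto
  next
    case 3
    then have "triple_comm j i k \<in> triple_span" using inc assms by auto
    then show ?thesis using swap[of j i k] assms by auto
  next
    case 4
    then have "triple_comm j k i \<in> triple_span" using inc assms by auto
    then have "triple_comm k j i \<in> triple_span" using swap[of j k i] assms by auto
    then show ?thesis using rev[of k j i] assms by auto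
  next
    case 5
    then have "triple_comm k i j \<in> triple_span" using inc assms by auto
    then have "triple_comm j i k \<in> triple_span" using rev[of k i j] assms by auto
    then show ?thesis using swap[of j i k] assms by auto
  next
    case 6
    then have "triple_comm k j i \<in> triple_span" using inc assms by auto
    then show ?thesis using rev[of k j i] assms by auto
  qed
qed

lemma comm_twist_in_span:
  assumes b: "b \<in> carrier B" and c: "c \<in> carrier B"
  shows "comm (twist b) (twist c) \<in> triple_span"
proof -
  have cc: "comm (twist b) (twist c) \<in> carrier B" using b c twist_closed comm_closed by simp
  have nb: "\<rho> b 1 \<noteq> \<rho> b 2" "\<rho> c 1 \<noteq> \<rho> c 2" "{\<rho> b 1, \<rho> b 2, \<rho> c 1, \<rho> c 2} \<subseteq> {1..n}"
    using perm_eq_iff b c perm_in three_le by auto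
  have shared: ?thesis
    if "\<rho> b 1 = i \<and> \<rho> b 2 = j \<or> \<rho> b 1 = j \<and> \<rho> b 2 = i"
      "\<rho> c 1 = j \<and> \<rho> c 2 = k \<or> \<rho> c 1 = k \<and> \<rho> c 2 = j" "i \<noteq> k" for i j k
  proof -
    have "distinct [i, j, k]" "{i, j, k} \<subseteq> {1..n}" using that nb by auto
    from triple_comm_in_span[OF this] show ?thesis
      using cc comm_twist_shared[OF b c that(1,2)] by (rule triple_span_cong)
  qed
  \<comment> \<open>Two pairs coincide, share exactly one string (four positions), or are
    disjoint.\<close>
  consider "\<rho> b 1 = \<rho> c 1 \<and> \<rho> b 2 = \<rho> c 2 \<or> \<rho> b 1 = \<rho> c 2 \<and> \<rho> b 2 = \<rho> c 1"
    | "\<rho> b 1 = \<rho> c 1" "\<rho> b 2 \<noteq> \<rho> c 2" | "\<rho> b 1 = \<rho> c 2" "\<rho> b 2 \<noteq> \<rho> c 1"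
    | "\<rho> b 2 = \<rho> c 1" "\<rho> b 1 \<noteq> \<rho> c 2" | "\<rho> b 2 = \<rho> c 2" "\<rho> b 1 \<noteq> \<rho> c 1"
    | "distinct [\<rho> b 1, \<rho> b 2, \<rho> c 1, \<rho> c 2]"
    using nb by auto
  then show ?thesis
  proof cases
    case 1
    have "comm (twist b) (twist c) \<equiv>\<^sub>3 comm (twist c) (twist c)"
      using b c twist_cong[OF b c 1] L2.one_closed
      by (intro comm_cong twist_pure) (auto simp: twist_closed)
    moreover have "comm (twist c) (twist c) = \<one>" using twist_closed[OF c] by (intro comm_eq_one) auto
    ultimately have "comm (twist b) (twist c) \<in> pure_central 3" using cc by (simp add: cong3_iff)
    then show ?thesis using triple_span by auto
  next
    case 2
    then show ?thesis by (intro shared[of "\<rho> b 2" "\<rho> b 1" "\<rho> c 2"]) auto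
  next
    case 3
    then show ?thesis by (intro shared[of "\<rho> b 2" "\<rho> b 1" "\<rho> c 1"]) auto
  next
    case 4
    then show ?thesis by (intro shared[of "\<rho> b 1" "\<rho> b 2" "\<rho> c 2"]) auto
  next
    case 5
    then show ?thesis by (intro shared[of "\<rho> b 1" "\<rho> b 2" "\<rho> c 1"]) auto
  next
    case 6
    then show ?thesis using comm_twist_disjoint[OF b c] triple_span by auto
  qed
qed

section \<open>Triple windings as coordinates on the second quotient\<close>

lemma triple_winding_mult:
  assumes "h \<in> pure_central 2" "k \<in> pure_central 2"
  shows "triple_winding (h \<otimes> k) a b c = triple_winding h a b c + triple_winding k a b c"
proof -
  have "winding h = (\<lambda>i j. 0)" using winding_pure_central2[OF assms(1)] by (simp add: fun_eq_iff)
  then show ?thesis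
    using pure_winding_mult(2)[of h k a b c] assms pure_central_mono by (auto simp: braid_bracket_def)
qed

lemma triple_winding_one: "triple_winding \<one> a b c = 0"
  and triple_winding_inv: "h \<in> pure_central 2 \<Longrightarrow> triple_winding (inv h) a b c = - triple_winding h a b c"
  using additive_int_pow(1,2)[OF L2.subgroup_axioms, of "\<lambda>h. triple_winding h a b c"] triple_winding_mult
  by auto

lemma pure_central3_generate:
  "pure_central 3 = generate B {h \<otimes> k \<otimes> inv h \<otimes> inv k | h k. h \<in> pure_central 2 \<and> k \<in> pure}"
  using pure_central_Suc[of "Suc 0"] by (simp only: pure_central_two pure_central_three)

lemma triple_winding_pure_central3: "m \<in> pure_central 3 \<Longrightarrow> triple_winding m a b c = 0"
proof -
  have "pure_central 3 \<subseteq> {m \<in> pure_central 2. triple_winding m a b c = 0}"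
    unfolding pure_central3_generate
  proof (rule generate_subgroup_incl)
    show "subgroup {m \<in> pure_central 2. triple_winding m a b c = 0} B"
      by (rule subgroupI)
        (use L2.subset L2.one_closed in \<open>auto simp: triple_winding_one triple_winding_inv triple_winding_mult intro!: exI[of _ \<one>]\<close>)
    have "h \<otimes> k \<otimes> inv h \<otimes> inv k \<in> pure_central 2 \<and> triple_winding (h \<otimes> k \<otimes> inv h \<otimes> inv k) a b c = 0"
      if h: "h \<in> pure_central 2" and k: "k \<in> pure" for h k
    proof -
      have "winding h = (\<lambda>i j. 0)" using winding_pure_central2[OF h] by (simp add: fun_eq_iff)
      then show ?thesis
        using winding_commutator(2)[of h k a b c] h k pure_central_mono commutator_pure_central2[of h k]
        by (auto simp: braid_bracket_def)
    qed
    then show "{h \<otimes> k \<otimes> inv h \<otimes> inv k |h k. h \<in> pure_central 2 \<and> k \<in> pure} \<subseteq> {m \<in> pure_central 2. triple_winding m a b c = 0}"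
      by blast
  qed
  then show "m \<in> pure_central 3 \<Longrightarrow> triple_winding m a b c = 0" by auto
qed

text \<open>For commutators, alternation comes from the symmetry of windings. The divisor is the
  product of the 2 in \<open>winding_commutator\<close>, the 3 in \<open>braid_bracket\<close> and
  the two even windings. Additivity on \<open>pure_central 2\<close> does the rest.\<close>

lemma triple_winding_alternating:
  assumes "m \<in> pure_central 2"
  shows "triple_winding m j i k = - triple_winding m i j k"
    and "triple_winding m i k j = - triple_winding m i j k"
    and "24 dvd triple_winding m i j k"
proof -
  let ?P = "\<lambda>m. triple_winding m j i k = - triple_winding m i j k \<and>
    triple_winding m i k j = - triple_winding m i j k \<and> 24 dvd triple_winding m i j k"
  have "pure_central 2 \<subseteq> {m \<in> pure_central 2. ?P m}"

  proof -
    have "generate B {h \<otimes> k \<otimes> inv h \<otimes> inv k |h k. h \<in> pure_central (Suc 0) \<and> k \<in> pure} \<subseteq> {m \<in> pure_central 2. ?P m}"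
    proof (rule generate_subgroup_incl)
      show "subgroup {m \<in> pure_central 2. ?P m} B"
        by (rule subgroupI)
          (use L2.subset L2.one_closed in \<open>auto simp: triple_winding_one triple_winding_inv triple_winding_mult intro!: exI[of _ \<one>]\<close>)
      have "?P (g \<otimes> h \<otimes> inv g \<otimes> inv h)" if g: "g \<in> pure" and h: "h \<in> pure" for g h
      proof -
        have sym: "winding g x y = winding g y x" "winding h x y = winding h y x" for x y
          using winding_symmetric_even g h by auto
        have ev: "\<exists>a. winding g x y = 2 * a" "\<exists>a. winding h x y = 2 * a" for x y
          using winding_symmetric_even[OF g, of x y] winding_symmetric_even[OF h, of x y]
          by (auto elim!: evenE)
        obtain a1 a2 a3 b1 b2 b3 where ab: "winding g i j = 2 * a1" "winding g j k = 2 * a2" "winding g k i = 2 * a3"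
          "winding h i j = 2 * b1" "winding h j k = 2 * b2" "winding h k i = 2 * b3"
          using ev by metis
        note ab' = ab[unfolded sym(1)[of i j] sym(1)[of j k] sym(1)[of k i] sym(2)[of i j] sym(2)[of j k] sym(2)[of k i]]
        show ?thesis
          unfolding winding_commutator(2)[OF g h]
          by (auto simp: braid_bracket_def ab ab' algebra_simps)
      qed
      then show "{h \<otimes> k \<otimes> inv h \<otimes> inv k |h k. h \<in> pure_central (Suc 0) \<and> k \<in> pure} \<subseteq> {m \<in> pure_central 2. ?P m}"
        using commutator_pure_central2 by auto
    qed
    then show ?thesis unfolding pure_central_two pure_central_Suc[symmetric] .
  qed
  then show "triple_winding m j i k = - triple_winding m i j k"
    "triple_winding m i k j = - triple_winding m i j k" "24 dvd triple_winding m i j k"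
    using assms by auto
qed

text \<open>The commutators of increasing triples generate by bilinearity, and on increasing labels
  their triple windings form 24 times the identity matrix.\<close>

lemma triple_winding_basis:
  shows "m \<in> pure_central 2 \<Longrightarrow> (\<And>i j k. (i, j, k) \<in> increasing_triples \<Longrightarrow> triple_winding m i j k = 0) \<Longrightarrow>
      m \<in> pure_central 3"
    and "\<exists>m\<in>pure_central 2. \<forall>(i, j, k)\<in>increasing_triples. triple_winding m i j k = 24 * v (i, j, k)"
proof -
  let ?A = "\<lambda>(i, j, k). triple_comm i j k"
  let ?lam = "\<lambda>(i, j, k) m. triple_winding m i j k"
  have "increasing_triples \<subseteq> {1..n} \<times> {1..n} \<times> {1..n}" by (auto simp: increasing_triples_def)
  then have fin: "finite increasing_triples" by (rule finite_subset) simp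
  have AN: "?A x \<in> pure_central 2" if "x \<in> increasing_triples" for x
    using that triple_comm_closed(1)[OF increasing_triple_comm] by (cases x) auto
  have gen: "pure_central 2 \<subseteq> triple_span"
    by (rule comm_bilinear_mem[OF triple_span comm_twist_in_span])
  have com: "h \<otimes> k \<otimes> inv h \<otimes> inv k \<in> pure_central 3" if "h \<in> pure_central 2" "k \<in> pure_central 2" for h k
    using that pure_central_mono by (intro commutator_pure_central3) auto
  have A: "triple_winding (triple_comm i j k) x y z = (if x = i \<and> y = j \<and> z = k then 24 else 0)"
    if ijk: "(i, j, k) \<in> increasing_triples" and xyz: "x < y" "y < z" for i j k x y z
  proof -
    have lt: "i < j" "j < k" using ijk by (auto simp: increasing_triples_def)
    have p: "pair_braid i j \<in> carrier B" "\<rho> (pair_braid i j) 1 = i" "\<rho> (pair_braid i j) 2 = j"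
      "pair_braid j k \<in> carrier B" "\<rho> (pair_braid j k) 1 = j" "\<rho> (pair_braid j k) 2 = k"
      using pair_braid ijk by (auto simp: increasing_triples_def)
    show ?thesis
      unfolding triple_comm_def comm_def
        winding_commutator(2)[OF twist_pure[OF p(1)] twist_pure[OF p(4)]] braid_bracket_def
        winding_twist[OF p(1)] winding_twist[OF p(4)] p
      using lt xyz by auto
  qed
  have lam_A: "?lam x (?A y) = (if x = y then 24 else 0)"
    if "x \<in> increasing_triples" "y \<in> increasing_triples" for x y
    using that A by (cases x; cases y) (auto simp: increasing_triples_def)
  note * = coordinates_free_basis[OF L2.subgroup_axioms L3.subgroup_axioms pure_central_mono(2)
      com fin AN gen, of ?lam 24]
  show "m \<in> pure_central 3" if "m \<in> pure_central 2"
    "\<And>i j k. (i, j, k) \<in> increasing_triples \<Longrightarrow> triple_winding m i j k = 0"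
    by (rule *(1)) (use that lam_A in \<open>auto simp: triple_winding_mult triple_winding_pure_central3\<close>)
  have "\<exists>m\<in>pure_central 2. \<forall>x\<in>increasing_triples. ?lam x m = 24 * v x"
    by (rule *(2)) (use lam_A in \<open>auto simp: triple_winding_mult triple_winding_pure_central3\<close>)
  then show "\<exists>m\<in>pure_central 2. \<forall>(i, j, k)\<in>increasing_triples. triple_winding m i j k = 24 * v (i, j, k)"
    by (auto simp: case_prod_beta)
qed

end

section \<open>Lifting group actions to braids\<close>

context artin_braids
begin

lemma set_action_section:
  fixes K :: "('k, 'm) monoid_scheme"
  assumes K: "group K" and \<iota>: "\<iota> \<in> hom K (sym_group n)"
    and free: "\<And>g T. g \<in> carrier K \<Longrightarrow> T \<subseteq> {1..n} \<Longrightarrow> card T = m \<Longrightarrow> \<iota> g ` T = T \<Longrightarrow> g = \<one>\<^bsub>K\<^esub>"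
  shows "\<exists>\<kappa>. \<forall>T. T \<subseteq> {1..n} \<and> card T = m \<longrightarrow>
    \<kappa> T \<in> carrier K \<and> (\<forall>g\<in>carrier K. \<kappa> (\<iota> g ` T) = g \<otimes>\<^bsub>K\<^esub> \<kappa> T)"
proof -
  interpret \<iota>: group_hom K "sym_group n" \<iota>
    using K \<iota> by (simp add: group_hom_def group_hom_axioms_def sym_group_is_group)
  have perm: "\<iota> g permutes {1..n}" if "g \<in> carrier K" for g
    using \<iota>.hom_closed[OF that] by (simp add: sym_group_carrier)
  let ?Ts = "{T. T \<subseteq> {1..n} \<and> card T = m}"
  have "\<exists>\<kappa>. \<forall>T\<in>?Ts. \<kappa> T \<in> carrier K \<and> (\<forall>g\<in>carrier K. \<kappa> (\<iota> g ` T) = g \<otimes>\<^bsub>K\<^esub> \<kappa> T)"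
  proof (rule free_action_section[OF K])
    fix g T assume g: "g \<in> carrier K" and T: "T \<in> ?Ts"
    have "card (\<iota> g ` T) = card T"
      using permutes_inj[OF perm[OF g]] by (intro card_image) (auto intro: inj_on_subset)
    moreover have "\<iota> g ` T \<subseteq> {1..n}" using T permutes_image[OF perm[OF g]] by blast
    ultimately show "\<iota> g ` T \<in> ?Ts" using T by simp
  next
    fix g h T assume "g \<in> carrier K" "h \<in> carrier K"
    then show "\<iota> (g \<otimes>\<^bsub>K\<^esub> h) ` T = \<iota> g ` \<iota> h ` T" by (simp add: sym_group_mult image_comp)
  next
    fix T show "\<iota> \<one>\<^bsub>K\<^esub> ` T = T" by (simp add: sym_group_one)
  next
    fix g T assume "g \<in> carrier K" "T \<in> ?Ts" "\<iota> g ` T = T"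
    then show "g = \<one>\<^bsub>K\<^esub>" by (intro free[of g T]) auto
  qed
  then show ?thesis by simp
qed

lemma perm_eq_of_pure:
  assumes "b \<in> carrier B" "c \<in> carrier B" "b \<otimes> inv c \<in> pure"
  shows "\<rho> b = \<rho> c"
proof -
  have "\<rho> b = \<rho> (b \<otimes> inv c \<otimes> c)" using assms by (simp add: m_assoc del: perm.hom_mult)
  also have "\<dots> = \<rho> c" using assms perm_mult[of "b \<otimes> inv c" c] by (simp add: pure_iff)
  finally show ?thesis .
qed

lemma pure_of_perm_eq:
  assumes "b \<in> carrier B" "c \<in> carrier B" "\<rho> b = \<rho> c"
  shows "b \<otimes> inv c \<in> pure"
proof -
  have "\<rho> (b \<otimes> inv c) = \<rho> b \<circ> \<rho> (inv c)" using assms by (intro perm_mult) auto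
  also have "\<dots> = id" unfolding assms(3) using perm_inv'[OF assms(2)] by (auto simp: fun_eq_iff simp del: perm.hom_inv)
  finally show ?thesis using assms by (simp add: pure_iff)
qed

lemma lift_mod_pure_central2:
  fixes K :: "('k, 'm) monoid_scheme"
  assumes K: "group K" and \<iota>: "\<iota> \<in> hom K (sym_group n)"
    and free: "\<And>g T. g \<in> carrier K \<Longrightarrow> T \<subseteq> {1..n} \<Longrightarrow> card T = 2 \<Longrightarrow> \<iota> g ` T = T \<Longrightarrow> g = \<one>\<^bsub>K\<^esub>"
  shows "\<exists>e. (\<forall>g\<in>carrier K. e g \<in> carrier B \<and> \<rho> (e g) = \<iota> g) \<and>
    (\<forall>g\<in>carrier K. \<forall>h\<in>carrier K. e g \<otimes> e h \<otimes> inv (e (g \<otimes>\<^bsub>K\<^esub> h)) \<in> pure_central 2)"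
proof -
  interpret \<iota>: group_hom K "sym_group n" \<iota>
    using K \<iota> by (simp add: group_hom_def group_hom_axioms_def sym_group_is_group)
  have perm: "\<iota> g permutes {1..n}" if "g \<in> carrier K" for g
    using \<iota>.hom_closed[OF that] by (simp add: sym_group_carrier)
  obtain \<kappa> where "\<forall>T. T \<subseteq> {1..n} \<and> card T = 2 \<longrightarrow>
      \<kappa> T \<in> carrier K \<and> (\<forall>g\<in>carrier K. \<kappa> (\<iota> g ` T) = g \<otimes>\<^bsub>K\<^esub> \<kappa> T)"
    using set_action_section[OF K \<iota> free] ..
  then have \<kappa>: "\<And>T. T \<subseteq> {1..n} \<Longrightarrow> card T = 2 \<Longrightarrow> \<kappa> T \<in> carrier K"
    "\<And>g T. g \<in> carrier K \<Longrightarrow> T \<subseteq> {1..n} \<Longrightarrow> card T = 2 \<Longrightarrow> \<kappa> (\<iota> g ` T) = g \<otimes>\<^bsub>K\<^esub> \<kappa> T"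
    by simp_all
  \<comment> \<open>Arbitrary lifts of the permutations; their defect is a cocycle with values in
    the pure braids.\<close>
  have "\<exists>b. b \<in> carrier B \<and> \<rho> b = \<iota> g" if g: "g \<in> carrier K" for g
    using ex_braid_with_perm[OF order_refl perm[OF g]] gen_generate by auto
  then obtain e where e: "e g \<in> carrier B" "\<rho> (e g) = \<iota> g" if "g \<in> carrier K" for g
    by metis
  let ?Ts = "{(i, j). i \<noteq> j \<and> i \<in> {1..n} \<and> j \<in> {1..n}}"
  let ?act = "\<lambda>g (i, j). (\<iota> g i, \<iota> g j)"
  \<comment> \<open>Coordinates run over ordered pairs, since the action does not preserve the
    order, but the section sees only the set. Both orders then copy their coordinate from the same
    element, as the symmetry of windings requires.\<close>
  let ?\<kappa> = "\<lambda>(i, j). \<kappa> {i, j}"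
  let ?lam = "\<lambda>(i, j) m. winding m i j"
  have "\<exists>e'. (\<forall>g\<in>carrier K. e' g \<in> carrier B \<and> e' g \<otimes> inv (e g) \<in> pure) \<and>
    (\<forall>g\<in>carrier K. \<forall>h\<in>carrier K. e' g \<otimes> e' h \<otimes> inv (e' (g \<otimes>\<^bsub>K\<^esub> h)) \<in> pure_central 2)"
  proof (rule lift_modulo_coordinates[OF K pure.normal_axioms, where lam = ?lam and Ts = ?Ts and act = ?act and \<kappa> = ?\<kappa>])
    show "e g \<in> carrier B" if "g \<in> carrier K" for g using e that by blast
    show "e g \<otimes> e h \<otimes> inv (e (g \<otimes>\<^bsub>K\<^esub> h)) \<in> pure" if "g \<in> carrier K" "h \<in> carrier K" for g h
    proof -
      have "\<rho> (e g \<otimes> e h) = \<rho> (e (g \<otimes>\<^bsub>K\<^esub> h))" using that e by simp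
      moreover have "e g \<otimes> e h \<in> carrier B" "e (g \<otimes>\<^bsub>K\<^esub> h) \<in> carrier B" using that e by simp_all
      ultimately show ?thesis by (intro pure_of_perm_eq)
    qed
    show "?lam T (h \<otimes> k) = ?lam T h + ?lam T k" if "h \<in> pure" "k \<in> pure" for T h k
      using that by (cases T) (simp add: pure_winding_mult)
    show "m \<in> pure_central 2" if m: "m \<in> pure" "\<And>T. T \<in> ?Ts \<Longrightarrow> ?lam T m = 0" for m
    proof (rule winding_basis(1)[OF m(1)])
      show "winding m i j = 0" if "(i, j) \<in> increasing_pairs" for i j
        using m(2)[of "(i, j)"] that by (simp add: increasing_pairs_def)
    qed
    show "?lam (?act g T) (e g \<otimes> m \<otimes> inv (e g)) = ?lam T m" if "g \<in> carrier K" "m \<in> pure" for g m T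
      using winding_conj(1)[OF e(1)[OF that(1)] that(2)] e(2)[OF that(1)] by (cases T) simp
    show "?act g T \<in> ?Ts" if g: "g \<in> carrier K" and T0: "T \<in> ?Ts" for g T
    proof -
      obtain i j where T: "T = (i, j)" "i \<noteq> j" "i \<in> {1..n}" "j \<in> {1..n}" using T0 by blast
      have "\<iota> g i \<noteq> \<iota> g j" using permutes_inj[OF perm[OF g]] T(2) by (simp add: inj_eq)
      then show ?thesis using T permutes_in_image[OF perm[OF g]] by simp
    qed
    show "?act (g \<otimes>\<^bsub>K\<^esub> h) T = ?act g (?act h T)" if "g \<in> carrier K" "h \<in> carrier K" for g h T
      using that by (cases T) (simp add: sym_group_mult)
    show "?act \<one>\<^bsub>K\<^esub> T = T" for T by (cases T) (simp add: sym_group_one)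
    show "?\<kappa> T \<in> carrier K" if "T \<in> ?Ts" for T
      using that \<kappa>(1) by auto
    show "?\<kappa> (?act g T) = g \<otimes>\<^bsub>K\<^esub> ?\<kappa> T" if g: "g \<in> carrier K" and T0: "T \<in> ?Ts" for g T
    proof -
      obtain i j where T: "T = (i, j)" "i \<noteq> j" "i \<in> {1..n}" "j \<in> {1..n}" using T0 by blast
      then show ?thesis using \<kappa>(2)[OF g, of "{i, j}"] by simp
    qed
    fix f assume f: "\<And>g. g \<in> carrier K \<Longrightarrow> f g \<in> pure"
    \<comment> \<open>Windings of pure braids are even, so halving and doubling loses nothing and
      the basis attains exactly the desired values.\<close>
    obtain m where m: "m \<in> pure" "\<forall>(i, j)\<in>increasing_pairs. winding m i j = 2 * (winding (f (\<kappa> {i, j})) i j div 2)"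
      using winding_basis(2)[of "\<lambda>(i, j). winding (f (\<kappa> {i, j})) i j div 2"] by auto
    have "winding m i j = winding (f (\<kappa> {i, j})) i j" if ij: "i \<noteq> j" "i \<in> {1..n}" "j \<in> {1..n}" for i j
    proof -
      have k: "f (\<kappa> {i, j}) \<in> pure" using f \<kappa>(1)[of "{i, j}"] ij by simp
      consider "i < j" | "j < i" using ij by linarith
      then show ?thesis
      proof cases
        case 1
        then have "(i, j) \<in> increasing_pairs" using ij by (simp add: increasing_pairs_def)
        then show ?thesis using m(2) winding_symmetric_even[OF k, of i j] by auto
      next
        case 2
        then have "(j, i) \<in> increasing_pairs" using ij by (simp add: increasing_pairs_def)
        then have "winding m j i = 2 * (winding (f (\<kappa> {i, j})) j i div 2)"
          using m(2) by (auto simp: insert_commute)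
        then show ?thesis
          using winding_symmetric_even[OF k, of i j] winding_symmetric_even[OF m(1), of i j] by auto
      qed
    qed
    then show "\<exists>m\<in>pure. \<forall>T\<in>?Ts. ?lam T m = ?lam T (f (?\<kappa> T))"
      using m(1) by (intro bexI[of _ m]) auto
  qed
  then obtain e' where e': "\<And>g. g \<in> carrier K \<Longrightarrow> e' g \<in> carrier B \<and> e' g \<otimes> inv (e g) \<in> pure"
    "\<forall>g\<in>carrier K. \<forall>h\<in>carrier K. e' g \<otimes> e' h \<otimes> inv (e' (g \<otimes>\<^bsub>K\<^esub> h)) \<in> pure_central 2"
    by blast
  have "\<rho> (e' g) = \<iota> g" if "g \<in> carrier K" for g
    using perm_eq_of_pure[of "e' g" "e g"] e' e that by simp
  then show ?thesis using e' by blast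
qed

text \<open>After the lift modulo \<open>pure_central 2\<close>, the remaining defect has values in
  \<open>pure_central 2\<close>. There windings vanish and triple windings are additive, so the same
  argument applies to sets of three strings.\<close>

lemma lift_mod_pure_central3:
  fixes K :: "('k, 'm) monoid_scheme"
  assumes K: "group K" and \<iota>: "\<iota> \<in> hom K (sym_group n)"
    and free: "\<And>g T m. g \<in> carrier K \<Longrightarrow> T \<subseteq> {1..n} \<Longrightarrow> m \<in> {2, 3} \<Longrightarrow> card T = m \<Longrightarrow> \<iota> g ` T = T \<Longrightarrow> g = \<one>\<^bsub>K\<^esub>"
  shows "\<exists>e. (\<forall>g\<in>carrier K. e g \<in> carrier B \<and> \<rho> (e g) = \<iota> g) \<and>
    (\<forall>g\<in>carrier K. \<forall>h\<in>carrier K. e g \<otimes> e h \<otimes> inv (e (g \<otimes>\<^bsub>K\<^esub> h)) \<in> pure_central 3)"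
proof -
  interpret \<iota>: group_hom K "sym_group n" \<iota>
    using K \<iota> by (simp add: group_hom_def group_hom_axioms_def sym_group_is_group)
  have perm: "\<iota> g permutes {1..n}" if "g \<in> carrier K" for g
    using \<iota>.hom_closed[OF that] by (simp add: sym_group_carrier)
  have free2: "g = \<one>\<^bsub>K\<^esub>" if "g \<in> carrier K" "T \<subseteq> {1..n}" "card T = 2" "\<iota> g ` T = T" for g T
    using that by (intro free[where m = 2]) auto
  have free3: "g = \<one>\<^bsub>K\<^esub>" if "g \<in> carrier K" "T \<subseteq> {1..n}" "card T = 3" "\<iota> g ` T = T" for g T
    using that by (intro free[where m = 3]) auto
  obtain \<kappa> where "\<forall>T. T \<subseteq> {1..n} \<and> card T = 3 \<longrightarrow>
      \<kappa> T \<in> carrier K \<and> (\<forall>g\<in>carrier K. \<kappa> (\<iota> g ` T) = g \<otimes>\<^bsub>K\<^esub> \<kappa> T)"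
    using set_action_section[OF K \<iota> free3] ..
  then have \<kappa>: "\<And>T. T \<subseteq> {1..n} \<Longrightarrow> card T = 3 \<Longrightarrow> \<kappa> T \<in> carrier K"
    "\<And>g T. g \<in> carrier K \<Longrightarrow> T \<subseteq> {1..n} \<Longrightarrow> card T = 3 \<Longrightarrow> \<kappa> (\<iota> g ` T) = g \<otimes>\<^bsub>K\<^esub> \<kappa> T"
    by simp_all
  obtain e where lift2: "(\<forall>g\<in>carrier K. e g \<in> carrier B \<and> \<rho> (e g) = \<iota> g) \<and>
      (\<forall>g\<in>carrier K. \<forall>h\<in>carrier K. e g \<otimes> e h \<otimes> inv (e (g \<otimes>\<^bsub>K\<^esub> h)) \<in> pure_central 2)"
    using lift_mod_pure_central2[OF K \<iota> free2] ..
  have e: "e g \<in> carrier B" "\<rho> (e g) = \<iota> g" if "g \<in> carrier K" for g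
    using lift2 that by simp_all
  have e2: "e g \<otimes> e h \<otimes> inv (e (g \<otimes>\<^bsub>K\<^esub> h)) \<in> pure_central 2" if "g \<in> carrier K" "h \<in> carrier K" for g h
    using lift2 that by simp
  let ?Ts = "{(i, j, k). distinct [i, j, k] \<and> {i, j, k} \<subseteq> {1..n}}"
  let ?act = "\<lambda>g (i, j, k). (\<iota> g i, \<iota> g j, \<iota> g k)"
  let ?\<kappa> = "\<lambda>(i, j, k). \<kappa> {i, j, k}"
  let ?lam = "\<lambda>(i, j, k) m. triple_winding m i j k"
  have Ts: "\<exists>i j k. T = (i, j, k) \<and> distinct [i, j, k] \<and> {i, j, k} \<subseteq> {1..n} \<and> card {i, j, k} = 3"
    if "T \<in> ?Ts" for T
    using that by auto
  have "\<exists>e'. (\<forall>g\<in>carrier K. e' g \<in> carrier B \<and> e' g \<otimes> inv (e g) \<in> pure_central 2) \<and>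
    (\<forall>g\<in>carrier K. \<forall>h\<in>carrier K. e' g \<otimes> e' h \<otimes> inv (e' (g \<otimes>\<^bsub>K\<^esub> h)) \<in> pure_central 3)"
  proof (rule lift_modulo_coordinates[OF K L2.normal_axioms e(1) e2, where lam = ?lam and Ts = ?Ts and act = ?act and \<kappa> = ?\<kappa>])
    show "?lam T (h \<otimes> k) = ?lam T h + ?lam T k" if "h \<in> pure_central 2" "k \<in> pure_central 2" for T h k
      using that by (cases T) (simp add: triple_winding_mult)
    show "m \<in> pure_central 3" if m: "m \<in> pure_central 2" "\<And>T. T \<in> ?Ts \<Longrightarrow> ?lam T m = 0" for m
    proof (rule triple_winding_basis(1)[OF m(1)])
      show "triple_winding m i j k = 0" if "(i, j, k) \<in> increasing_triples" for i j k
        using m(2)[of "(i, j, k)"] that by (simp add: increasing_triples_def)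
    qed
    show "?lam (?act g T) (e g \<otimes> m \<otimes> inv (e g)) = ?lam T m" if g: "g \<in> carrier K" and m: "m \<in> pure_central 2" for g m T
    proof -
      have "m \<in> pure" using m pure_central_mono by blast
      then show ?thesis
        using winding_conj(2)[OF e(1)[OF g], of m] winding_pure_central2[OF m] e(2)[OF g]
        by (cases T) simp
    qed
    show "?act g T \<in> ?Ts" if g: "g \<in> carrier K" and T0: "T \<in> ?Ts" for g T
    proof -
      obtain i j k where T: "T = (i, j, k)" "distinct [i, j, k]" "{i, j, k} \<subseteq> {1..n}" using Ts[OF T0] by blast
      have "distinct [\<iota> g i, \<iota> g j, \<iota> g k]"
        using permutes_inj[OF perm[OF g]] T(2) by (simp add: inj_eq)
      moreover have "{\<iota> g i, \<iota> g j, \<iota> g k} \<subseteq> {1..n}"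
        using T(3) permutes_in_image[OF perm[OF g]] by blast
      ultimately show ?thesis unfolding T by simp
    qed
    show "?act (g \<otimes>\<^bsub>K\<^esub> h) T = ?act g (?act h T)" if "g \<in> carrier K" "h \<in> carrier K" for g h T
      using that by (cases T) (simp add: sym_group_mult)
    show "?act \<one>\<^bsub>K\<^esub> T = T" for T by (cases T) (simp add: sym_group_one)
    show "?\<kappa> T \<in> carrier K" if T0: "T \<in> ?Ts" for T
    proof -
      obtain i j k where T: "T = (i, j, k)" "{i, j, k} \<subseteq> {1..n}" "card {i, j, k} = 3"
        using Ts[OF T0] by blast
      then show ?thesis using \<kappa>(1)[OF T(2,3)] by simp
    qed
    show "?\<kappa> (?act g T) = g \<otimes>\<^bsub>K\<^esub> ?\<kappa> T" if g: "g \<in> carrier K" and T0: "T \<in> ?Ts" for g T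
    proof -
      obtain i j k where T: "T = (i, j, k)" "{i, j, k} \<subseteq> {1..n}" "card {i, j, k} = 3"
        using Ts[OF T0] by blast
      then show ?thesis using \<kappa>(2)[OF g T(2,3)] by simp
    qed
    fix f assume f: "\<And>g. g \<in> carrier K \<Longrightarrow> f g \<in> pure_central 2"
    obtain m where m: "m \<in> pure_central 2" "\<forall>(i, j, k)\<in>increasing_triples.
        triple_winding m i j k = 24 * (triple_winding (f (\<kappa> {i, j, k})) i j k div 24)"
      using triple_winding_basis(2)[of "\<lambda>(i, j, k). triple_winding (f (\<kappa> {i, j, k})) i j k div 24"] by auto
    \<comment> \<open>The basis gives agreement on increasing triples. It spreads to the other
      orders because both sides alternate, the right one since \<open>\<kappa>\<close> depends only
      on the set.\<close>
    define P where "P i j k \<longleftrightarrow> triple_winding m i j k = triple_winding (f (\<kappa> {i, j, k})) i j k" for i j k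
    have "P i j k" if ijk: "distinct [i, j, k]" "{i, j, k} \<subseteq> {1..n}" for i j k
    proof -
      have fk: "f (\<kappa> {i, j, k}) \<in> pure_central 2" if "distinct [i, j, k]" "{i, j, k} \<subseteq> {1..n}" for i j k
        using that by (intro f \<kappa>(1)) auto
      have inc: "P i j k" if "i < j" "j < k" "{i, j, k} \<subseteq> {1..n}" for i j k
      proof -
        have "(i, j, k) \<in> increasing_triples" using that by (simp add: increasing_triples_def)
        moreover have "f (\<kappa> {i, j, k}) \<in> pure_central 2" using fk that by simp
        ultimately show ?thesis unfolding P_def using m(2) triple_winding_alternating(3) by auto
      qed
      have swap: "P j i k" "P i k j" if "P i j k" "distinct [i, j, k]" "{i, j, k} \<subseteq> {1..n}" for i j k
      proof -
        have s: "{j, i, k} = {i, j, k}" "{i, k, j} = {i, j, k}" by auto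
        show "P j i k" "P i k j"
          using that(1) triple_winding_alternating(1,2)[OF fk[OF that(2,3)], of i j k]
            triple_winding_alternating(1,2)[OF m(1), of i j k]
          unfolding P_def s by simp_all
      qed
      consider "i < j" "j < k" | "i < k" "k < j" | "j < i" "i < k" | "j < k" "k < i" | "k < i" "i < j" | "k < j" "j < i"
        using ijk(1) by (auto simp: neq_iff)
      then show ?thesis
      proof cases
        case 1
        then show ?thesis using inc ijk by simp
      next
        case 2
        then show ?thesis using swap(2)[OF inc[of i k j]] ijk by auto
      next
        case 3
        then show ?thesis using swap(1)[OF inc[of j i k]] ijk by auto
      next
        case 4
        then have "P j i k" using swap(2)[OF inc[of j k i]] ijk by auto
        then show ?thesis using swap(1)[of j i k] ijk by auto
      next
        case 5
        then have "P i k j" using swap(1)[OF inc[of k i j]] ijk by auto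
        then show ?thesis using swap(2)[of i k j] ijk by auto
      next
        case 6
        then have "P j k i" using swap(1)[OF inc[of k j i]] ijk by auto
        then have "P j i k" using swap(2)[of j k i] ijk by auto
        then show ?thesis using swap(1)[of j i k] ijk by auto
      qed
    qed
    then show "\<exists>m\<in>pure_central 2. \<forall>T\<in>?Ts. ?lam T m = ?lam T (f (?\<kappa> T))"
      using m(1) unfolding P_def by (intro bexI[of _ m]) auto
  qed
  then obtain e' where e': "\<And>g. g \<in> carrier K \<Longrightarrow> e' g \<in> carrier B \<and> e' g \<otimes> inv (e g) \<in> pure_central 2"
    "\<forall>g\<in>carrier K. \<forall>h\<in>carrier K. e' g \<otimes> e' h \<otimes> inv (e' (g \<otimes>\<^bsub>K\<^esub> h)) \<in> pure_central 3"
    by blast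
  have "\<rho> (e' g) = \<iota> g" if "g \<in> carrier K" for g
    using perm_eq_of_pure[of "e' g" "e g"] e'(1)[OF that] e[OF that] subsetD[OF pure_central_mono(1)] by simp
  then show ?thesis using e' by blast
qed

text \<open>The lift is multiplicative modulo \<open>N\<close>. Since \<open>N\<close> consists of
  pure braids, the coset still determines the permutation, and injectivity of \<open>\<iota>\<close>
  carries over.\<close>

lemma lift_embeds:
  fixes K :: "('k, 'm) monoid_scheme"
  assumes N: "N \<lhd> B" "N \<subseteq> pure" and inj: "inj_on \<iota> (carrier K)"
    and lift: "\<exists>e. (\<forall>g\<in>carrier K. e g \<in> carrier B \<and> \<rho> (e g) = \<iota> g) \<and>
      (\<forall>g\<in>carrier K. \<forall>h\<in>carrier K. e g \<otimes> e h \<otimes> inv (e (g \<otimes>\<^bsub>K\<^esub> h)) \<in> N)" and K: "group K"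
  shows "embeds_in K (B Mod N)"
proof -
  interpret N: normal N B by fact
  interpret K: group K by fact
  obtain e where e: "\<And>g. g \<in> carrier K \<Longrightarrow> e g \<in> carrier B" "\<And>g. g \<in> carrier K \<Longrightarrow> \<rho> (e g) = \<iota> g"
    and eN: "\<And>g h. g \<in> carrier K \<Longrightarrow> h \<in> carrier K \<Longrightarrow> e g \<otimes> e h \<otimes> inv (e (g \<otimes>\<^bsub>K\<^esub> h)) \<in> N"
    using lift by blast
  interpret q: group_hom B "B Mod N" "\<lambda>b. N #> b"
    using N.r_coset_hom_Mod N.factorgroup_is_group
    by (simp add: group_hom_def group_hom_axioms_def is_group)
  have "(\<lambda>g. N #> e g) \<in> hom K (B Mod N)"
  proof (rule homI)
    show "N #> e g \<in> carrier (B Mod N)" if "g \<in> carrier K" for g using q.hom_closed[OF e(1)[OF that]] .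
    fix g h assume gh: "g \<in> carrier K" "h \<in> carrier K"
    have c: "e g \<otimes> e h \<in> carrier B" "e (g \<otimes>\<^bsub>K\<^esub> h) \<in> carrier B" using gh e by auto
    have "e g \<otimes> e h \<in> N #> e (g \<otimes>\<^bsub>K\<^esub> h)"
      using N.rcos_module[OF is_group c(2,1)] eN[OF gh] by simp
    then have "N #> e (g \<otimes>\<^bsub>K\<^esub> h) = N #> (e g \<otimes> e h)"
      by (rule repr_independence[OF _ c(2) N.subgroup_axioms])
    then show "N #> e (g \<otimes>\<^bsub>K\<^esub> h) = (N #> e g) \<otimes>\<^bsub>B Mod N\<^esub> (N #> e h)"
      using q.hom_mult[OF e(1)[OF gh(1)] e(1)[OF gh(2)]] by simp
  qed
  moreover have "inj_on (\<lambda>g. N #> e g) (carrier K)"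
  proof (rule inj_onI)
    fix g h assume gh: "g \<in> carrier K" "h \<in> carrier K" "N #> e g = N #> e h"
    then have "e g \<in> N #> e h" using rcos_self[OF e(1)[OF gh(1)] N.subgroup_axioms] by simp
    then have "e g \<otimes> inv (e h) \<in> N"
      using N.rcos_module[OF is_group e(1)[OF gh(2)] e(1)[OF gh(1)]] by simp
    then have "\<rho> (e g) = \<rho> (e h)" using N(2) gh by (intro perm_eq_of_pure e(1)) auto
    then show "g = h" using gh e(2) inj by (simp add: inj_on_def)
  qed
  ultimately show ?thesis unfolding embeds_in_def mon_def by blast
qed

end

section \<open>Embedding groups of order prime to 2 or 6\<close>

lemma artin_braids_braid_group:
  assumes "3 \<le> n"
  shows "artin_braids (braid_group n) n (braid_gen n) (braid_perm n) (presented_hom (chord_group n) chord_gen)"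
proof -
  let ?B = "braid_group n" and ?S = "{1..<n}" and ?R = "braid_relations n"
  let ?c = "\<lambda>w. word_cong ?S ?R `` {w}"
  interpret group ?B by (rule group_braid_group)
  have mult: "?c u \<otimes>\<^bsub>?B\<^esub> ?c v = ?c (u @ v)" if "u \<in> words ?S" "v \<in> words ?S" for u v
    unfolding braid_group_def using that by (rule presented_mult)
  have carrierI: "?c w \<in> carrier ?B" if "w \<in> words ?S" for w
    unfolding braid_group_def using that by (rule presented_carrierI)
  have one: "\<one>\<^bsub>?B\<^esub> = ?c []" by (simp add: braid_group_def presented_one)
  have rel: "?c u = ?c v" if "(u, v) \<in> ?R" "u \<in> words ?S" "v \<in> words ?S" for u v
    using equiv_class_eq[OF equiv_word_cong word_cong.rel[OF that]] .
  have gen: "braid_gen n i = ?c [(i, True)]" for i by (simp add: braid_gen_def)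
  have gen_closed: "braid_gen n i \<in> carrier ?B" if "i \<in> ?S" for i
    unfolding gen using that by (intro carrierI) auto
  have sub: "braid_gen n ` ?S \<subseteq> carrier ?B" using gen_closed by auto
  have word_gen: "?c w \<in> generate ?B (braid_gen n ` ?S)" if "w \<in> words ?S" for w
    using that
  proof (induction w)
    case Nil
    show ?case using generate.one[of ?B] by (simp add: one)
  next
    case (Cons a w)
    obtain x b where a: "a = (x, b)" by (cases a)
    have x: "x \<in> ?S" and w: "w \<in> words ?S" using Cons a by auto
    have pos: "[(x, True)] \<in> words ?S" and neg: "[(x, False)] \<in> words ?S" using x by auto
    have letter: "?c [(x, b)] \<in> generate ?B (braid_gen n ` ?S)"
    proof (cases b)
      case True
      then show ?thesis unfolding gen[symmetric] using x by (auto intro!: generate.incl simp flip: gen)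
    next
      case False
      have "?c [(x, False)] \<otimes>\<^bsub>?B\<^esub> ?c [(x, True)] = \<one>\<^bsub>?B\<^esub>"
        unfolding mult[OF neg pos] one
        using equiv_class_eq[OF equiv_word_cong word_cong.cancel[OF x, of False]] by simp
      then have "inv\<^bsub>?B\<^esub> (?c [(x, True)]) = ?c [(x, False)]"
        using carrierI pos neg by (intro inv_equality) auto
      then show ?thesis using False x generate.inv[of "braid_gen n x" "braid_gen n ` ?S" ?B] by (auto simp: gen)
    qed
    have "?c (a # w) = ?c [(x, b)] \<otimes>\<^bsub>?B\<^esub> ?c w" using mult[of "[(x, b)]" w] x w a by auto
    then show ?case using generate.eng[OF letter Cons.IH] w by simp
  qed
  have chord_closed: "chord_gen \<in> ?S \<rightarrow> carrier (chord_group n)"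
    by (auto simp: chord_gen_def chord_group_def intro!: permutes_swap_id)
  \<comment> \<open>\<open>word_eval\<close> ends every product with the unit, which must be removed
    before the relations of \<open>chord_gen\<close> apply.\<close>
  have chord_closed': "chord_gen i \<otimes>\<^bsub>chord_group n\<^esub> \<one>\<^bsub>chord_group n\<^esub> = chord_gen i" if "i \<in> ?S" for i
    using chord_closed that by (intro monoid.r_one group.is_monoid group_chord_group) auto
  have chord_rel: "\<forall>(u, v)\<in>?R. word_eval (chord_group n) chord_gen u = word_eval (chord_group n) chord_gen v"
    unfolding braid_relations_def
    by (auto simp: chord_closed' chord_gen_braid[simplified] intro: chord_gen_commute)
  show ?thesis
  proof
    show "carrier ?B = generate ?B (braid_gen n ` ?S)"
    proof
      show "carrier ?B \<subseteq> generate ?B (braid_gen n ` ?S)"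
        using word_gen unfolding braid_group_def[of n] by (auto elim!: presented_carrierE)
      show "generate ?B (braid_gen n ` ?S) \<subseteq> carrier ?B" using generate_incl[OF sub] .
    qed
    show "braid_gen n i \<otimes>\<^bsub>?B\<^esub> braid_gen n j = braid_gen n j \<otimes>\<^bsub>?B\<^esub> braid_gen n i"
      if "i \<in> ?S" "j \<in> ?S" "i + 2 \<le> j" for i j
    proof -
      have "(pos_word [i, j], pos_word [j, i]) \<in> ?R" unfolding braid_relations_def using that by auto
      then have "?c (pos_word [i, j]) = ?c (pos_word [j, i])" using that by (intro rel) auto
      then show ?thesis unfolding gen using that by (simp add: mult)
    qed
    show "braid_gen n i \<otimes>\<^bsub>?B\<^esub> braid_gen n (i + 1) \<otimes>\<^bsub>?B\<^esub> braid_gen n i =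
        braid_gen n (i + 1) \<otimes>\<^bsub>?B\<^esub> braid_gen n i \<otimes>\<^bsub>?B\<^esub> braid_gen n (i + 1)"
      if "1 \<le> i" "i + 2 \<le> n" for i
    proof -
      have "(pos_word [i, i + 1, i], pos_word [i + 1, i, i + 1]) \<in> ?R"
        unfolding braid_relations_def using that by blast
      then have "?c (pos_word [i, i + 1, i]) = ?c (pos_word [i + 1, i, i + 1])" using that by (intro rel) auto
      then show ?thesis unfolding gen using that by (simp add: mult)
    qed
    show "presented_hom (chord_group n) chord_gen \<in> hom ?B (chord_group n)"
      unfolding braid_group_def by (rule presented_hom_hom[OF group_chord_group chord_closed chord_rel])
    show "presented_hom (chord_group n) chord_gen (braid_gen n i) = chord_gen i" if "i \<in> ?S" for i
      unfolding gen using that chord_closed'[OF that]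
      by (subst presented_hom_class[OF group_chord_group chord_closed chord_rel]) auto
  qed (use assms gen_closed braid_perm_hom braid_perm_gen in auto)
qed

theorem free_action_embeds:
  fixes K :: "('k, 'm) monoid_scheme"
  assumes n: "3 \<le> n" and K: "group K" and \<iota>: "\<iota> \<in> hom K (sym_group n)" "inj_on \<iota> (carrier K)"
  shows "(\<And>g T. g \<in> carrier K \<Longrightarrow> T \<subseteq> {1..n} \<Longrightarrow> card T = 2 \<Longrightarrow> \<iota> g ` T = T \<Longrightarrow> g = \<one>\<^bsub>K\<^esub>) \<Longrightarrow>
      embeds_in K (braid_group n Mod lower_central (pure_braid_group n) 2)"
    and "(\<And>g T m. g \<in> carrier K \<Longrightarrow> T \<subseteq> {1..n} \<Longrightarrow> m \<in> {2, 3} \<Longrightarrow> card T = m \<Longrightarrow> \<iota> g ` T = T \<Longrightarrow> g = \<one>\<^bsub>K\<^esub>) \<Longrightarrow>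
      embeds_in K (braid_group n Mod lower_central (pure_braid_group n) 3)"
proof -
  interpret artin_braids "braid_group n" n "braid_gen n" "braid_perm n" "presented_hom (chord_group n) chord_gen"
    using n by (rule artin_braids_braid_group)
  have P: "pure_braid_group n = braid_group n\<lparr>carrier := pure\<rparr>"
    by (simp add: pure_braid_group_def pure_def)
  show "embeds_in K (braid_group n Mod lower_central (pure_braid_group n) 2)"
    if "\<And>g T. g \<in> carrier K \<Longrightarrow> T \<subseteq> {1..n} \<Longrightarrow> card T = 2 \<Longrightarrow> \<iota> g ` T = T \<Longrightarrow> g = \<one>\<^bsub>K\<^esub>"
    unfolding P
    by (rule lift_embeds[OF pure_central_normal pure_central_mono(1) \<iota>(2) lift_mod_pure_central2[OF K \<iota>(1) that] K])
  show "embeds_in K (braid_group n Mod lower_central (pure_braid_group n) 3)"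
    if "\<And>g T m. g \<in> carrier K \<Longrightarrow> T \<subseteq> {1..n} \<Longrightarrow> m \<in> {2, 3} \<Longrightarrow> card T = m \<Longrightarrow> \<iota> g ` T = T \<Longrightarrow> g = \<one>\<^bsub>K\<^esub>"
    unfolding P
    by (rule lift_embeds[OF pure_central_normal subset_trans[OF pure_central_mono(2) pure_central_mono(1)] \<iota>(2)
      lift_mod_pure_central3[OF K \<iota>(1) that] K])
qed

text \<open>The numbers 2 and 6 are the exponents of the symmetric groups on two and three
  letters.\<close>

lemma stabilizer_power:
  assumes f: "inj f" and T: "f ` T = T" and x: "x \<in> T"
  shows "card T = 2 \<Longrightarrow> (f ^^ 2) x = x" and "card T = 3 \<Longrightarrow> (f ^^ 6) x = x"
proof -
  show "(f ^^ 2) x = x" if "card T = 2"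
  proof -
    obtain a b where ab: "T = {a, b}" "a \<noteq> b" using \<open>card T = 2\<close> by (auto simp: card_2_iff)
    have "f a \<in> {a, b}" "f b \<in> {a, b}" "f a \<noteq> f b" using T ab inj_eq[OF f] by auto
    then show ?thesis using x ab by (auto simp: numeral_2_eq_2)
  qed
  show "(f ^^ 6) x = x" if "card T = 3"
  proof -
    obtain a b c where abc: "T = {a, b, c}" "a \<noteq> b" "b \<noteq> c" "a \<noteq> c"
      using \<open>card T = 3\<close> by (auto simp: card_3_iff)
    have mem: "f a \<in> {a, b, c}" "f b \<in> {a, b, c}" "f c \<in> {a, b, c}" using T abc by blast+
    have "f a \<noteq> f b" "f b \<noteq> f c" "f a \<noteq> f c" using abc inj_eq[OF f] by auto
    moreover have "(f ^^ 6) x = f (f (f (f (f (f x)))))" by (simp add: numeral_eq_Suc)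
    ultimately show ?thesis using x mem unfolding abc(1) by (elim insertE emptyE) simp_all
  qed
qed

text \<open>If \<open>g\<close> stabilises a set of two or three points, then its square or its
  sixth power fixes at least two points, hence is trivial. Coprimality to the order of the group
  then makes \<open>g\<close> itself trivial.\<close>

theorem coprime_order_embeds:
  fixes K :: "('k, 'm) monoid_scheme"
  assumes n: "3 \<le> n" and K: "group K" and \<iota>: "\<iota> \<in> hom K (sym_group n)"
    and fixes_two: "\<And>g i j. g \<in> carrier K \<Longrightarrow> i \<in> {1..n} \<Longrightarrow> j \<in> {1..n} \<Longrightarrow> i \<noteq> j \<Longrightarrow>
      \<iota> g i = i \<Longrightarrow> \<iota> g j = j \<Longrightarrow> g = \<one>\<^bsub>K\<^esub>"
  shows "coprime (order K) 2 \<Longrightarrow> embeds_in K (braid_group n Mod lower_central (pure_braid_group n) 2)"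
    and "coprime (order K) 6 \<Longrightarrow> embeds_in K (braid_group n Mod lower_central (pure_braid_group n) 3)"
proof -
  interpret K: group K by fact
  interpret \<iota>: group_hom K "sym_group n" \<iota>
    using K \<iota> by (simp add: group_hom_def group_hom_axioms_def sym_group_is_group)
  have perm: "\<iota> g permutes {1..n}" if "g \<in> carrier K" for g
    using \<iota>.hom_closed[OF that] by (simp add: sym_group_carrier)
  have inj: "inj_on \<iota> (carrier K)"
    using fixes_two[of _ 1 2] n unfolding \<iota>.inj_on_one_iff by (simp add: sym_group_one)
  have pow: "\<iota> (g [^]\<^bsub>K\<^esub> k) = \<iota> g ^^ k" if "g \<in> carrier K" for g and k :: nat
    using that by (induction k) (simp_all add: sym_group_one sym_group_mult funpow_swap1 fun_eq_iff)
  have coprime_pow: "g = \<one>\<^bsub>K\<^esub>" if "g \<in> carrier K" "g [^]\<^bsub>K\<^esub> k = \<one>\<^bsub>K\<^esub>" "coprime (order K) k" for g and k :: nat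
  proof -
    have "K.ord g dvd k" "K.ord g dvd order K"
      using that K.pow_eq_id K.ord_dvd_group_order by auto
    then have "K.ord g = 1" using that(3) by (metis coprime_common_divisor_nat)
    then show ?thesis using K.ord_eq_1[OF that(1)] by simp
  qed
  have fixed_pow: "g [^]\<^bsub>K\<^esub> k = \<one>\<^bsub>K\<^esub>"
    if "g \<in> carrier K" "T \<subseteq> {1..n}" "2 \<le> card T" "\<And>x. x \<in> T \<Longrightarrow> (\<iota> g ^^ k) x = x" for g T and k :: nat
  proof -
    obtain i j where "i \<in> T" "j \<in> T" "i \<noteq> j"
      using \<open>2 \<le> card T\<close> by (metis One_nat_def Suc_1 card_le_Suc0_iff_eq card.infinite not_less_eq_eq zero_le nat_le_linear not_numeral_le_zero)
    then show ?thesis using that pow[OF that(1)] by (intro fixes_two[of _ i j]) auto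
  qed
  have free2: "g = \<one>\<^bsub>K\<^esub>" if "coprime (order K) 2" "g \<in> carrier K" "T \<subseteq> {1..n}" "card T = 2" "\<iota> g ` T = T" for g T
    using that stabilizer_power(1)[OF permutes_inj[OF perm]]
    by (intro coprime_pow[of g 2] fixed_pow[of g T]) auto
  have free3: "g = \<one>\<^bsub>K\<^esub>" if "coprime (order K) 6" "g \<in> carrier K" "T \<subseteq> {1..n}" "card T = 3" "\<iota> g ` T = T" for g T
    using that stabilizer_power(2)[OF permutes_inj[OF perm]]
    by (intro coprime_pow[of g 6] fixed_pow[of g T]) auto
  show "embeds_in K (braid_group n Mod lower_central (pure_braid_group n) 2)" if "coprime (order K) 2"
    using free2[OF that] by (rule free_action_embeds(1)[OF n K \<iota> inj])
  show "embeds_in K (braid_group n Mod lower_central (pure_braid_group n) 3)" if 6: "coprime (order K) 6"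
  proof (rule free_action_embeds(2)[OF n K \<iota> inj])
    have 2: "coprime (order K) 2" using 6 coprime_mult_right_iff[of "order K" 2 3] by simp
    show "g = \<one>\<^bsub>K\<^esub>" if "g \<in> carrier K" "T \<subseteq> {1..n}" "m \<in> {2, 3}" "card T = m" "\<iota> g ` T = T" for g T m
      using that free2[OF 2] free3[OF 6] by auto
  qed
qed

section \<open>Affine actions on cyclic groups\<close>

text \<open>Factor \<open>u ^ d - 1\<close> as \<open>u - 1\<close> times the sum of the powers of
  \<open>u\<close>. That sum is congruent to \<open>d\<close> modulo \<open>p\<close>, hence prime
  to \<open>p\<close>, so the whole power of \<open>p\<close> divides \<open>u - 1\<close>.\<close>

lemma cong_one_of_power_cong_one:
  fixes u :: int and p d r :: nat
  assumes p: "Factorial_Ring.prime p" and d: "\<not> p dvd d"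
    and u: "int p dvd u - 1" and ud: "int (p ^ r) dvd u ^ d - 1"
  shows "int (p ^ r) dvd u - 1"
proof -
  let ?S = "\<Sum>i<d. u ^ i"
  have pi: "Factorial_Ring.prime (int p)" using p by simp
  have "int p dvd u ^ i - 1" for i
    using u unfolding power_diff_1_eq by (rule dvd_mult2)
  then have "int p dvd (\<Sum>i<d. u ^ i - 1)" by (intro dvd_sum)
  then have "int p dvd ?S - int d" by (simp add: sum_subtractf)
  then have "\<not> int p dvd ?S" using d by (metis dvd_diff_right_iff int_dvd_int_iff dvd_diff_commute)
  then have "coprime (int p) ?S" using pi by (simp add: prime_imp_coprime)
  then have "coprime (int (p ^ r)) ?S" by simp
  moreover have "int (p ^ r) dvd (u - 1) * ?S" using ud unfolding power_diff_1_eq .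
  ultimately show ?thesis by (simp add: coprime_dvd_mult_left_iff)
qed

locale affine_action =
  fixes p r d :: nat and \<theta> :: "int \<Rightarrow> int \<Rightarrow> int" and n
  assumes p: "Factorial_Ring.prime p" and r: "r \<ge> 1" and d: "0 < d" "\<not> p dvd d"
    and n: "n = p ^ r"
    and hom: "\<theta> \<in> hom (integer_mod_group d) (AutoGroup (integer_mod_group n))"
    and inj: "inj_on \<theta> (carrier (integer_mod_group d))"
begin

abbreviation "N \<equiv> integer_mod_group n"
abbreviation "H \<equiv> integer_mod_group d"
abbreviation "K \<equiv> semidirect_product N H \<theta>"

lemma n_gt: "1 < n"
  using p r prime_gt_1_nat[OF p] unfolding n by (simp add: one_less_power)

lemma carrier: "carrier N = {0..<int n}" "carrier H = {0..<int d}"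
  using n_gt d by (simp_all add: carrier_integer_mod_group)

lemma group_K: "group K"
  using hom by (intro group_semidirect_product) auto

lemma theta_closed: "x \<in> carrier H \<Longrightarrow> z \<in> carrier N \<Longrightarrow> \<theta> x z \<in> carrier N"
  and theta_hom: "x \<in> carrier H \<Longrightarrow> \<theta> x \<in> hom N N"
proof -
  show *: "\<theta> x \<in> hom N N" if "x \<in> carrier H" for x
    using hom_in_carrier[OF hom that] by (simp add: AutoGroup_def auto_def)
  show "\<theta> x z \<in> carrier N" if "x \<in> carrier H" "z \<in> carrier N" for x z
    using hom_in_carrier[OF *[OF that(1)] that(2)] .
qed

lemma theta_add:
  assumes "x \<in> carrier H" "z \<in> carrier N" "w \<in> carrier N"
  shows "\<theta> x ((z + w) mod int n) = (\<theta> x z + \<theta> x w) mod int n"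
  using hom_mult[OF theta_hom[OF assms(1)] assms(2,3)] by simp

lemma theta_mult:
  assumes "x \<in> carrier H" "y \<in> carrier H" "z \<in> carrier N"
  shows "\<theta> (x \<otimes>\<^bsub>H\<^esub> y) z = \<theta> x (\<theta> y z)"
proof -
  have "\<theta> x \<in> Bij (carrier N)" "\<theta> y \<in> Bij (carrier N)"
    using hom_in_carrier[OF hom] assms by (auto simp: AutoGroup_def auto_def)
  then show ?thesis
    using hom_mult[OF hom assms(1,2)] assms(3) by (simp add: AutoGroup_def BijGroup_def compose_def)
qed

lemma theta_zero: "z \<in> carrier N \<Longrightarrow> \<theta> 0 z = z"
proof -
  interpret T: group_hom H "AutoGroup N" \<theta>
    using hom group.AutoGroup[of N] by (simp add: group_hom_def group_hom_axioms_def)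
  show "z \<in> carrier N \<Longrightarrow> \<theta> 0 z = z"
    using T.hom_one by (simp add: AutoGroup_def BijGroup_def)
qed

text \<open>An endomorphism of a cyclic group is determined by the image of its generator;
  \<open>\<theta> x 1\<close> is the multiplier of \<open>x\<close>.\<close>

lemma theta_linear:
  assumes x: "x \<in> carrier H" and z: "z \<in> carrier N"
  shows "\<theta> x z = (z * \<theta> x 1) mod int n"
proof -
  interpret t: group_hom N N "\<theta> x"
    using theta_hom[OF x] by (simp add: group_hom_def group_hom_axioms_def)
  have "(1 :: int) [^]\<^bsub>N\<^esub> nat z = z"
    using z by (simp add: carrier)
  moreover have "\<theta> x (1 [^]\<^bsub>N\<^esub> nat z) = \<theta> x 1 [^]\<^bsub>N\<^esub> nat z"
    using n_gt by (intro t.hom_nat_pow) simp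
  ultimately show ?thesis using z by (simp add: carrier)
qed

lemma theta_power:
  assumes x: "x \<in> carrier H"
  shows "\<theta> (x [^]\<^bsub>H\<^esub> k) 1 = (\<theta> x 1) ^ k mod int n"
proof (induction k)
  case 0
  then show ?case using theta_zero[of 1] n_gt by (simp add: carrier)
next
  case (Suc k)
  interpret H: group H by simp
  have k: "x [^]\<^bsub>H\<^esub> k \<in> carrier H" using x by (rule H.nat_pow_closed)
  have 1: "1 \<in> carrier N" using n_gt by (simp add: carrier)
  have "\<theta> (x [^]\<^bsub>H\<^esub> Suc k) 1 = \<theta> (x [^]\<^bsub>H\<^esub> k) (\<theta> x 1)"
    using theta_mult[OF k x 1] by (simp only: H.nat_pow_Suc)
  also have "\<dots> = (\<theta> x 1 * \<theta> (x [^]\<^bsub>H\<^esub> k) 1) mod int n"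
    by (rule theta_linear[OF k theta_closed[OF x 1]])
  finally show ?case unfolding Suc by (simp add: mod_mult_right_eq)
qed

text \<open>Subtracting the two fixed point equations shows that \<open>n\<close> divides
  \<open>(u - 1) * (z - w)\<close>, where \<open>u\<close> is the multiplier of \<open>x\<close>.
  This forces \<open>u = 1\<close>; then \<open>a = 0\<close>, and injectivity of
  \<open>\<theta>\<close> gives \<open>x = 0\<close>.\<close>

lemma fixes_two_imp_one:
  assumes a: "a \<in> carrier N" and x: "x \<in> carrier H"
    and z: "z \<in> carrier N" "(a + \<theta> x z) mod int n = z"
    and w: "w \<in> carrier N" "(a + \<theta> x w) mod int n = w" and "z \<noteq> w"
  shows "a = 0" "x = 0"
proof -
  define u where "u = \<theta> x 1"
  have 1: "1 \<in> carrier N" using n_gt by (simp add: carrier)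
  have u: "0 \<le> u" "u < int n" using theta_closed[OF x 1] by (simp_all add: u_def carrier)
  have lin: "\<theta> x y = (y * u) mod int n" if "y \<in> carrier N" for y
    unfolding u_def using theta_linear[OF x that] .
  have dvd: "int n dvd a + y * u - y" if "y \<in> carrier N" "(a + \<theta> x y) mod int n = y" for y
  proof -
    have "(a + y * u) mod int n = y" using that lin[OF that(1)] by (simp add: mod_add_right_eq)
    then show ?thesis by (metis dvd_minus_mod)
  qed
  have "int n dvd (a + z * u - z) - (a + w * u - w)"
    using dvd[OF z] dvd[OF w] by (rule dvd_diff)
  then have zw: "int n dvd (u - 1) * (z - w)" by (simp add: algebra_simps)
  \<comment> \<open>Otherwise \<open>u - 1\<close> is a unit modulo \<open>n\<close> and the two
    fixed points coincide.\<close>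
  have "int p dvd u - 1"
  proof (rule ccontr)
    assume "\<not> int p dvd u - 1"
    then have "coprime (int p) (u - 1)" using p by (simp add: prime_imp_coprime)
    then have "coprime (int n) (u - 1)" by (simp add: n)
    then have "int n dvd z - w" using zw by (simp add: coprime_dvd_mult_right_iff)
    moreover have "\<bar>z - w\<bar> < int n" using z(1) w(1) by (auto simp: carrier)
    ultimately show False using \<open>z \<noteq> w\<close> dvd_imp_le_int[of "z - w" "int n"] by simp
  qed
  moreover have "int n dvd u ^ d - 1"
  proof -
    have "x [^]\<^bsub>H\<^esub> d = 0" by simp
    then have "u ^ d mod int n = 1"
      using theta_power[OF x, of d] theta_zero[OF 1] by (simp add: u_def)
    then show ?thesis by (metis dvd_minus_mod)
  qed
  ultimately have "int n dvd u - 1"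
    using cong_one_of_power_cong_one[OF p d(2), of u r] by (simp add: n)
  have u1: "u = 1"
  proof (rule ccontr)
    assume "u \<noteq> 1"
    show False
    \<comment> \<open>The bound on a multiple of \<open>n\<close> needs \<open>u - 1\<close>
      positive, so the representative 0 is treated apart.\<close>
    proof (cases "u = 0")
      case True
      then have "int n dvd 1" using \<open>int n dvd u - 1\<close> by simp
      then show False using n_gt by simp
    next
      case False
      then show False using \<open>int n dvd u - 1\<close> \<open>u \<noteq> 1\<close> u zdvd_imp_le[of "int n" "u - 1"] by auto
    qed
  qed
  have "int n dvd a" using dvd[OF z] u1 by simp
  then show "a = 0" using a dvd_imp_le_int[of a "int n"] by (cases "a = 0") (auto simp: carrier)
  \<comment> \<open>Elements of \<open>AutoGroup\<close> are normalised outside the carrier, so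
    agreement on it gives equality of functions, as injectivity of \<open>\<theta>\<close>
    demands.\<close>
  have "\<theta> x \<in> extensional (carrier N)" "\<theta> 0 \<in> extensional (carrier N)"
    using hom_in_carrier[OF hom] x d by (auto simp: AutoGroup_def auto_def Bij_def)
  moreover have "\<theta> x y = \<theta> 0 y" if "y \<in> carrier N" for y
    using lin[OF that] u1 theta_zero[OF that] that by (simp add: carrier)
  ultimately have "\<theta> x = \<theta> 0" by (intro extensionalityI)
  then show "x = 0" using inj x d by (auto dest!: inj_onD[of \<theta> _ x 0])
qed

text \<open>Strings are numbered from 1 and residues from 0, so string \<open>k\<close> stands for
  the residue \<open>k - 1\<close>. Numbers outside the range are fixed because elements of
  \<open>sym_group\<close> are functions on all naturals.\<close>

definition shift_perm :: "int \<times> int \<Rightarrow> nat \<Rightarrow> nat"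
  where "shift_perm g k =
    (if k \<in> {1..n} then nat ((fst g + \<theta> (snd g) (int k - 1)) mod int n) + 1 else k)"

lemma shift_perm_in:
  assumes "k \<in> {1..n}"
  shows "shift_perm g k \<in> {1..n}" "int (shift_perm g k) - 1 = (fst g + \<theta> (snd g) (int k - 1)) mod int n"
proof -
  define v where "v = (fst g + \<theta> (snd g) (int k - 1)) mod int n"
  have "0 \<le> v" "v < int n" using n_gt by (simp_all add: v_def)
  moreover have "shift_perm g k = nat v + 1" using assms by (simp add: shift_perm_def v_def)
  ultimately show "shift_perm g k \<in> {1..n}" "int (shift_perm g k) - 1 = (fst g + \<theta> (snd g) (int k - 1)) mod int n"
    by (auto simp: v_def[symmetric])
qed

lemma shift_perm_mult:
  assumes g: "g \<in> carrier K" and h: "h \<in> carrier K"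
  shows "shift_perm (g \<otimes>\<^bsub>K\<^esub> h) = shift_perm g \<circ> shift_perm h"
proof
  fix k
  obtain a x where gx: "g = (a, x)" "a \<in> carrier N" "x \<in> carrier H" using g by (auto simp: semidirect_product_def)
  obtain b y where hy: "h = (b, y)" "b \<in> carrier N" "y \<in> carrier H" using h by (auto simp: semidirect_product_def)
  have gh: "g \<otimes>\<^bsub>K\<^esub> h = ((a + \<theta> x b) mod int n, x \<otimes>\<^bsub>H\<^esub> y)"
    unfolding gx hy by (simp add: semidirect_product_def)
  show "shift_perm (g \<otimes>\<^bsub>K\<^esub> h) k = (shift_perm g \<circ> shift_perm h) k"
  proof (cases "k \<in> {1..n}")
    case True
    define z where "z = int k - 1"
    have z: "z \<in> carrier N" using True by (auto simp: z_def carrier)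
    have yz: "\<theta> y z \<in> carrier N" using theta_closed[OF hy(3) z] .
    have k': "int (shift_perm h k) - 1 = (b + \<theta> y z) mod int n"
      using shift_perm_in(2)[OF True, of h] by (simp add: hy z_def)
    have "int (shift_perm g (shift_perm h k)) - 1 = (a + \<theta> x ((b + \<theta> y z) mod int n)) mod int n"
      using shift_perm_in(2)[OF shift_perm_in(1)[OF True, of h], of g] by (simp only: k' gx fst_conv snd_conv)
    also have "\<dots> = (a + (\<theta> x b + \<theta> x (\<theta> y z))) mod int n"
      unfolding theta_add[OF gx(3) hy(2) yz] by (simp add: mod_add_right_eq)
    also have "\<dots> = ((a + \<theta> x b) mod int n + \<theta> (x \<otimes>\<^bsub>H\<^esub> y) z) mod int n"
      unfolding theta_mult[OF gx(3) hy(3) z] by (simp add: mod_add_left_eq add.assoc)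
    also have "\<dots> = int (shift_perm (g \<otimes>\<^bsub>K\<^esub> h) k) - 1"
      using shift_perm_in(2)[OF True, of "g \<otimes>\<^bsub>K\<^esub> h"] by (simp only: gh z_def fst_conv snd_conv)
    finally show ?thesis by simp
  next
    case False
    then show ?thesis by (auto simp: shift_perm_def)
  qed
qed

lemma shift_perm_one: "shift_perm \<one>\<^bsub>K\<^esub> = id"
proof
  fix k
  show "shift_perm \<one>\<^bsub>K\<^esub> k = id k"
    by (auto simp: shift_perm_def semidirect_product_def theta_zero carrier)
qed

lemma shift_perm_hom: "shift_perm \<in> hom K (sym_group n)"
proof (rule homI)
  interpret K: group K by (rule group_K)
  fix g assume g: "g \<in> carrier K"
  have "shift_perm (inv\<^bsub>K\<^esub> g) \<circ> shift_perm g = id" "shift_perm g \<circ> shift_perm (inv\<^bsub>K\<^esub> g) = id"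
    using g by (simp_all flip: shift_perm_mult add: shift_perm_one)
  then have "bij (shift_perm g)" by (rule o_bij)
  moreover have "shift_perm g k = k" if "k \<notin> {1..n}" for k using that by (auto simp: shift_perm_def)
  ultimately show "shift_perm g \<in> carrier (sym_group n)"
    by (auto simp: sym_group_carrier permutes_def bij_iff)
next
  fix g h assume "g \<in> carrier K" "h \<in> carrier K"
  then show "shift_perm (g \<otimes>\<^bsub>K\<^esub> h) = shift_perm g \<otimes>\<^bsub>sym_group n\<^esub> shift_perm h"
    by (simp add: shift_perm_mult sym_group_mult)
qed

lemma shift_perm_fixes_two:
  assumes g: "g \<in> carrier K" and ij: "i \<in> {1..n}" "j \<in> {1..n}" "i \<noteq> j"
    and fixed: "shift_perm g i = i" "shift_perm g j = j"
  shows "g = \<one>\<^bsub>K\<^esub>"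
proof -
  obtain a x where gx: "g = (a, x)" "a \<in> carrier N" "x \<in> carrier H" using g by (auto simp: semidirect_product_def)
  have c: "int i - 1 \<in> carrier N" "int j - 1 \<in> carrier N" using ij by (auto simp: carrier)
  have "(a + \<theta> x (int i - 1)) mod int n = int i - 1" "(a + \<theta> x (int j - 1)) mod int n = int j - 1"
    using shift_perm_in(2)[OF ij(1), of g] shift_perm_in(2)[OF ij(2), of g] fixed by (simp_all add: gx)
  from fixes_two_imp_one[OF gx(2,3) c(1) this(1) c(2) this(2)] ij(3)
  show ?thesis by (simp add: gx semidirect_product_def)
qed

lemma order_K: "order K = n * d"
  by (simp add: order_def semidirect_product_def carrier card_cartesian_product)

end

theorem corollary4:
  fixes p r j d d\<^sub>1 :: nat
    and \<theta> :: "int \<Rightarrow> int \<Rightarrow> int"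
    and G :: "('g, 'm) monoid_scheme"
  assumes "Factorial_Ring.prime p" and "odd p"
    and "r \<ge> 1"
    and "p - 1 = 2 ^ j * d" and "odd d"
    and "d\<^sub>1 dvd d"
    and "\<theta> \<in> hom (integer_mod_group d\<^sub>1) (AutoGroup (integer_mod_group (p ^ r)))"
    and "inj_on \<theta> (carrier (integer_mod_group d\<^sub>1))"
    and "group G"
    and "G \<cong> semidirect_product (integer_mod_group (p ^ r)) (integer_mod_group d\<^sub>1) \<theta>"
  shows "(p \<ge> 3 \<longrightarrow>
            embeds_in G (braid_group (p ^ r) Mod lower_central (pure_braid_group (p ^ r)) 2)) \<and>
         (p \<ge> 5 \<and> gcd d\<^sub>1 3 = 1 \<longrightarrow>
            embeds_in G (braid_group (p ^ r) Mod lower_central (pure_braid_group (p ^ r)) 3))"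
proof -
  have p3: "3 \<le> p" using assms(1,2) prime_ge_2_nat[of p] by (cases "p = 2") auto
  have d1: "odd d\<^sub>1" using assms(5,6) dvd_trans by blast
  have "d\<^sub>1 dvd p - 1" using assms(4,6) by simp
  then have "d\<^sub>1 \<le> p - 1" using p3 by (intro dvd_imp_le) auto
  moreover have "0 < d\<^sub>1" using d1 by (rule odd_pos)
  \<comment> \<open>A divisor of \<open>p - 1\<close> is too small to be a multiple of
    \<open>p\<close>; this makes a multiplier congruent to 1 modulo \<open>p\<close>
    trivial.\<close>
  ultimately have "\<not> p dvd d\<^sub>1" using p3 by (auto dest: dvd_imp_le)
  then interpret affine_action p r d\<^sub>1 \<theta> "p ^ r"
    using assms \<open>0 < d\<^sub>1\<close> by unfold_locales auto
  have "p ^ 1 \<le> p ^ r" using p3 assms(3) by (intro power_increasing) auto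
  then have n: "3 \<le> p ^ r" using p3 by simp
  obtain f where f: "f \<in> mon G K"
    using assms(10) by (auto simp: is_iso_def iso_iff_mon_epi)
  have transfer: "embeds_in G Q" if KQ: "embeds_in K Q" for Q :: "nat word set set monoid"
  proof -
    obtain h where "h \<in> mon K Q" using KQ by (auto simp: embeds_in_def)
    with f have "h \<circ> f \<in> mon G Q" by (rule mon_compose)
    then show ?thesis by (auto simp: embeds_in_def)
  qed
  have odd_order: "coprime (order K) 2" using assms(2) d1 by (simp add: order_K)
  show ?thesis
  proof (intro conjI impI)
    show "embeds_in G (braid_group (p ^ r) Mod lower_central (pure_braid_group (p ^ r)) 2)"
      by (rule transfer, rule coprime_order_embeds(1)[OF n group_K shift_perm_hom _ odd_order])
        (rule shift_perm_fixes_two)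
    assume p5: "p \<ge> 5 \<and> gcd d\<^sub>1 3 = 1"
    \<comment> \<open>Both extra conditions of part (b) enter here: they exclude elements of order
      3, which could permute a set of three points cyclically.\<close>
    have "coprime p 3" using assms(1) p5 by (intro primes_coprime) auto
    moreover have "coprime d\<^sub>1 3" using p5 by (simp add: coprime_iff_gcd_eq_1)
    ultimately have "coprime (order K) 3" by (simp add: order_K)
    then have six: "coprime (order K) 6" using odd_order coprime_mult_right_iff[of "order K" 2 3] by simp
    show "embeds_in G (braid_group (p ^ r) Mod lower_central (pure_braid_group (p ^ r)) 3)"
      by (rule transfer, rule coprime_order_embeds(2)[OF n group_K shift_perm_hom _ six])
        (rule shift_perm_fixes_two)
  qed
qed

end
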